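(* Let $\tau=\frac{1}{\sqrt2}(\sqrt2+1)^{1/4}$, let $T=T_0\cup T_1\subset\mathbb{R}^2$ with $$T_0=\{(x,y):0\le x\le1,\ 0\le y\le x\},\qquad T_1=\{(x,y):1\le x\le2,\ 0\le y\le 2-x\},$$ and for $t\in[\tau,1]$ let $\Lambda_t:T\to T$ be the map $$\Lambda_t(x,y)=\begin{cases}(t(x+y),\,t(x-y)), & (x,y)\in T_0,\\ (t(2-x+y),\,t(2-x-y)), & (x,y)\in T_1.\end{cases}$$ Then the family $(\Lambda_t)_{t\in[\tau,1]}$ is statistically stable.
   Context: $m$ is Lebesgue measure on $\mathbb{R}^2$. A Borel probability measure $\mu$ on $T$ is $\phi$-invariant if $\mu(\phi^{-1}(A))=\mu(A)$ for every Borel $A\subset T$, and absolutely continuous if $\mu(A)=0$ whenever $m(A)=0$; its density with respect to $m$ is denoted $d\mu/dm$. Statistical stability. Let $I$ be a metric space and $(\phi_t)_{t\in I}$ a family of maps of a compact set, each having some absolutely continuous invariant probability measure. The family is statistically stable if for any $t_0\in I$, any sequence $(t_n)_n$ in $I$ converging to $t_0$ and any choice of absolutely continuous $\phi_{t_n}$-invariant probability measures $\mu_{t_n}$, every subsequence of the densities $(d\mu_{t_n}/dm)_n$ has a further subsequence converging in the $L^1$-norm, and every $L^1$-limit of a subsequence is the density of an absolutely continuous $\phi_{t_0}$-invariant probability measure. It is known (earlier work of Pumariño, Rodríguez, Tatjer and Vigil) that for each $t\in[\tau,1]$ the map $\Lambda_t$ has a unique absolutely continuous invariant probability measure $\mu_t$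 (which is ergodic). Hence statistical stability of this family means that for each $t_0\in[\tau,1]$, $d\mu_t/dm$ converges in the $L^1$-norm to $d\mu_{t_0}/dm$ as $t\to t_0$ in $[\tau,1]$. *)

theory Defs
  imports "HOL-Probability.Probability"
begin

text \<open>Lebesgue measure on the Borel subsets of \<open>X\<close>.\<close>

abbreviation lborel_on :: "'a::euclidean_space set \<Rightarrow> 'a measure" where
  "lborel_on X \<equiv> restrict_space lborel X"

definition invariant_measure :: "('a \<Rightarrow> 'a) \<Rightarrow> 'a measure \<Rightarrow> bool" where
  "invariant_measure \<phi> \<mu> \<longleftrightarrow>
     \<phi> \<in> measurable \<mu> \<mu> \<and>
     (\<forall>A\<in>sets \<mu>. emeasure \<mu> (\<phi> -` A \<inter> space \<mu>) = emeasure \<mu> A)"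

text \<open>Absolutely continuous invariant Borel probability measures on \<open>X\<close>.\<close>

definition acip :: "'a::euclidean_space set \<Rightarrow> ('a \<Rightarrow> 'a) \<Rightarrow> 'a measure \<Rightarrow> bool" where
  "acip X \<phi> \<mu> \<longleftrightarrow>
     prob_space \<mu> \<and> sets \<mu> = sets (lborel_on X) \<and>
     absolutely_continuous (lborel_on X) \<mu> \<and> invariant_measure \<phi> \<mu>"

text \<open>\<^const>\<open>RN_deriv\<close> takes values in the extended reals. For an absolutely continuous
  probability measure it is finite almost everywhere, so passing to real values loses nothing.\<close>

definition leb_density :: "'a::euclidean_space set \<Rightarrow> 'a measure \<Rightarrow> 'a \<Rightarrow> real" where
  "leb_density X \<mu> = (\<lambda>x. enn2real (RN_deriv (lborel_on X) \<mu> x))"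

definition L1_tendsto :: "'a measure \<Rightarrow> (nat \<Rightarrow> 'a \<Rightarrow> real) \<Rightarrow> ('a \<Rightarrow> real) \<Rightarrow> bool" where
  "L1_tendsto M F f \<longleftrightarrow>
     (\<forall>n. integrable M (F n)) \<and> integrable M f \<and>
     (\<lambda>n. \<integral>\<^sup>+x. ennreal (norm (F n x - f x)) \<partial>M) \<longlonglongrightarrow> 0"

text \<open>The notion applies to families of maps of a compact set each of which has some absolutely
  continuous invariant probability measure; these requirements are part of the predicate, so
  that it cannot hold vacuously. Densities are classes modulo null sets, hence the equality
  almost everywhere in the last clause.\<close>

definition statistically_stable ::
  "'a::euclidean_space set \<Rightarrow> 'i::metric_space set \<Rightarrow> ('i \<Rightarrow> 'a \<Rightarrow> 'a) \<Rightarrow> bool" where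
  "statistically_stable X I \<phi> \<longleftrightarrow>
     compact X \<and> (\<forall>t\<in>I. \<phi> t ` X \<subseteq> X) \<and> (\<forall>t\<in>I. \<exists>\<mu>. acip X (\<phi> t) \<mu>) \<and>
     (\<forall>t\<^sub>0\<in>I. \<forall>t :: nat \<Rightarrow> 'i. \<forall>\<mu> :: nat \<Rightarrow> 'a measure.
        (\<forall>n. t n \<in> I) \<longrightarrow> t \<longlonglongrightarrow> t\<^sub>0 \<longrightarrow> (\<forall>n. acip X (\<phi> (t n)) (\<mu> n)) \<longrightarrow>
          (\<forall>r :: nat \<Rightarrow> nat. strict_mono r \<longrightarrow>
             (\<exists>s :: nat \<Rightarrow> nat. strict_mono s \<and>
                (\<exists>f. L1_tendsto (lborel_on X) (\<lambda>k. leb_density X (\<mu> (r (s k)))) f))) \<and>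
          (\<forall>r :: nat \<Rightarrow> nat. \<forall>f. strict_mono r \<longrightarrow>
             L1_tendsto (lborel_on X) (\<lambda>k. leb_density X (\<mu> (r k))) f \<longrightarrow>
             (\<exists>\<nu>. acip X (\<phi> t\<^sub>0) \<nu> \<and> (AE x in lborel_on X. f x = leb_density X \<nu> x))))"

definition tent_T0 :: "(real \<times> real) set" where
  "tent_T0 = {(x, y). 0 \<le> x \<and> x \<le> 1 \<and> 0 \<le> y \<and> y \<le> x}"

definition tent_T1 :: "(real \<times> real) set" where
  "tent_T1 = {(x, y). 1 \<le> x \<and> x \<le> 2 \<and> 0 \<le> y \<and> y \<le> 2 - x}"

definition tent_T :: "(real \<times> real) set" where
  "tent_T = tent_T0 \<union> tent_T1"

text \<open>The two formulas agree on the common edge \<open>x = 1\<close>. Values outside \<^const>\<open>tent_T\<close> are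
  irrelevant.\<close>

definition tent_map :: "real \<Rightarrow> real \<times> real \<Rightarrow> real \<times> real" where
  "tent_map t = (\<lambda>(x, y).
     if (x, y) \<in> tent_T0 then (t * (x + y), t * (x - y))
     else (t * (2 - x + y), t * (2 - x - y)))"

definition tent_tau :: real where
  "tent_tau = 1 / sqrt 2 * (sqrt 2 + 1) powr (1 / 4)"

end

theory Submission
  imports Defs "HOL-Library.Diagonal_Subsequence"
begin

text \<open>
  On \<^const>\<open>tent_T\<close> the map is a folding along the crease \<open>x = 1\<close> followed by a similarity of
  ratio \<open>sqrt 2 * t\<close>. Replace variation by the modulus \<open>V f s = (\<Sum>d. \<integral> \<bar>f (z + s d) - f z\<bar>)\<close>, where
  \<open>d\<close> runs through the four directions at multiples of 45 degrees, which fold and similarity permute.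
  The transfer operator \<open>P\<close> then satisfies \<open>V (P f) s \<le> V f (\<sigma> s) + (mass of a strip at the crease)\<close>
  with \<open>\<sigma> = 1 / (sqrt 2 * t)\<close>, and telescoping along translates bounds the strip mass by the part of
  \<open>V f (\<sigma> s)\<close> living near the crease, up to \<open>C s \<parallel>f\<parallel>\<close>. So after \<open>N\<close> steps the modulus grows by at most
  \<open>2^h\<close> (plus \<open>C s \<parallel>f\<parallel>\<close>), where \<open>h\<close> bounds the number of visits to the crease during \<open>N\<close> steps, while
  \<open>s\<close> has shrunk by \<open>\<sigma>^N\<close>. Following the orbits of the crease explicitly gives \<open>2^h \<sigma>^N < 1\<close> for
  suitable \<open>N\<close>, and by compactness the same \<open>N\<close> and \<open>h\<close> serve near misses of the crease and all nearby
  parameters. Hence all invariant densities for parameters near \<open>t0\<close> satisfy \<open>V h s \<le> C s\<close> with a common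
  \<open>C\<close> and are relatively compact in \<open>L\<^sup>1\<close>; limits are invariant because \<open>P\<close> depends continuously on \<open>t\<close>.
\<close>

section \<open>The transfer operator of the folding map\<close>

text \<open>Each fold can double the modulus, while one step shrinks the scale only by
  \<open>1 / (sqrt 2 * t)\<close>, at best \<open>1 / sqrt 2\<close>; so a one-step estimate never
  contracts, and visits to the crease must be counted. At \<open>tent_tau\<close> the expansion is
  \<open>(sqrt 2 + 1) powr (1 / 4)\<close>, about 1.2465. Its sixth power is below 4 and its seventh
  above 4, so two visits in seven steps are affordable there and two in six are not. The case
  distinctions on \<open>t\<close> come from this balance. Increments under translation replace
  derivatives, so that Fubini and changes of variables are enough for the estimates. An invariant
  density is a priori only integrable, and no finite bound \<open>B * s\<close> on its modulus can
  be assumed. The contraction is therefore run on Lipschitz functions, whose modulus is linear in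
  \<open>s\<close>, and carried over by approximation, as \<open>transfer\<close> does not increase
  the norm. The same estimate along the iterates of a Lipschitz density gives existence through
  Cesaro averages.\<close>

lemma measurable_fst_plane [measurable]: "fst \<in> borel_measurable (borel :: (real \<times> real) measure)"
  by (intro borel_measurable_continuous_onI continuous_intros)

lemma measurable_snd_plane [measurable]: "snd \<in> borel_measurable (borel :: (real \<times> real) measure)"
  by (intro borel_measurable_continuous_onI continuous_intros)

lemma nn_integral_plane:
  assumes [measurable]: "f \<in> borel_measurable (borel :: (real \<times> real) measure)"
  shows "(\<integral>\<^sup>+z. f z \<partial>lborel) = (\<integral>\<^sup>+x. \<integral>\<^sup>+y. f (x, y) \<partial>lborel \<partial>lborel)"
proof -
  have "f \<in> borel_measurable (lborel \<Otimes>\<^sub>M lborel)" by (simp add: lborel_prod)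
  from lborel.nn_integral_fst[OF this] show ?thesis by (simp add: lborel_prod)
qed

lemma nn_integral_plane_swap:
  assumes [measurable]: "f \<in> borel_measurable (borel :: (real \<times> real) measure)"
  shows "(\<integral>\<^sup>+x. \<integral>\<^sup>+y. f (x, y) \<partial>lborel \<partial>lborel) = (\<integral>\<^sup>+y. \<integral>\<^sup>+x. f (x, y) \<partial>lborel \<partial>lborel)"
  by (rule lborel_pair.Fubini'[symmetric]) (simp add: lborel_prod)

lemma nn_integral_shift:
  assumes [measurable]: "f \<in> borel_measurable (borel :: 'a::euclidean_space measure)"
  shows "(\<integral>\<^sup>+z. f (z + c) \<partial>lborel) = (\<integral>\<^sup>+z. f z \<partial>lborel)"
proof -
  have "(\<integral>\<^sup>+z. f z \<partial>lborel) = (\<integral>\<^sup>+z. f z \<partial>distr lborel borel ((+) c))"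
    by (simp add: lborel_distr_plus)
  also have "\<dots> = (\<integral>\<^sup>+z. f (z + c) \<partial>lborel)"
    by (subst nn_integral_distr) (auto simp: add.commute)
  finally show ?thesis by simp
qed

lemma nn_integral_reflect:
  assumes [measurable]: "f \<in> borel_measurable (borel :: (real \<times> real) measure)"
  shows "(\<integral>\<^sup>+z. f (c - fst z, snd z) \<partial>lborel) = (\<integral>\<^sup>+z. f z \<partial>lborel)"
proof -
  have "(\<integral>\<^sup>+z. f (c - fst z, snd z) \<partial>lborel) = (\<integral>\<^sup>+x. \<integral>\<^sup>+y. f (c + (-1) * x, y) \<partial>lborel \<partial>lborel)"
    by (subst nn_integral_plane) auto
  also have "\<dots> = (\<integral>\<^sup>+x. \<integral>\<^sup>+y. f (x, y) \<partial>lborel \<partial>lborel)"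
    using nn_integral_real_affine[where f="\<lambda>x. \<integral>\<^sup>+y. f (x, y) \<partial>lborel" and c="-1" and t=c] by simp
  finally show ?thesis by (simp add: nn_integral_plane)
qed

text \<open>The Jacobian is obtained by Fubini from substitutions in one variable: shifting
  \<open>x\<close> by \<open>y\<close> turns the map into the shear
  \<open>(t * x, t * (x - 2 * y))\<close>, and then each coordinate is rescaled separately.\<close>

lemma nn_integral_rotate:
  assumes [measurable]: "f \<in> borel_measurable (borel :: (real \<times> real) measure)" and t: "t > 0"
  shows "(\<integral>\<^sup>+z. f z \<partial>lborel) =
    ennreal (2 * t\<^sup>2) * (\<integral>\<^sup>+z. f (t * (fst z + snd z), t * (fst z - snd z)) \<partial>lborel)"
proof -
  have "(\<integral>\<^sup>+z. f (t * (fst z + snd z), t * (fst z - snd z)) \<partial>lborel)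
      = (\<integral>\<^sup>+y. \<integral>\<^sup>+x. f (t * (x + y), t * (x - y)) \<partial>lborel \<partial>lborel)"
    by (subst nn_integral_plane) (auto intro!: nn_integral_plane_swap[where f="\<lambda>z. f (t * (fst z + snd z), t * (fst z - snd z))", simplified])
  also have "\<dots> = (\<integral>\<^sup>+y. \<integral>\<^sup>+x. f (t * x, t * (x - 2 * y)) \<partial>lborel \<partial>lborel)"
  proof (rule nn_integral_cong)
    fix y
    show "(\<integral>\<^sup>+x. f (t * (x + y), t * (x - y)) \<partial>lborel) = (\<integral>\<^sup>+x. f (t * x, t * (x - 2 * y)) \<partial>lborel)"
      using nn_integral_shift[where f="\<lambda>x. f (t * x, t * (x - 2 * y))" and c=y]
      by (simp add: algebra_simps)
  qed
  also have "\<dots> = (\<integral>\<^sup>+x. \<integral>\<^sup>+y. f (t * x, t * (x - 2 * y)) \<partial>lborel \<partial>lborel)"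
    by (rule nn_integral_plane_swap[where f="\<lambda>z. f (t * fst z, t * (fst z - 2 * snd z))", simplified, symmetric])
  finally have 1: "(\<integral>\<^sup>+z. f (t * (fst z + snd z), t * (fst z - snd z)) \<partial>lborel)
      = (\<integral>\<^sup>+x. \<integral>\<^sup>+y. f (t * x, t * (x - 2 * y)) \<partial>lborel \<partial>lborel)" .
  have "(\<integral>\<^sup>+z. f z \<partial>lborel) = (\<integral>\<^sup>+x. \<integral>\<^sup>+y. f (x, y) \<partial>lborel \<partial>lborel)"
    by (rule nn_integral_plane) auto
  also have "\<dots> = ennreal t * (\<integral>\<^sup>+x. \<integral>\<^sup>+y. f (t * x, y) \<partial>lborel \<partial>lborel)"
    by (subst nn_integral_real_affine[where c=t and t=0]) (use t in auto)
  also have "(\<integral>\<^sup>+x. \<integral>\<^sup>+y. f (t * x, y) \<partial>lborel \<partial>lborel)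
      = (\<integral>\<^sup>+x. ennreal (2 * t) * (\<integral>\<^sup>+y. f (t * x, t * x + (- 2 * t) * y) \<partial>lborel) \<partial>lborel)"
    by (rule nn_integral_cong, subst nn_integral_real_affine[where c="- 2 * t"]) (use t in \<open>auto simp: abs_mult\<close>)
  also have "\<dots> = ennreal (2 * t) * (\<integral>\<^sup>+x. \<integral>\<^sup>+y. f (t * x, t * (x - 2 * y)) \<partial>lborel \<partial>lborel)"
    by (subst nn_integral_cmult[symmetric]) (auto simp: algebra_simps)
  finally show ?thesis
    using t unfolding 1 by (simp add: mult.assoc[symmetric] ennreal_mult[symmetric] power2_eq_square mult.commute[of t 2])
qed

text \<open>A single continuous formula for both branches, valid on the whole plane;
  \<open>1 - \<bar>fst z - 1\<bar>\<close> is the first coordinate folded at the crease. Increments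
  also look at points slightly outside \<open>tent_T\<close>, where the values of
  \<open>tent_map\<close> mean nothing.\<close>

definition fold_map :: "real \<Rightarrow> real \<times> real \<Rightarrow> real \<times> real" where
  "fold_map t z = (t * (1 - \<bar>fst z - 1\<bar> + snd z), t * (1 - \<bar>fst z - 1\<bar> - snd z))"

text \<open>The fibre over points of the crease is set to \<open>0\<close>; this changes a null set only.\<close>

definition transfer :: "real \<Rightarrow> (real \<times> real \<Rightarrow> real) \<Rightarrow> real \<times> real \<Rightarrow> real" where
  "transfer t f z =
     (let a = (fst z + snd z) / (2 * t); b = (fst z - snd z) / (2 * t)
      in if a < 1 then (f (a, b) + f (2 - a, b)) / (2 * t\<^sup>2) else 0)"

lemma measurable_transfer [measurable]:
  assumes [measurable]: "f \<in> borel_measurable borel"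
  shows "transfer t f \<in> borel_measurable borel"
  unfolding transfer_def Let_def by measurable

lemma continuous_fold_map: "continuous_on UNIV (fold_map t)"
  unfolding fold_map_def by (intro continuous_intros)

lemma measurable_fold_map [measurable]: "fold_map t \<in> borel_measurable borel"
  by (intro borel_measurable_continuous_onI continuous_fold_map)

lemma transfer_rotate:
  assumes "t > 0"
  shows "transfer t f (t * (fst z + snd z), t * (fst z - snd z)) =
    (if fst z < 1 then (f z + f (2 - fst z, snd z)) / (2 * t\<^sup>2) else 0)"
proof -
  have "(t * (fst z + snd z) + t * (fst z - snd z)) / (2 * t) = fst z"
    "(t * (fst z + snd z) - t * (fst z - snd z)) / (2 * t) = snd z"
    using assms by (auto simp: field_simps)
  then show ?thesis by (simp add: transfer_def Let_def)
qed

lemma AE_fst_neq: "AE z in (lborel :: (real \<times> real) measure). fst z \<noteq> c"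
proof -
  have "emeasure (lborel \<Otimes>\<^sub>M lborel) ({c} \<times> (UNIV::real set)) = 0"
    by (subst lborel.emeasure_pair_measure_Times) auto
  then have "{c} \<times> (UNIV::real set) \<in> null_sets lborel"
    by (intro null_setsI) (auto simp: lborel_prod[symmetric])
  then show ?thesis
    by (rule AE_I') auto
qed

lemma nn_integral_fold:
  assumes [measurable]: "H \<in> borel_measurable (borel :: (real \<times> real) measure)"
  shows "(\<integral>\<^sup>+z. (if fst z < 1 then H z + H (2 - fst z, snd z) else 0) \<partial>lborel) = (\<integral>\<^sup>+z. H z \<partial>lborel)"
proof -
  have "(\<integral>\<^sup>+z. (if fst z < 1 then H z + H (2 - fst z, snd z) else 0) \<partial>lborel)
    = (\<integral>\<^sup>+z. (if fst z < 1 then H z else 0) + (if fst z < 1 then H (2 - fst z, snd z) else 0) \<partial>lborel)"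
    by (intro nn_integral_cong) auto
  also have "\<dots> = (\<integral>\<^sup>+z. (if fst z < 1 then H z else 0) \<partial>lborel) +
      (\<integral>\<^sup>+z. (if fst z < 1 then H (2 - fst z, snd z) else 0) \<partial>lborel)"
    by (rule nn_integral_add) measurable
  also have "(\<integral>\<^sup>+z. (if fst z < 1 then H (2 - fst z, snd z) else 0) \<partial>lborel) = (\<integral>\<^sup>+z. (if fst z > 1 then H z else 0) \<partial>lborel)"
    by (subst nn_integral_reflect[where c=2 and f="\<lambda>z. if fst z > 1 then H z else 0", symmetric])
      (auto intro!: nn_integral_cong)
  also have "(\<integral>\<^sup>+z. (if fst z < 1 then H z else 0) \<partial>lborel) + \<dots> =
      (\<integral>\<^sup>+z. (if fst z < 1 then H z else 0) + (if fst z > 1 then H z else 0) \<partial>lborel)"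
    by (rule nn_integral_add[symmetric]) measurable
  also have "\<dots> = (\<integral>\<^sup>+z. H z \<partial>lborel)"
    by (rule nn_integral_cong_AE) (use AE_fst_neq[of 1] in eventually_elim, auto)
  finally show ?thesis .
qed

lemma fold_map_reflect: "fold_map t (2 - fst z, snd z) = fold_map t z"
  by (auto simp: fold_map_def)

lemma fold_map_left: "fst z \<le> 1 \<Longrightarrow> fold_map t z = (t * (fst z + snd z), t * (fst z - snd z))"
  by (auto simp: fold_map_def)

text \<open>Duality: \<open>transfer t f\<close> is the density of the image under
  \<open>fold_map t\<close> of the measure with density \<open>f\<close>. Mass preservation and the
  link between fixed points and invariant measures both rest on this.\<close>

lemma nn_integral_transfer:
  assumes [measurable]: "f \<in> borel_measurable borel" "g \<in> borel_measurable borel"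
    and f: "\<And>z. f z \<ge> 0" and t: "t > 0"
  shows "(\<integral>\<^sup>+z. ennreal (transfer t f z) * g z \<partial>lborel) = (\<integral>\<^sup>+z. ennreal (f z) * g (fold_map t z) \<partial>lborel)"
proof -
  have "(\<integral>\<^sup>+z. ennreal (transfer t f z) * g z \<partial>lborel) = (\<integral>\<^sup>+z. ennreal (2 * t\<^sup>2) *
      (ennreal (if fst z < 1 then (f z + f (2 - fst z, snd z)) / (2 * t\<^sup>2) else 0) *
       g (t * (fst z + snd z), t * (fst z - snd z))) \<partial>lborel)"
    by (subst nn_integral_rotate[OF _ t], measurable, subst nn_integral_cmult[symmetric])
      (auto simp: transfer_rotate[OF t])
  also have "\<dots> = (\<integral>\<^sup>+z. (if fst z < 1 then ennreal (f z) * g (fold_map t z) +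
      ennreal (f (2 - fst z, snd z)) * g (fold_map t (2 - fst z, snd z)) else 0) \<partial>lborel)"
  proof (intro nn_integral_cong)
    fix z :: "real \<times> real"
    define c where "c = 2 * t\<^sup>2"
    have c: "c > 0" using t by (simp add: c_def)
    have *: "ennreal c * (ennreal ((x + y) / c) * G) = ennreal x * G + ennreal y * G" if "x \<ge> 0" "y \<ge> 0" for x y G
      using that c by (simp add: mult.assoc[symmetric] ennreal_mult[symmetric] distrib_right)
    show "ennreal (2 * t\<^sup>2) *
      (ennreal (if fst z < 1 then (f z + f (2 - fst z, snd z)) / (2 * t\<^sup>2) else 0) *
       g (t * (fst z + snd z), t * (fst z - snd z))) = (if fst z < 1 then ennreal (f z) * g (fold_map t z) +
      ennreal (f (2 - fst z, snd z)) * g (fold_map t (2 - fst z, snd z)) else 0)"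
      using * f unfolding c_def[symmetric] by (simp add: fold_map_reflect fold_map_left)
  qed
  also have "\<dots> = (\<integral>\<^sup>+z. ennreal (f z) * g (fold_map t z) \<partial>lborel)"
    by (rule nn_integral_fold) measurable
  finally show ?thesis .
qed

lemma abs_transfer_le: "\<bar>transfer t f z\<bar> \<le> transfer t (\<lambda>z. \<bar>f z\<bar>) z"
  by (auto simp: transfer_def Let_def abs_mult intro!: divide_right_mono)

lemma transfer_diff: "transfer t (\<lambda>z. f z - g z) z = transfer t f z - transfer t g z"
  by (auto simp: transfer_def Let_def diff_divide_distrib[symmetric])

definition L1norm :: "('a::euclidean_space \<Rightarrow> real) \<Rightarrow> ennreal" where
  "L1norm f = (\<integral>\<^sup>+z. ennreal \<bar>f z\<bar> \<partial>lborel)"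

lemma L1norm_transfer_le:
  assumes [measurable]: "f \<in> borel_measurable borel" and t: "t > 0"
  shows "L1norm (transfer t f) \<le> L1norm f"
proof -
  have "L1norm (transfer t f) \<le> (\<integral>\<^sup>+z. ennreal (transfer t (\<lambda>z. \<bar>f z\<bar>) z) * 1 \<partial>lborel)"
    unfolding L1norm_def by (intro nn_integral_mono) (auto intro!: ennreal_leI abs_transfer_le)
  also have "\<dots> = L1norm f"
    by (subst nn_integral_transfer[OF _ _ _ t]) (auto simp: L1norm_def)
  finally show ?thesis .
qed

section \<open>Mass of a strip along the crease\<close>

lemma sum_at_most_one:
  fixes c :: "nat \<Rightarrow> ennreal"
  assumes "\<And>j j'. j \<in> J \<Longrightarrow> j' \<in> J \<Longrightarrow> B j \<Longrightarrow> B j' \<Longrightarrow> j = j'"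
    and "\<And>j. j \<in> J \<Longrightarrow> B j \<Longrightarrow> c j \<le> m" and "finite J"
  shows "(\<Sum>j\<in>J. if B j then c j else 0) \<le> m"
proof (cases "\<exists>i\<in>J. B i")
  case True
  then obtain i where i: "i \<in> J" "B i" by auto
  have "(\<Sum>j\<in>J. if B j then c j else 0) = (\<Sum>j\<in>J. if i = j then c j else 0)"
    by (intro sum.cong) (use assms(1) i in auto)
  then show ?thesis using i assms(2,3) by simp
next
  case False
  then have "(\<Sum>j\<in>J. if B j then c j else 0) = 0" by (intro sum.neutral) auto
  then show ?thesis by simp
qed

lemma abs_le_telescope:
  fixes a :: "nat \<Rightarrow> real"
  shows "\<bar>a 0\<bar> \<le> (\<Sum>j=1..k. \<bar>a (j - 1) - a j\<bar>) + \<bar>a k\<bar>"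
  by (induction k) auto

text \<open>Averaging over the endpoint \<open>k\<close> of the telescope spreads the leftover term
  over all \<open>k\<close>, each with weight \<open>1 / K\<close>. After integration over disjoint
  strips it costs only the fraction \<open>1 / K\<close> of the norm.\<close>

lemma abs_le_telescope_average:
  fixes a :: "nat \<Rightarrow> real"
  assumes "K > 0"
  shows "\<bar>a 0\<bar> \<le> (\<Sum>j=1..K. \<bar>a (j - 1) - a j\<bar> + (1 / real K) * \<bar>a j\<bar>)"
proof -
  have "\<bar>a 0\<bar> \<le> (\<Sum>j=1..K. \<bar>a (j - 1) - a j\<bar>) + \<bar>a k\<bar>" if "k \<in> {1..K}" for k
  proof -
    have "(\<Sum>j=1..k. \<bar>a (j - 1) - a j\<bar>) \<le> (\<Sum>j=1..K. \<bar>a (j - 1) - a j\<bar>)"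
      using that by (intro sum_mono2) auto
    then show ?thesis using abs_le_telescope[of a k] by linarith
  qed
  then have "(\<Sum>k=1..K. \<bar>a 0\<bar>) \<le> (\<Sum>k=1..K. (\<Sum>j=1..K. \<bar>a (j - 1) - a j\<bar>) + \<bar>a k\<bar>)"
    by (rule sum_mono)
  then have "K * \<bar>a 0\<bar> \<le> K * (\<Sum>j=1..K. \<bar>a (j - 1) - a j\<bar>) + (\<Sum>k=1..K. \<bar>a k\<bar>)"
    by (simp add: sum.distrib)
  then have "\<bar>a 0\<bar> \<le> (\<Sum>j=1..K. \<bar>a (j - 1) - a j\<bar>) + (1 / real K) * (\<Sum>k=1..K. \<bar>a k\<bar>)"
    using assms by (simp add: field_simps)
  then show ?thesis by (simp only: sum.distrib sum_distrib_left)
qed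

text \<open>A value on the strip is compared with the average over its \<open>K\<close> translates by \<open>- j u\<close>. The translated
  strips are disjoint, so each increment of \<open>g\<close> near the crease is used only once more.\<close>

lemma strip_estimate:
  fixes g :: "real \<times> real \<Rightarrow> real" and a W :: "real \<times> real \<Rightarrow> ennreal" and K :: nat
  assumes [measurable]: "g \<in> borel_measurable borel" "a \<in> borel_measurable borel" "W \<in> borel_measurable borel"
    and K: "K > 0" and u: "fst u \<ge> 0" and M: "\<And>z. a z \<le> M"
    and W1: "\<And>z. a z \<le> W z"
    and W2: "\<And>z j. 1 \<le> j \<Longrightarrow> j \<le> K \<Longrightarrow> 1 - (real j + 1) * fst u \<le> fst z \<Longrightarrow> fst z < 1 - real j * fst u
      \<Longrightarrow> a z + a (z + real j *\<^sub>R u) \<le> W z"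
  shows "(\<integral>\<^sup>+z. a z * ennreal \<bar>(if fst (z + u) < 1 then g (z + u) else 0) - (if fst z < 1 then g z else 0)\<bar> \<partial>lborel)
    \<le> (\<integral>\<^sup>+z. (if fst (z + u) < 1 then W z * ennreal \<bar>g (z + u) - g z\<bar> else 0) \<partial>lborel) + M * ennreal (1 / real K) * L1norm g"
proof -
  \<comment> \<open>\<open>B 0\<close> is the strip whose points are carried across the crease by
    \<open>u\<close>, and \<open>B j\<close> is \<open>B 0\<close> moved back by \<open>j\<close>
    translations. For \<open>fst u = 0\<close> all strips are empty.\<close>
  define B where "B j z \<longleftrightarrow> 1 - (real j + 1) * fst u \<le> fst z \<and> fst z < 1 - real j * fst u" for j and z :: "real \<times> real"
  have [measurable]: "Measurable.pred borel (B j)" for j unfolding B_def by measurable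
  define D where "D z = ennreal \<bar>g (z + u) - g z\<bar>" for z
  have [measurable]: "D \<in> borel_measurable borel" unfolding D_def by measurable
  have B_shift: "B 0 (z + real j *\<^sub>R u) \<longleftrightarrow> B j z" for z j
    by (auto simp: B_def algebra_simps)
  have B_unique: "j = j'" if "B j z" "B j' z" for j j' z
  proof (rule ccontr)
    assume "j \<noteq> j'"
    have *: False if "i < i'" "B i z" "B i' z" for i i' :: nat
    proof -
      have "(real i + 1) * fst u \<le> real i' * fst u"
        using that(1) u by (intro mult_right_mono) auto
      then show False using that(2,3) by (auto simp: B_def)
    qed
    show False using \<open>j \<noteq> j'\<close> *[of j j'] *[of j' j] that by (meson linorder_neq_iff)
  qed
  define Y where "Y z = D z + ennreal (1 / real K) * ennreal \<bar>g z\<bar>" for z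
  have [measurable]: "Y \<in> borel_measurable borel" unfolding Y_def by measurable
  have tele: "ennreal \<bar>g z\<bar> \<le> (\<Sum>j=1..K. Y (z + real j *\<^sub>R (- u)))" for z
  proof -
    have "\<bar>g z\<bar> \<le> (\<Sum>j=1..K. \<bar>g (z + real (j - 1) *\<^sub>R (- u)) - g (z + real j *\<^sub>R (- u))\<bar>
        + (1 / real K) * \<bar>g (z + real j *\<^sub>R (- u))\<bar>)"
      using abs_le_telescope_average[OF K, of "\<lambda>j. g (z + real j *\<^sub>R (- u))"] by simp
    also have "\<dots> = (\<Sum>j=1..K. \<bar>g (z + real j *\<^sub>R (- u) + u) - g (z + real j *\<^sub>R (- u))\<bar>
        + (1 / real K) * \<bar>g (z + real j *\<^sub>R (- u))\<bar>)"
      by (intro sum.cong) (auto simp: of_nat_diff algebra_simps)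
    finally have "ennreal \<bar>g z\<bar> \<le> ennreal (\<Sum>j=1..K. \<bar>g (z + real j *\<^sub>R (- u) + u) - g (z + real j *\<^sub>R (- u))\<bar>
        + (1 / real K) * \<bar>g (z + real j *\<^sub>R (- u))\<bar>)" by (rule ennreal_leI)
    also have "\<dots> = (\<Sum>j=1..K. Y (z + real j *\<^sub>R (- u)))"
      unfolding Y_def D_def by (subst sum_ennreal[symmetric]) (auto intro!: sum.cong simp: ennreal_mult[symmetric])
    finally show ?thesis .
  qed
  \<comment> \<open>On the strip \<open>B 0\<close> the cut-off function is zero at
    \<open>z + u\<close>, so its increment is the full value of \<open>g\<close> at
    \<open>z\<close>; this is the mass to be traded for increments.\<close>
  let ?S = "\<lambda>z. if B 0 z then a z * ennreal \<bar>g z\<bar> else 0"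
  have "(\<integral>\<^sup>+z. ?S z \<partial>lborel) \<le> (\<integral>\<^sup>+z. (\<Sum>j=1..K. if B 0 z then a z * Y (z + real j *\<^sub>R (- u)) else 0) \<partial>lborel)"
  proof (intro nn_integral_mono)
    fix z
    show "?S z \<le> (\<Sum>j=1..K. if B 0 z then a z * Y (z + real j *\<^sub>R (- u)) else 0)"
      using mult_left_mono[OF tele[of z], of "a z"] by (cases "B 0 z") (simp_all add: sum_distrib_left)
  qed
  also have "\<dots> = (\<Sum>j=1..K. \<integral>\<^sup>+z. (if B 0 z then a z * Y (z + real j *\<^sub>R (- u)) else 0) \<partial>lborel)"
    by (rule nn_integral_sum) measurable
  also have "\<dots> = (\<Sum>j=1..K. \<integral>\<^sup>+z. (if B j z then a (z + real j *\<^sub>R u) * Y z else 0) \<partial>lborel)"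
  proof (intro sum.cong refl)
    fix j
    show "(\<integral>\<^sup>+z. (if B 0 z then a z * Y (z + real j *\<^sub>R (- u)) else 0) \<partial>lborel)
      = (\<integral>\<^sup>+z. (if B j z then a (z + real j *\<^sub>R u) * Y z else 0) \<partial>lborel)"
      by (subst nn_integral_shift[where c="real j *\<^sub>R u", symmetric]) (auto simp: B_shift cong: if_cong)
  qed
  also have "\<dots> = (\<integral>\<^sup>+z. (\<Sum>j=1..K. if B j z then a (z + real j *\<^sub>R u) * Y z else 0) \<partial>lborel)"
    by (rule nn_integral_sum[symmetric]) measurable
  finally have S: "(\<integral>\<^sup>+z. ?S z \<partial>lborel) \<le> (\<integral>\<^sup>+z. (\<Sum>j=1..K. if B j z then a (z + real j *\<^sub>R u) * Y z else 0) \<partial>lborel)" .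
  have "(\<integral>\<^sup>+z. a z * ennreal \<bar>(if fst (z + u) < 1 then g (z + u) else 0) - (if fst z < 1 then g z else 0)\<bar> \<partial>lborel)
      = (\<integral>\<^sup>+z. (if fst (z + u) < 1 then a z * D z else 0) + ?S z \<partial>lborel)"
    by (intro nn_integral_cong) (use u in \<open>auto simp: B_def D_def\<close>)
  also have "\<dots> = (\<integral>\<^sup>+z. (if fst (z + u) < 1 then a z * D z else 0) \<partial>lborel) + (\<integral>\<^sup>+z. ?S z \<partial>lborel)"
    by (rule nn_integral_add) measurable
  also have "\<dots> \<le> (\<integral>\<^sup>+z. (if fst (z + u) < 1 then a z * D z else 0) \<partial>lborel) +
      (\<integral>\<^sup>+z. (\<Sum>j=1..K. if B j z then a (z + real j *\<^sub>R u) * Y z else 0) \<partial>lborel)"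
    using S by (rule add_left_mono)
  also have "\<dots> = (\<integral>\<^sup>+z. (if fst (z + u) < 1 then a z * D z else 0) +
      (\<Sum>j=1..K. if B j z then a (z + real j *\<^sub>R u) * Y z else 0) \<partial>lborel)"
    by (rule nn_integral_add[symmetric]) measurable
  also have "\<dots> \<le> (\<integral>\<^sup>+z. (if fst (z + u) < 1 then W z * D z else 0) + M * ennreal (1 / real K) * ennreal \<bar>g z\<bar> \<partial>lborel)"
  proof (intro nn_integral_mono)
    fix z :: "real \<times> real"
    have "(\<Sum>j=1..K. if B j z then a (z + real j *\<^sub>R u) * Y z else 0)
      = (\<Sum>j=1..K. (if B j z then a (z + real j *\<^sub>R u) * D z else 0) + (if B j z then a (z + real j *\<^sub>R u) * (ennreal (1 / real K) * ennreal \<bar>g z\<bar>) else 0))"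
      by (intro sum.cong) (auto simp: Y_def distrib_left)
    also have "\<dots> = (\<Sum>j=1..K. (if B j z then a (z + real j *\<^sub>R u) * D z else 0)) +
        (\<Sum>j=1..K. (if B j z then a (z + real j *\<^sub>R u) * (ennreal (1 / real K) * ennreal \<bar>g z\<bar>) else 0))"
      by (rule sum.distrib)
    finally have 1: "(\<Sum>j=1..K. if B j z then a (z + real j *\<^sub>R u) * Y z else 0) = \<dots>" .
    \<comment> \<open>The strips are disjoint, so at each point at most one of the leftover terms is
      present.\<close>
    have 2: "(\<Sum>j=1..K. (if B j z then a (z + real j *\<^sub>R u) * (ennreal (1 / real K) * ennreal \<bar>g z\<bar>) else 0))
        \<le> M * ennreal (1 / real K) * ennreal \<bar>g z\<bar>"
      by (rule sum_at_most_one) (auto simp: mult.assoc intro!: mult_right_mono M dest: B_unique)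
    \<comment> \<open>The increment at \<open>z\<close> is used twice: with weight
      \<open>a z\<close> as itself, and with weight \<open>a (z + real j *\<^sub>R u)\<close> in the
      telescope of the one strip point lying \<open>j\<close> translations ahead. \<open>W2\<close>
      pays for both together.\<close>
    have 3: "(if fst (z + u) < 1 then a z * D z else 0) + (\<Sum>j=1..K. (if B j z then a (z + real j *\<^sub>R u) * D z else 0))
        \<le> (if fst (z + u) < 1 then W z * D z else 0)"
    proof (cases "\<exists>j\<in>{1..K}. B j z")
      case True
      then obtain j where j: "1 \<le> j" "j \<le> K" "B j z" by auto
      have "1 * fst u \<le> real j * fst u" using j u by (intro mult_right_mono) auto
      then have *: "fst (z + u) < 1" using j(3) by (auto simp: B_def)
      have "(\<Sum>i=1..K. (if B i z then a (z + real i *\<^sub>R u) * D z else 0)) \<le> a (z + real j *\<^sub>R u) * D z"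
        proof (rule sum_at_most_one)
        fix i assume "B i z"
        then have "i = j" using j(3) by (rule B_unique)
        then show "a (z + real i *\<^sub>R u) * D z \<le> a (z + real j *\<^sub>R u) * D z" by simp
      qed (use B_unique in auto)
      then have "a z * D z + (\<Sum>j=1..K. (if B j z then a (z + real j *\<^sub>R u) * D z else 0)) \<le> (a z + a (z + real j *\<^sub>R u)) * D z"
        by (simp add: distrib_right)
      also have "\<dots> \<le> W z * D z"
        using W2[OF j(1,2)] j(3) by (intro mult_right_mono) (auto simp: B_def)
      finally show ?thesis using * by simp
    next
      case False
      then have "(\<Sum>j=1..K. (if B j z then a (z + real j *\<^sub>R u) * D z else 0)) = 0"
        by (intro sum.neutral) auto
      then show ?thesis using mult_right_mono[OF W1[of z], of "D z"] by simp
    qed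
    show "(if fst (z + u) < 1 then a z * D z else 0) +
      (\<Sum>j=1..K. if B j z then a (z + real j *\<^sub>R u) * Y z else 0)
      \<le> (if fst (z + u) < 1 then W z * D z else 0) + M * ennreal (1 / real K) * ennreal \<bar>g z\<bar>"
      unfolding 1 add.assoc[symmetric] by (rule add_mono[OF 3 2])
  qed
  also have "\<dots> = (\<integral>\<^sup>+z. (if fst (z + u) < 1 then W z * D z else 0) \<partial>lborel) + (\<integral>\<^sup>+z. M * ennreal (1 / real K) * ennreal \<bar>g z\<bar> \<partial>lborel)"
    by (rule nn_integral_add) measurable
  also have "(\<integral>\<^sup>+z. M * ennreal (1 / real K) * ennreal \<bar>g z\<bar> \<partial>lborel) = M * ennreal (1 / real K) * L1norm g"
    unfolding L1norm_def by (rule nn_integral_cmult) measurable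
  finally show ?thesis unfolding D_def .
qed


section \<open>Weighted increments and the modulus in four directions\<close>

definition incr :: "('a::euclidean_space \<Rightarrow> ennreal) \<Rightarrow> ('a \<Rightarrow> real) \<Rightarrow> 'a \<Rightarrow> ennreal" where
  "incr w f u = (\<integral>\<^sup>+z. w z * ennreal \<bar>f (z + u) - f z\<bar> \<partial>lborel)"

definition variation :: "(real \<times> real \<Rightarrow> ennreal) \<Rightarrow> (real \<times> real \<Rightarrow> real) \<Rightarrow> real \<Rightarrow> ennreal" where
  "variation w f s = incr w f (s, 0) + incr w f (0, s) +
     incr w f (s / sqrt 2, s / sqrt 2) + incr w f (s / sqrt 2, - s / sqrt 2)"

abbreviation incr1 :: "('a::euclidean_space \<Rightarrow> real) \<Rightarrow> 'a \<Rightarrow> ennreal" where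
  "incr1 \<equiv> incr (\<lambda>_. 1)"

abbreviation modulus :: "(real \<times> real \<Rightarrow> real) \<Rightarrow> real \<Rightarrow> ennreal" where
  "modulus \<equiv> variation (\<lambda>_. 1)"

text \<open>Since \<open>u\<close> does not point to the left, \<open>fst (z + u) < 1\<close> forces
  \<open>fst z < 1\<close>; the two regions of base points are disjoint and increments across the
  crease are dropped.\<close>

lemma incr_split:
  assumes [measurable]: "f \<in> borel_measurable borel" "w \<in> borel_measurable borel" and u: "fst u \<ge> 0"
  shows "(\<integral>\<^sup>+z. (if fst (z + u) < 1 then w z * ennreal \<bar>f (z + u) - f z\<bar> else 0) \<partial>lborel) +
    (\<integral>\<^sup>+z. (if fst z > 1 then w z * ennreal \<bar>f (z + u) - f z\<bar> else 0) \<partial>lborel) \<le> incr w f (u :: real \<times> real)"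
  unfolding incr_def
  by (subst nn_integral_add[symmetric]) (use u in \<open>auto intro!: nn_integral_mono\<close>)

text \<open>\<open>\<gamma>\<close> selects the base point of the reflected increment: with \<open>\<gamma> = 1\<close> it is again an increment along
  a vector pointing to the right, and \<open>\<gamma> = 0\<close> serves vertical \<open>u\<close>, which the reflection preserves.\<close>

lemma transfer_incr:
  fixes w w' :: "real \<times> real \<Rightarrow> ennreal" and u :: "real \<times> real"
  defines "R \<equiv> \<lambda>z :: real \<times> real. (2 - fst z, snd z)"
  assumes [measurable]: "f \<in> borel_measurable borel" "w \<in> borel_measurable borel" "w' \<in> borel_measurable borel"
    and t: "t > 0" and u: "fst u \<ge> 0" and K: "K > 0" and M: "\<And>z. w z \<le> M" and \<rho>: "(real K + 1) * norm u \<le> \<rho>"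
    and w1: "\<And>x x'. dist x x' \<le> \<rho> \<Longrightarrow> w (fold_map t x') \<le> w' x"
    and w2: "\<And>x x'. \<bar>fst x - 1\<bar> \<le> \<rho> \<Longrightarrow> dist x x' \<le> \<rho> \<Longrightarrow> 2 * w (fold_map t x') \<le> w' x"
    and \<gamma>: "\<gamma> \<in> {0, 1}"
  shows "incr w (transfer t f) (t * (fst u + snd u), t * (fst u - snd u)) \<le>
    (\<integral>\<^sup>+z. (if fst (z + u) < 1 then w' z * ennreal \<bar>f (z + u) - f z\<bar> else 0) \<partial>lborel) +
    (\<integral>\<^sup>+z. (if fst (z + u) < 1 then w' (R (z + \<gamma> *\<^sub>R u)) * ennreal \<bar>f (R (z + u)) - f (R z)\<bar> else 0) \<partial>lborel) +
    2 * (M * ennreal (1 / real K) * L1norm f)"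
proof -
  define A where "A z = (t * (fst z + snd z), t * (fst z - snd z))" for z :: "real \<times> real"
  \<comment> \<open>\<open>F f\<close> and \<open>F (f \<circ> R)\<close> are the contributions of
    the two inverse branches, seen on the left half-plane. Cutting them off at the crease creates
    the jump that \<open>strip_estimate\<close> deals with.\<close>
  define F where "F g z = (if fst z < 1 then g z else 0)" for g :: "real \<times> real \<Rightarrow> real" and z :: "real \<times> real"
  have [measurable]: "R \<in> borel_measurable borel" unfolding R_def by measurable
  have [measurable]: "A \<in> borel_measurable borel" unfolding A_def by measurable
  have [measurable]: "F g \<in> borel_measurable borel" if [measurable]: "g \<in> borel_measurable borel" for g unfolding F_def by measurable
  have nu: "norm u \<le> \<rho>" "real K * norm u \<le> \<rho>" "0 \<le> \<rho>"
  proof -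
    have "1 * norm u \<le> (real K + 1) * norm u" "real K * norm u \<le> (real K + 1) * norm u"
      by (intro mult_right_mono; simp)+
    then show "norm u \<le> \<rho>" "real K * norm u \<le> \<rho>" using \<rho> by auto
    then show "0 \<le> \<rho>" using norm_ge_zero order_trans by blast
  qed
  have fu: "(real j + 1) * fst u \<le> \<rho>" if "j \<le> K" for j
  proof -
    have "fst u \<le> norm u" using norm_fst_le[of "fst u" "snd u"] by simp
    then have "(real j + 1) * fst u \<le> (real K + 1) * norm u"
      using that u by (intro mult_mono) auto
    then show ?thesis using \<rho> by simp
  qed
  have dR: "dist (R x) (R y) = dist x y" for x y
    by (auto simp: R_def dist_prod_def dist_real_def power2_commute)
  have AR: "A (z + u) = A z + A u" for z by (auto simp: A_def algebra_simps)
  have "incr w (transfer t f) (A u) = ennreal (2 * t\<^sup>2) * (\<integral>\<^sup>+z. w (A z) * ennreal \<bar>transfer t f (A z + A u) - transfer t f (A z)\<bar> \<partial>lborel)"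
    unfolding incr_def by (subst nn_integral_rotate[OF _ t]) (auto simp: A_def)
  also have "\<dots> = (\<integral>\<^sup>+z. ennreal (2 * t\<^sup>2) * (w (A z) * ennreal \<bar>transfer t f (A z + A u) - transfer t f (A z)\<bar>) \<partial>lborel)"
    by (rule nn_integral_cmult[symmetric]) measurable
  also have "\<dots> \<le> (\<integral>\<^sup>+z. w (fold_map t z) * ennreal \<bar>F f (z + u) - F f z\<bar> +
      w (fold_map t z) * ennreal \<bar>F (f \<circ> R) (z + u) - F (f \<circ> R) z\<bar> \<partial>lborel)"
  proof (intro nn_integral_mono)
    fix z
    have tr: "transfer t f (A z) = (F f z + F (f \<circ> R) z) / (2 * t\<^sup>2)" for z
      unfolding A_def by (subst transfer_rotate[OF t]) (auto simp: F_def R_def)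
    have "2 * t\<^sup>2 * \<bar>transfer t f (A z + A u) - transfer t f (A z)\<bar> = \<bar>2 * t\<^sup>2 * (transfer t f (A z + A u) - transfer t f (A z))\<bar>"
      by (simp add: abs_mult)
    also have "2 * t\<^sup>2 * (transfer t f (A z + A u) - transfer t f (A z)) = (F f (z + u) + F (f \<circ> R) (z + u)) - (F f z + F (f \<circ> R) z)"
      unfolding AR[symmetric] tr using t by (simp add: field_simps)
    also have "\<bar>\<dots>\<bar> \<le> \<bar>F f (z + u) - F f z\<bar> + \<bar>F (f \<circ> R) (z + u) - F (f \<circ> R) z\<bar>" by linarith
    finally have 1: "2 * t\<^sup>2 * \<bar>transfer t f (A z + A u) - transfer t f (A z)\<bar> \<le> \<bar>F f (z + u) - F f z\<bar> + \<bar>F (f \<circ> R) (z + u) - F (f \<circ> R) z\<bar>" .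
    show "ennreal (2 * t\<^sup>2) * (w (A z) * ennreal \<bar>transfer t f (A z + A u) - transfer t f (A z)\<bar>) \<le>
      w (fold_map t z) * ennreal \<bar>F f (z + u) - F f z\<bar> + w (fold_map t z) * ennreal \<bar>F (f \<circ> R) (z + u) - F (f \<circ> R) z\<bar>"
    proof (cases "fst z < 1")
      case True
      then have wA: "w (fold_map t z) = w (A z)" by (simp add: fold_map_left A_def)
      have "ennreal (2 * t\<^sup>2) * (w (A z) * ennreal \<bar>transfer t f (A z + A u) - transfer t f (A z)\<bar>)
        = w (A z) * ennreal (2 * t\<^sup>2 * \<bar>transfer t f (A z + A u) - transfer t f (A z)\<bar>)"
        by (simp add: ennreal_mult' mult_ac)
      also have "\<dots> \<le> w (A z) * ennreal (\<bar>F f (z + u) - F f z\<bar> + \<bar>F (f \<circ> R) (z + u) - F (f \<circ> R) z\<bar>)"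
        by (intro mult_left_mono ennreal_leI 1) auto
      finally show ?thesis by (simp add: wA distrib_left)
    next
      \<comment> \<open>As \<open>u\<close> does not point to the left, \<open>z + u\<close> is
        beyond the crease as well and both sides vanish.\<close>
      case False
      then have "F g (z + u) = 0 \<and> F g z = 0" for g using u by (simp add: F_def)
      then have "\<bar>transfer t f (A z + A u) - transfer t f (A z)\<bar> = 0"
        unfolding AR[symmetric] tr by simp
      then show ?thesis by simp
    qed
  qed
  also have "\<dots> = (\<integral>\<^sup>+z. w (fold_map t z) * ennreal \<bar>F f (z + u) - F f z\<bar> \<partial>lborel) +
      (\<integral>\<^sup>+z. w (fold_map t z) * ennreal \<bar>F (f \<circ> R) (z + u) - F (f \<circ> R) z\<bar> \<partial>lborel)"
    by (rule nn_integral_add) measurable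
  also have "(\<integral>\<^sup>+z. w (fold_map t z) * ennreal \<bar>F f (z + u) - F f z\<bar> \<partial>lborel) \<le>
    (\<integral>\<^sup>+z. (if fst (z + u) < 1 then w' z * ennreal \<bar>f (z + u) - f z\<bar> else 0) \<partial>lborel) + M * ennreal (1 / real K) * L1norm f"
    unfolding F_def
  proof (rule strip_estimate[OF _ _ _ K u M])
    fix z show "w (fold_map t z) \<le> w' z" using w1[of z z] nu by auto
  next
    fix z :: "real \<times> real" and j :: nat assume j: "1 \<le> j" "j \<le> K" "1 - (real j + 1) * fst u \<le> fst z" "fst z < 1 - real j * fst u"
    have "0 \<le> real j * fst u" using u by simp
    then have *: "\<bar>fst z - 1\<bar> \<le> \<rho>" using j(3,4) fu[OF j(2)] by auto
    have "dist z (z + real j *\<^sub>R u) \<le> real K * norm u"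
      using j(2) by (auto simp: dist_norm intro!: mult_right_mono)
    then have d: "dist z (z + real j *\<^sub>R u) \<le> \<rho>" using nu by simp
    \<comment> \<open>By \<open>w2\<close> each of the two weights is at most half of
      \<open>w' z\<close>; in \<open>ennreal\<close> this is expressed by doubling and
      cancelling.\<close>
    have "2 * (w (fold_map t z) + w (fold_map t (z + real j *\<^sub>R u))) \<le> w' z + w' z"
      using add_mono[OF w2[OF *, of z] w2[OF * d]] nu(3) by (simp add: distrib_left)
    then have "2 * (w (fold_map t z) + w (fold_map t (z + real j *\<^sub>R u))) \<le> 2 * w' z"
      by (simp add: mult_2)
    then show "w (fold_map t z) + w (fold_map t (z + real j *\<^sub>R u)) \<le> w' z"
      by (subst (asm) ennreal_mult_le_mult_iff) auto
  qed measurable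
  also have "(\<integral>\<^sup>+z. w (fold_map t z) * ennreal \<bar>F (f \<circ> R) (z + u) - F (f \<circ> R) z\<bar> \<partial>lborel) \<le>
    (\<integral>\<^sup>+z. (if fst (z + u) < 1 then w' (R (z + \<gamma> *\<^sub>R u)) * ennreal \<bar>(f \<circ> R) (z + u) - (f \<circ> R) z\<bar> else 0) \<partial>lborel)
      + M * ennreal (1 / real K) * L1norm (f \<circ> R)"
    unfolding F_def
  proof (rule strip_estimate[OF _ _ _ K u M])
    have wR: "w (fold_map t z) = w (fold_map t (R z))" for z by (simp add: R_def fold_map_reflect)
    have d0: "dist (R (z + \<gamma> *\<^sub>R u)) (R z) \<le> \<rho>" for z
      unfolding dR using \<gamma> nu by (auto simp: dist_norm)
    fix z :: "real \<times> real" show "w (fold_map t z) \<le> w' (R (z + \<gamma> *\<^sub>R u))" unfolding wR[of z] by (rule w1[OF d0])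
    fix j :: nat assume j: "1 \<le> j" "j \<le> K" "1 - (real j + 1) * fst u \<le> fst z" "fst z < 1 - real j * fst u"
    have "1 * fst u \<le> real j * fst u" using u j(1) by (intro mult_right_mono) auto
    then have *: "\<bar>fst (R (z + \<gamma> *\<^sub>R u)) - 1\<bar> \<le> \<rho>" using j(3,4) fu[OF j(2)] \<gamma> u by (auto simp: R_def)
    \<comment> \<open>Because \<open>\<gamma> \<le> 1 \<le> j\<close>, the two points differ by at
      most \<open>K\<close> copies of \<open>u\<close> for either choice of
      \<open>\<gamma>\<close>.\<close>
    have "dist (R (z + \<gamma> *\<^sub>R u)) (R (z + real j *\<^sub>R u)) = norm ((\<gamma> - real j) *\<^sub>R u)"
      unfolding dR by (simp add: dist_norm algebra_simps)
    also have "\<dots> \<le> real K * norm u"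
      using \<gamma> j(1,2) by (auto intro!: mult_right_mono)
    finally have d: "dist (R (z + \<gamma> *\<^sub>R u)) (R (z + real j *\<^sub>R u)) \<le> \<rho>" using nu by simp
    have "2 * (w (fold_map t z) + w (fold_map t (z + real j *\<^sub>R u))) \<le> w' (R (z + \<gamma> *\<^sub>R u)) + w' (R (z + \<gamma> *\<^sub>R u))"
      using add_mono[OF w2[OF * d0] w2[OF * d]] unfolding wR[symmetric] by (simp add: distrib_left)
    then have "2 * (w (fold_map t z) + w (fold_map t (z + real j *\<^sub>R u))) \<le> 2 * w' (R (z + \<gamma> *\<^sub>R u))"
      by (simp add: mult_2)
    then show "w (fold_map t z) + w (fold_map t (z + real j *\<^sub>R u)) \<le> w' (R (z + \<gamma> *\<^sub>R u))"
      by (subst (asm) ennreal_mult_le_mult_iff) auto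
  qed measurable
  also have "L1norm (f \<circ> R) = L1norm f"
    unfolding L1norm_def R_def comp_def by (rule nn_integral_reflect) measurable
  finally show ?thesis
    unfolding comp_def A_def by (simp add: mult_2 algebra_simps add_mono)
qed

section \<open>Variation under iteration\<close>

text \<open>For a single direction there is no such bound: the right half-plane is seen through the
  reflection, which exchanges the two diagonals, so its increments belong to another direction than
  those of the left half-plane. Summing over all four directions puts the halves \<open>L\<close>
  and \<open>G\<close> together again. The factor \<open>8\<close> counts four directions and two
  branches.\<close>

lemma transfer_variation:
  assumes [measurable]: "f \<in> borel_measurable borel" "w \<in> borel_measurable borel" "w' \<in> borel_measurable borel"
    and t: "t > 0" and s: "s \<ge> 0" and K: "K > 0" and M: "\<And>z. w z \<le> M"
    and \<rho>: "(real K + 1) * (s / (sqrt 2 * t)) \<le> \<rho>"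
    and w1: "\<And>x x'. dist x x' \<le> \<rho> \<Longrightarrow> w (fold_map t x') \<le> w' x"
    and w2: "\<And>x x'. \<bar>fst x - 1\<bar> \<le> \<rho> \<Longrightarrow> dist x x' \<le> \<rho> \<Longrightarrow> 2 * w (fold_map t x') \<le> w' x"
  shows "variation w (transfer t f) s \<le> variation w' f (s / (sqrt 2 * t)) + 8 * (M * ennreal (1 / real K) * L1norm f)"
proof -
  define s' where "s' = s / (sqrt 2 * t)"
  define q where "q = s' / sqrt 2"
  define e where "e = M * ennreal (1 / real K) * L1norm f"
  define L where "L u = (\<integral>\<^sup>+z. (if fst (z + u) < 1 then w' z * ennreal \<bar>f (z + u) - f z\<bar> else 0) \<partial>lborel)" for u
  define G where "G u = (\<integral>\<^sup>+z. (if fst z > 1 then w' z * ennreal \<bar>f (z + u) - f z\<bar> else 0) \<partial>lborel)" for u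
  define R where "R z = (2 - fst z, snd z)" for z :: "real \<times> real"
  have [measurable]: "R \<in> borel_measurable borel" unfolding R_def by measurable
  have s': "s' \<ge> 0" "s = sqrt 2 * t * s'" and q: "q \<ge> 0" "s' = sqrt 2 * q"
    using s t by (auto simp: s'_def q_def)
  \<comment> \<open>Reflection reverses the horizontal part of \<open>u\<close>. With
    \<open>R (z + u)\<close> as base point the increment is read backwards and points to the right
    again, with the vertical part of \<open>u\<close> negated.\<close>
  have R1: "(\<integral>\<^sup>+z. (if fst (z + u) < 1 then w' (R (z + 1 *\<^sub>R u)) * ennreal \<bar>f (R (z + u)) - f (R z)\<bar> else 0) \<partial>lborel)
    = G (fst u, - snd u)" for u
  proof -
    define H where "H z = (if fst z > 1 then w' z * ennreal \<bar>f (z + (fst u, - snd u)) - f z\<bar> else 0)" for z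
    have [measurable]: "H \<in> borel_measurable borel" unfolding H_def by measurable
    have "R (z + u) + (fst u, - snd u) = R z" for z by (simp add: R_def)
    then have "(\<integral>\<^sup>+z. (if fst (z + u) < 1 then w' (R (z + 1 *\<^sub>R u)) * ennreal \<bar>f (R (z + u)) - f (R z)\<bar> else 0) \<partial>lborel)
      = (\<integral>\<^sup>+z. H (R (z + u)) \<partial>lborel)"
      by (intro nn_integral_cong) (auto simp: H_def abs_minus_commute, auto simp: R_def)
    also have "\<dots> = (\<integral>\<^sup>+z. H (R z) \<partial>lborel)" by (rule nn_integral_shift[where f="\<lambda>z. H (R z)"]) measurable
    also have "\<dots> = (\<integral>\<^sup>+z. H z \<partial>lborel)" unfolding R_def by (rule nn_integral_reflect) measurable
    finally show ?thesis by (simp add: H_def G_def)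
  qed
  have R0: "(\<integral>\<^sup>+z. (if fst (z + u) < 1 then w' (R (z + 0 *\<^sub>R u)) * ennreal \<bar>f (R (z + u)) - f (R z)\<bar> else 0) \<partial>lborel)
    = G u" if "fst u = 0" for u
  proof -
    define H where "H z = (if fst z > 1 then w' z * ennreal \<bar>f (z + u) - f z\<bar> else 0)" for z
    have [measurable]: "H \<in> borel_measurable borel" unfolding H_def by measurable
    have "R (z + u) = R z + u" for z using that by (simp add: R_def prod_eq_iff)
    then have "(\<integral>\<^sup>+z. (if fst (z + u) < 1 then w' (R (z + 0 *\<^sub>R u)) * ennreal \<bar>f (R (z + u)) - f (R z)\<bar> else 0) \<partial>lborel)
      = (\<integral>\<^sup>+z. H (R z) \<partial>lborel)"
      using that by (intro nn_integral_cong) (auto simp: H_def R_def)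
    also have "\<dots> = (\<integral>\<^sup>+z. H z \<partial>lborel)" unfolding R_def by (rule nn_integral_reflect) measurable
    finally show ?thesis by (simp add: H_def G_def)
  qed
  have step: "incr w (transfer t f) (t * (fst u + snd u), t * (fst u - snd u)) \<le> L u + G (fst u, - snd u) + 2 * e"
    if "fst u \<ge> 0" "norm u = s'" for u
    using transfer_incr[of f w w' t u K M \<rho> 1] that assms
    unfolding R_def[symmetric] R1 L_def[symmetric] e_def[symmetric] s'_def[symmetric] by auto
  have step0: "incr w (transfer t f) (t * (fst u + snd u), t * (fst u - snd u)) \<le> L u + G u + 2 * e"
    if "fst u = 0" "norm u = s'" for u
    using transfer_incr[of f w w' t u K M \<rho> 0] that assms
    unfolding R_def[symmetric] R0[OF that(1)] L_def[symmetric] e_def[symmetric] s'_def[symmetric] by auto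
  have n: "norm (q, q) = s'" "norm (q, - q) = s'" "norm (s', 0::real) = s'" "norm (0::real, s') = s'"
  proof -
    have "q\<^sup>2 + q\<^sup>2 = s'\<^sup>2" by (simp add: q(2) power_mult_distrib)
    then show "norm (q, q) = s'" "norm (q, - q) = s'" using s' by (auto simp: norm_Pair)
  qed (use s' in \<open>auto simp: norm_Pair\<close>)
  have "t * (q + q) = s" unfolding s'(2) q(2) by (simp add: mult.assoc[symmetric])
  then have 1: "incr w (transfer t f) (s, 0) \<le> L (q, q) + G (q, - q) + 2 * e"
    and 2: "incr w (transfer t f) (0, s) \<le> L (q, - q) + G (q, q) + 2 * e"
    using step[of "(q, q)"] step[of "(q, - q)"] q n by auto
  have "t * s' = s / sqrt 2" unfolding s'(2) by simp
  then have 3: "incr w (transfer t f) (s / sqrt 2, s / sqrt 2) \<le> L (s', 0) + G (s', 0) + 2 * e"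
    and 4: "incr w (transfer t f) (s / sqrt 2, - s / sqrt 2) \<le> L (0, s') + G (0, s') + 2 * e"
    using step[of "(s', 0)"] step0[of "(0, s')"] s' n by auto
  have LG: "L u + G u \<le> incr w' f u" if "fst u \<ge> 0" for u
    unfolding L_def G_def by (rule incr_split) (use that in measurable)
  have "variation w (transfer t f) s \<le> (L (q, q) + G (q, - q) + 2 * e) + (L (q, - q) + G (q, q) + 2 * e) +
     (L (s', 0) + G (s', 0) + 2 * e) + (L (0, s') + G (0, s') + 2 * e)"
    unfolding variation_def by (intro add_mono 1 2 3 4)
  also have "\<dots> = (L (s', 0) + G (s', 0)) + (L (0, s') + G (0, s')) + (L (q, q) + G (q, q)) + (L (q, - q) + G (q, - q)) + (2 * e + 2 * e + 2 * e + 2 * e)"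
    by (simp add: ac_simps)
  also have "2 * e + 2 * e + 2 * e + 2 * e = 8 * e" by (simp add: distrib_right[symmetric])
  also have "(L (s', 0) + G (s', 0)) + (L (0, s') + G (0, s')) + (L (q, q) + G (q, q)) + (L (q, - q) + G (q, - q))
    \<le> incr w' f (s', 0) + incr w' f (0, s') + incr w' f (q, q) + incr w' f (q, - q)"
    by (intro add_mono LG) (use q s' in auto)
  also have "\<dots> = variation w' f s'" by (simp add: variation_def q_def)
  finally show ?thesis by (simp add: s'_def e_def)
qed

text \<open>A crude constant: it only has to stay far enough below the growth factor
  \<open>8\<close> of the tolerances in \<open>hit_weight\<close>.\<close>

lemma dist_fold_map_le:
  assumes "0 \<le> t" "t \<le> 1"
  shows "dist (fold_map t x) (fold_map t y) \<le> 4 * dist x y"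
proof -
  have d: "\<bar>fst x - fst y\<bar> \<le> dist x y" "\<bar>snd x - snd y\<bar> \<le> dist x y"
    using dist_fst_le[of x y] dist_snd_le[of x y] by (auto simp: dist_real_def)
  have t: "\<bar>t * a\<bar> \<le> \<bar>a\<bar>" for a
    using assms mult_right_mono[of t 1 "\<bar>a\<bar>"] by (simp add: abs_mult)
  have "dist (fold_map t x) (fold_map t y) \<le> \<bar>fst (fold_map t x) - fst (fold_map t y)\<bar> + \<bar>snd (fold_map t x) - snd (fold_map t y)\<bar>"
    unfolding dist_norm by (metis norm_Pair_le fst_diff snd_diff prod.collapse real_norm_def)
  also have "\<dots> = \<bar>t * (\<bar>fst y - 1\<bar> - \<bar>fst x - 1\<bar> + (snd x - snd y))\<bar> + \<bar>t * (\<bar>fst y - 1\<bar> - \<bar>fst x - 1\<bar> - (snd x - snd y))\<bar>"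
    by (simp add: fold_map_def algebra_simps)
  also have "\<dots> \<le> \<bar>\<bar>fst y - 1\<bar> - \<bar>fst x - 1\<bar> + (snd x - snd y)\<bar> + \<bar>\<bar>fst y - 1\<bar> - \<bar>fst x - 1\<bar> - (snd x - snd y)\<bar>"
    by (intro add_mono t)
  also have "\<dots> \<le> 4 * dist x y" using d by linarith
  finally show ?thesis .
qed

lemma dist_fold_map_pow_le:
  assumes "0 \<le> t" "t \<le> 1"
  shows "dist ((fold_map t ^^ k) x) ((fold_map t ^^ k) y) \<le> 4 ^ k * dist x y"
proof (induction k)
  case (Suc k)
  have "dist ((fold_map t ^^ Suc k) x) ((fold_map t ^^ Suc k) y) \<le> 4 * dist ((fold_map t ^^ k) x) ((fold_map t ^^ k) y)"
    using dist_fold_map_le[OF assms] by simp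
  then show ?case using Suc by simp
qed simp

text \<open>The tolerance \<open>8 ^ j * \<rho>\<close> outgrows the distance \<open>4 ^ j * \<rho>\<close> between orbits of \<open>\<rho>\<close>-close points.\<close>

definition hit_weight :: "real \<Rightarrow> real \<Rightarrow> nat \<Rightarrow> real \<times> real \<Rightarrow> ennreal" where
  "hit_weight t \<rho> k z = (\<Prod>j<k. if \<bar>fst ((fold_map t ^^ j) z) - 1\<bar> \<le> 8 ^ j * \<rho> then 2 else 1)"

lemma measurable_fold_map_pow [measurable]: "fold_map t ^^ k \<in> borel_measurable borel"
  by (induction k) (auto simp: comp_def)

lemma measurable_hit_weight [measurable]: "hit_weight t \<rho> k \<in> borel_measurable borel"
  unfolding hit_weight_def by measurable

lemma hit_weight_le: "hit_weight t \<rho> k z \<le> 2 ^ k"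
proof -
  have "hit_weight t \<rho> k z \<le> (\<Prod>j<k. 2)"
    unfolding hit_weight_def by (rule prod_mono_ennreal) auto
  then show ?thesis by simp
qed

text \<open>Provides the weight hypotheses of \<open>transfer_variation\<close>. A near visit of the
  orbit of \<open>fold_map t x'\<close> at time \<open>j\<close> is one of the orbit of
  \<open>x\<close> at time \<open>j + 1\<close>, because
  \<open>8 ^ j + 4 ^ Suc j \<le> 8 ^ Suc j\<close>; the factor for time \<open>0\<close> is the
  doubling at the crease.\<close>

lemma hit_weight_Suc_ge:
  assumes t: "0 \<le> t" "t \<le> 1" and "\<rho> \<ge> 0" and d: "dist x x' \<le> \<rho>"
  shows "(if \<bar>fst x - 1\<bar> \<le> \<rho> then 2 else 1) * hit_weight t \<rho> k (fold_map t x') \<le> hit_weight t \<rho> (Suc k) x"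
proof -
  have "hit_weight t \<rho> k (fold_map t x') \<le> (\<Prod>j<k. if \<bar>fst ((fold_map t ^^ Suc j) x) - 1\<bar> \<le> 8 ^ Suc j * \<rho> then 2 else 1)"
    unfolding hit_weight_def
  proof (rule prod_mono_ennreal)
    fix j
    have "\<bar>fst ((fold_map t ^^ Suc j) x) - fst ((fold_map t ^^ Suc j) x')\<bar> \<le> 4 ^ Suc j * dist x x'"
      using dist_fold_map_pow_le[OF t, of "Suc j" x x'] dist_fst_le[of "(fold_map t ^^ Suc j) x" "(fold_map t ^^ Suc j) x'"]
      by (simp add: dist_real_def del: funpow.simps)
    also have "\<dots> \<le> 4 ^ Suc j * \<rho>" by (intro mult_left_mono d) auto
    finally have *: "\<bar>fst ((fold_map t ^^ Suc j) x) - fst ((fold_map t ^^ Suc j) x')\<bar> \<le> 4 ^ Suc j * \<rho>" .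
    have "(4::real) ^ j \<le> 8 ^ j" "(0::real) \<le> 8 ^ j" by (auto intro: power_mono)
    then have "8 ^ j + 4 ^ Suc j \<le> (8::real) ^ Suc j" unfolding power_Suc by linarith
    then have "8 ^ j * \<rho> + 4 ^ Suc j * \<rho> \<le> 8 ^ Suc j * \<rho>"
      using mult_right_mono[OF _ \<open>\<rho> \<ge> 0\<close>] by (metis distrib_right)
    then have "\<bar>fst ((fold_map t ^^ Suc j) x) - 1\<bar> \<le> 8 ^ Suc j * \<rho>" if "\<bar>fst ((fold_map t ^^ Suc j) x') - 1\<bar> \<le> 8 ^ j * \<rho>"
      using * that by linarith
    then show "(if \<bar>fst ((fold_map t ^^ j) (fold_map t x')) - 1\<bar> \<le> 8 ^ j * \<rho> then 2 else 1::ennreal)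
        \<le> (if \<bar>fst ((fold_map t ^^ Suc j) x) - 1\<bar> \<le> 8 ^ Suc j * \<rho> then 2 else 1)"
      by (auto simp: funpow_swap1)
  qed
  then show ?thesis
    unfolding hit_weight_def[of t \<rho> "Suc k"] prod.lessThan_Suc_shift by (intro mult_mono) auto
qed

lemma transfer_pow_measurable [measurable]:
  assumes [measurable]: "f \<in> borel_measurable borel"
  shows "(transfer t ^^ k) f \<in> borel_measurable borel"
  by (induction k) auto

lemma L1norm_transfer_pow_le:
  assumes [measurable]: "f \<in> borel_measurable borel" and t: "t > 0"
  shows "L1norm ((transfer t ^^ k) f) \<le> L1norm f"
proof (induction k)
  case (Suc k)
  have "L1norm ((transfer t ^^ Suc k) f) \<le> L1norm ((transfer t ^^ k) f)"
    using L1norm_transfer_le[OF transfer_pow_measurable t] by simp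
  then show ?case using Suc by simp
qed simp

text \<open>The induction treats the innermost application of \<open>transfer\<close> last, which
  pulls the weight back to the starting point of the orbit. Each step adds an error no larger than
  the bound reached so far, whence the factor \<open>2 ^ k\<close>.\<close>

lemma transfer_pow_variation:
  assumes f: "f \<in> borel_measurable borel" and t: "0 < t" "t \<le> 1" "1 / (sqrt 2 * t) \<le> 1"
    and s: "0 < s" "s \<le> \<rho> / 3"
  shows "modulus ((transfer t ^^ k) f) s \<le>
    variation (hit_weight t \<rho> k) f ((1 / (sqrt 2 * t)) ^ k * s) + ennreal (24 * 2 ^ k * s / \<rho>) * L1norm f"
  using f
proof (induction k arbitrary: f)
  case 0
  then show ?case by (simp add: hit_weight_def[abs_def])
next
  case (Suc k)
  note [measurable] = Suc.prems
  define \<sigma> where "\<sigma> = 1 / (sqrt 2 * t)"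
  have \<sigma>: "0 < \<sigma>" "\<sigma> \<le> 1" using t by (auto simp: \<sigma>_def)
  have \<rho>: "\<rho> > 0" using s by auto
  define s' where "s' = \<sigma> ^ Suc k * s"
  have "\<sigma> ^ Suc k \<le> 1" "\<sigma> ^ Suc k > 0" using \<sigma> by (auto simp del: power_Suc intro!: power_le_one)
  then have s': "0 < s'" "s' \<le> s" using s mult_right_mono[of "\<sigma> ^ Suc k" 1 s] by (auto simp: s'_def simp del: power_Suc)
  \<comment> \<open>As many translates as fit: \<open>(K + 1) * s' \<le> \<rho>\<close>. Since
    \<open>s \<le> \<rho> / 3\<close> keeps \<open>K\<close> positive,
    \<open>K + 2 \<le> 3 * K\<close>, and so \<open>1 / K\<close> is at most
    \<open>3 * s / \<rho>\<close>.\<close>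
  define K where "K = nat \<lfloor>\<rho> / s'\<rfloor> - 1"
  have "3 \<le> \<rho> / s'" using s' s by (simp add: field_simps)
  then have "3 \<le> nat \<lfloor>\<rho> / s'\<rfloor>" by linarith
  then have K: "K > 0" "real K = of_int \<lfloor>\<rho> / s'\<rfloor> - 1"
    unfolding K_def by linarith+
  then have K1: "real K + 1 \<le> \<rho> / s'" "\<rho> / s' \<le> real K + 2" by linarith+
  have K2: "(real K + 1) * s' \<le> \<rho>" using K1(1) s' by (simp add: field_simps)
  have "\<rho> \<le> (real K + 2) * s'" using K1(2) s' by (simp add: field_simps)
  also have "\<dots> \<le> (3 * real K) * s" using K(1) s' by (intro mult_mono) auto
  finally have K3: "1 / real K \<le> 3 * s / \<rho>" using K(1) \<rho> by (simp add: field_simps)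
  have "modulus ((transfer t ^^ Suc k) f) s \<le>
      variation (hit_weight t \<rho> k) (transfer t f) (\<sigma> ^ k * s) + ennreal (24 * 2 ^ k * s / \<rho>) * L1norm (transfer t f)"
    using Suc.IH[of "transfer t f"] by (simp add: funpow_swap1 \<sigma>_def)
  also have "\<dots> \<le> variation (hit_weight t \<rho> k) (transfer t f) (\<sigma> ^ k * s) + ennreal (24 * 2 ^ k * s / \<rho>) * L1norm f"
    by (intro add_left_mono mult_left_mono L1norm_transfer_le) (use t in auto)
  also have "variation (hit_weight t \<rho> k) (transfer t f) (\<sigma> ^ k * s) \<le>
      variation (hit_weight t \<rho> (Suc k)) f (\<sigma> ^ k * s / (sqrt 2 * t)) + 8 * (2 ^ k * ennreal (1 / real K) * L1norm f)"
  proof (rule transfer_variation)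
    show "(real K + 1) * (\<sigma> ^ k * s / (sqrt 2 * t)) \<le> \<rho>"
      using K2 by (simp add: s'_def \<sigma>_def mult_ac)
    show "\<And>x x'. dist x x' \<le> \<rho> \<Longrightarrow> hit_weight t \<rho> k (fold_map t x') \<le> hit_weight t \<rho> (Suc k) x"
    proof -
      fix x x' :: "real \<times> real" assume "dist x x' \<le> \<rho>"
      have "1 * hit_weight t \<rho> k (fold_map t x') \<le> (if \<bar>fst x - 1\<bar> \<le> \<rho> then 2 else 1) * hit_weight t \<rho> k (fold_map t x')"
        by (intro mult_right_mono) auto
      also have "\<dots> \<le> hit_weight t \<rho> (Suc k) x"
        by (rule hit_weight_Suc_ge) (use t \<rho> \<open>dist x x' \<le> \<rho>\<close> in auto)
      finally show "hit_weight t \<rho> k (fold_map t x') \<le> hit_weight t \<rho> (Suc k) x" by simp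
    qed
    show "\<And>x x'. \<bar>fst x - 1\<bar> \<le> \<rho> \<Longrightarrow> dist x x' \<le> \<rho> \<Longrightarrow> 2 * hit_weight t \<rho> k (fold_map t x') \<le> hit_weight t \<rho> (Suc k) x"
    proof -
      fix x x' :: "real \<times> real" assume "\<bar>fst x - 1\<bar> \<le> \<rho>" "dist x x' \<le> \<rho>"
      then show "2 * hit_weight t \<rho> k (fold_map t x') \<le> hit_weight t \<rho> (Suc k) x"
        using hit_weight_Suc_ge[of t \<rho> x x' k] t(1,2) \<rho> by simp
    qed
    show "0 \<le> \<sigma> ^ k * s" using \<sigma> s by simp
  qed (use hit_weight_le t(1) K(1) in \<open>simp_all add: Suc.prems\<close>)
  also have "\<sigma> ^ k * s / (sqrt 2 * t) = \<sigma> ^ Suc k * s" by (simp add: \<sigma>_def)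
  also have "8 * (2 ^ k * ennreal (1 / real K) * L1norm f) \<le> ennreal (24 * 2 ^ k * s / \<rho>) * L1norm f"
  proof -
    have "8 * (2 ^ k * ennreal (1 / real K) * L1norm f) = ennreal (8 * 2 ^ k * (1 / real K)) * L1norm f"
      by (simp add: ennreal_mult' mult.assoc ennreal_power[symmetric] del: times_divide_eq_right)
    also have "\<dots> \<le> ennreal (8 * 2 ^ k * (3 * s / \<rho>)) * L1norm f"
      by (intro mult_right_mono ennreal_leI mult_left_mono K3) auto
    finally show ?thesis by (simp add: mult_ac)
  qed
  also have "variation (hit_weight t \<rho> (Suc k)) f (\<sigma> ^ Suc k * s) + ennreal (24 * 2 ^ k * s / \<rho>) * L1norm f + ennreal (24 * 2 ^ k * s / \<rho>) * L1norm f
    = variation (hit_weight t \<rho> (Suc k)) f (\<sigma> ^ Suc k * s) + ennreal (24 * 2 ^ k * s / \<rho> + 24 * 2 ^ k * s / \<rho>) * L1norm f"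
  proof -
    have "ennreal (c + c) * N = ennreal c * N + ennreal c * N" if "c \<ge> 0" for c N
      using that by (simp only: distrib_right[symmetric] ennreal_plus)
    from this[of "24 * 2 ^ k * s / \<rho>"] show ?thesis using s \<rho> by (simp only: add.assoc) auto
  qed
  also have "24 * 2 ^ k * s / \<rho> + 24 * 2 ^ k * s / \<rho> = 24 * 2 ^ Suc k * s / \<rho>" by simp
  finally show ?case unfolding \<sigma>_def by (auto intro: add_mono simp only:)
qed

section \<open>Returns to the crease\<close>

text \<open>The function \<open>x ^ k * (1 - x)\<close> has its peak at \<open>k / (k + 1)\<close>,
  and the hypothesis places \<open>a\<close> at or beyond it.\<close>

lemma power_times_diff_antimono:
  fixes a b :: real
  assumes "a \<le> b" "real k \<le> (real k + 1) * a" "0 \<le> a"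
  shows "b ^ k * (1 - b) \<le> a ^ k * (1 - a)"
proof (rule DERIV_nonpos_imp_nonincreasing[OF \<open>a \<le> b\<close>])
  fix x assume x: "a \<le> x" "x \<le> b"
  have "((\<lambda>x. x ^ k * (1 - x)) has_real_derivative real k * x ^ (k - 1) * (1 - x) - x ^ k) (at x)"
    by (auto intro!: derivative_eq_intros)
  moreover have "real k * x ^ (k - 1) * (1 - x) - x ^ k \<le> 0"
  proof (cases k)
    case 0
    then show ?thesis by simp
  next
    case (Suc m)
    have "real k * x ^ (k - 1) * (1 - x) - x ^ k = x ^ m * (real k - (real k + 1) * x)"
      by (simp add: Suc algebra_simps)
    moreover have "real k \<le> (real k + 1) * x"
      using assms(2) mult_left_mono[OF x(1), of "real k + 1"] by linarith
    ultimately show ?thesis using assms x by (auto intro!: mult_nonneg_nonpos)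
  qed
  ultimately show "\<exists>y. ((\<lambda>x. x ^ k * (1 - x)) has_real_derivative y) (at x) \<and> y \<le> 0" by blast
qed

lemma tent_T_iff: "z \<in> tent_T \<longleftrightarrow> 0 \<le> snd z \<and> snd z \<le> 1 - \<bar>fst z - 1\<bar>"
  by (cases z) (auto simp: tent_T_def tent_T0_def tent_T1_def)

lemma tent_map_eq_fold_map: "z \<in> tent_T \<Longrightarrow> tent_map t z = fold_map t z"
  by (cases z) (auto simp: tent_map_def fold_map_def tent_T_def tent_T0_def tent_T1_def)

lemma fold_map_tent_T:
  assumes "z \<in> tent_T" "0 \<le> t" "t \<le> 1"
  shows "fold_map t z \<in> tent_T"
proof -
  define m where "m = 1 - \<bar>fst z - 1\<bar>"
  have m: "0 \<le> snd z" "snd z \<le> m" "m \<le> 1" using assms(1) by (auto simp: tent_T_iff m_def)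
  have 1: "t * (m - snd z) \<ge> 0" "t * snd z \<ge> 0" "t * m \<le> 1"
    using m assms mult_mono[of t 1 m 1] by auto
  have "0 \<le> t * (m - snd z) \<and> t * (m - snd z) \<le> 1 - \<bar>t * (m + snd z) - 1\<bar>"
    using 1 m by (auto simp: algebra_simps abs_le_iff)
  then show ?thesis by (simp add: tent_T_iff fold_map_def m_def)
qed

lemma fold_map_pow_tent_T:
  assumes "z \<in> tent_T" "0 \<le> t" "t \<le> 1"
  shows "(fold_map t ^^ k) z \<in> tent_T"
  by (induction k) (use assms fold_map_tent_T in auto)

lemma fold_map_le: "x \<le> 1 \<Longrightarrow> fold_map t (x, y) = (t * (x + y), t * (x - y))"
  and fold_map_ge: "x \<ge> 1 \<Longrightarrow> fold_map t (x, y) = (t * (2 - x + y), t * (2 - x - y))"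
  by (auto simp: fold_map_def)

text \<open>\<open>22 / 25\<close> is slightly below \<^const>\<open>tent_tau\<close>. On this range the numbers \<open>e k\<close> are small, and the
  coordinates of all orbits needed below are integer combinations of \<open>t\<close> and some \<open>e k\<close>.\<close>

locale crease =
  fixes t :: real
  assumes t: "22 / 25 \<le> t" "t \<le> 1"
begin

definition e where "e k = t ^ k * (1 - t)"

text \<open>For these \<open>k\<close> the peak \<open>k / (k + 1)\<close> is at most 6/7, below
  22/25, so \<open>e k\<close> is largest at the left end of the parameter range.\<close>

lemma e_bounds: "0 \<le> e k" "k \<le> 6 \<Longrightarrow> e k \<le> (22 / 25) ^ k * (3 / 25)"
proof -
  show "0 \<le> e k" using t by (simp add: e_def)
  assume "k \<le> 6"
  then have "real k \<le> (real k + 1) * (22 / 25)" by simp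
  from power_times_diff_antimono[OF t(1) this] show "e k \<le> (22 / 25) ^ k * (3 / 25)"
    by (simp add: e_def)
qed

lemma e_numeric: "e 1 \<le> 106 / 1000" "e 2 \<le> 93 / 1000" "e 3 \<le> 82 / 1000" "e 4 \<le> 72 / 1000" "e 5 \<le> 64 / 1000"
  "0 \<le> e 1" "0 \<le> e 2" "0 \<le> e 3" "0 \<le> e 4" "0 \<le> e 5"
  using e_bounds(2)[of 1] e_bounds(2)[of 2] e_bounds(2)[of 3] e_bounds(2)[of 4] e_bounds(2)[of 5] e_bounds(1)
  by (simp_all add: power_divide)

text \<open>Multiplication by \<open>t\<close> takes \<open>e k\<close> to \<open>e (k + 1)\<close>
  and \<open>t\<close> to \<open>t - e 1\<close>. With these rewrite rules an orbit point stays an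
  integer combination and each application of the map is one simplification;
  \<open>One_nat_def\<close> is switched off there so that \<open>e 1\<close> keeps its
  form.\<close>

lemma t_e: "t * e 1 = e 2" "t * e 2 = e 3" "t * e 3 = e 4" "t * e 4 = e 5" "t * t = t - e 1" "t * (1 - t) = e 1"
  by (simp_all add: e_def eval_nat_numeral algebra_simps)

lemma t_e': "t * (e 1 * c) = e 2 * c" "t * (e 2 * c) = e 3 * c" "t * (e 3 * c) = e 4 * c" "t * (e 4 * c) = e 5 * c"
  "t * (c * e 1) = c * e 2" "t * (c * e 2) = c * e 3" "t * (c * e 3) = c * e 4" "t * (c * e 4) = c * e 5"
  "t * (t * c) = t * c - e 1 * c"
  by (simp_all add: e_def eval_nat_numeral algebra_simps)

text \<open>The differences are \<open>(1 - t) * (2 * t\<^sup>2 - 1)\<close> and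
  \<open>(1 - t) * (4 * t ^ 4 - 1)\<close>. At \<open>t = 1\<close> both vanish and the orbits
  concerned hit the crease exactly, which is why that parameter is treated separately.\<close>

lemma above_one:
  assumes "t < 1"
  shows "1 < t + 2 * e 2" "1 < t + 4 * e 4"
proof -
  have "t\<^sup>2 \<ge> (22 / 25)\<^sup>2" "t ^ 4 \<ge> (22 / 25) ^ 4" using t by (auto intro: power_mono)
  then have "0 < (1 - t) * (2 * t\<^sup>2 - 1)" "0 < (1 - t) * (4 * t ^ 4 - 1)"
    using assms by (auto intro!: mult_pos_pos simp: power_divide)
  then show "1 < t + 2 * e 2" "1 < t + 4 * e 4" by (auto simp: e_def algebra_simps)
qed

text \<open>With \<open>u\<close> standing for the square of \<open>t\<close> the sum is
  \<open>8 * u\<^sup>2 * (1 - u)\<close>, which decreases from 2/3 on. The number 0.7938 is the cube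
  root of 1/2 rounded up, and the value there is about 1.04.\<close>

lemma eight:
  assumes "t ^ 6 \<le> 1 / 2"
  shows "1 < 8 * e 4 + 8 * e 5"
proof -
  have "t\<^sup>2 \<le> 7938 / 10000"
  proof (rule ccontr)
    assume "\<not> ?thesis"
    then have "(7938 / 10000) ^ 3 \<le> (t\<^sup>2) ^ 3" by (intro power_mono) auto
    then show False using assms by (simp add: power_mult[symmetric] power_divide)
  qed
  moreover have "real 2 \<le> (real 2 + 1) * t\<^sup>2" using power_mono[of "22 / 25" t 2] t by (simp add: power_divide)
  ultimately have "(7938 / 10000)\<^sup>2 * (1 - 7938 / 10000) \<le> (t\<^sup>2)\<^sup>2 * (1 - t\<^sup>2)"
    by (rule power_times_diff_antimono) simp
  moreover have "8 * e 4 + 8 * e 5 = 8 * ((t\<^sup>2)\<^sup>2 * (1 - t\<^sup>2))"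
    by (simp add: e_def eval_nat_numeral algebra_simps)
  ultimately show ?thesis by (simp add: power_divide)
qed

lemma iter:
  "(fold_map t ^^ 1) z = fold_map t z"
  "(fold_map t ^^ 2) z = fold_map t (fold_map t z)"
  "(fold_map t ^^ 3) z = fold_map t (fold_map t (fold_map t z))"
  "(fold_map t ^^ 4) z = fold_map t (fold_map t (fold_map t (fold_map t z)))"
  "(fold_map t ^^ 5) z = fold_map t (fold_map t (fold_map t (fold_map t (fold_map t z))))"
  by (simp_all add: eval_nat_numeral)

text \<open>The starting height is that of \<open>landing 1\<close>; the next three lemmas start
  from the heights of \<open>landing 2\<close> to \<open>landing 4\<close>. At each step the bounds
  in \<open>e_numeric\<close> decide the side of the crease. Only the fifth point is close, and the
  restriction on \<open>t\<close> puts it beyond the crease.\<close>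

lemma orbit_1:
  assumes "j \<in> {1..4} \<or> j = 5 \<and> t ^ 6 \<le> 1 / 2"
  shows "fst ((fold_map t ^^ j) (1, 2 * t - 1)) \<noteq> 1"
proof -
  have 1: "fold_map t (1, 2 * t - 1) = (2 * t - 2 * e 1, 2 * e 1)"
    by (subst fold_map_le) (auto simp: algebra_simps t_e t_e' simp del: One_nat_def)
  have 2: "fold_map t (2 * t - 2 * e 1, 2 * e 1) = (2 * e 1 + 4 * e 2, 2 * e 1)"
    using e_numeric t by (subst fold_map_ge) (auto simp: algebra_simps t_e t_e' simp del: One_nat_def)
  have 3: "fold_map t (2 * e 1 + 4 * e 2, 2 * e 1) = (4 * e 2 + 4 * e 3, 4 * e 3)"
    using e_numeric t by (subst fold_map_le) (auto simp: algebra_simps t_e t_e' simp del: One_nat_def)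
  have 4: "fold_map t (4 * e 2 + 4 * e 3, 4 * e 3) = (4 * e 3 + 8 * e 4, 4 * e 3)"
    using e_numeric t by (subst fold_map_le) (auto simp: algebra_simps t_e t_e' simp del: One_nat_def)
  have 5: "fold_map t (4 * e 3 + 8 * e 4, 4 * e 3) = (8 * e 4 + 8 * e 5, 8 * e 5)"
    using e_numeric t by (subst fold_map_le) (auto simp: algebra_simps t_e t_e' simp del: One_nat_def)
  consider "j = 1" | "j = 2" | "j = 3" | "j = 4" | "j = 5" "t ^ 6 \<le> 1 / 2" using assms by fastforce
  then show ?thesis
    by cases (use e_numeric t eight in \<open>auto simp: iter 1 2 3 4 5 simp del: One_nat_def\<close>)
qed

text \<open>The delicate point is the first iterate, which lies just to the right of the crease by
  \<open>above_one\<close>; the same happens in \<open>orbit_4\<close>.\<close>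

lemma orbit_2:
  assumes "j \<in> {1..4}" "t < 1"
  shows "fst ((fold_map t ^^ j) (1, 2 * e 1)) \<noteq> 1"
proof -
  have 1: "fold_map t (1, 2 * e 1) = (t + 2 * e 2, t - 2 * e 2)"
    by (subst fold_map_le) (auto simp: algebra_simps t_e t_e' simp del: One_nat_def)
  have 2: "fold_map t (t + 2 * e 2, t - 2 * e 2) = (2 * t - 4 * e 3, 2 * e 1)"
    using above_one[OF assms(2)] by (subst fold_map_ge) (auto simp: algebra_simps t_e t_e' simp del: One_nat_def)
  have 3: "fold_map t (2 * t - 4 * e 3, 2 * e 1) = (2 * e 1 + 4 * e 4 + 2 * e 2, 2 * e 1 + 4 * e 4 - 2 * e 2)"
    using e_numeric t by (subst fold_map_ge) (auto simp: algebra_simps t_e t_e' simp del: One_nat_def)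
  have 4: "fold_map t (2 * e 1 + 4 * e 4 + 2 * e 2, 2 * e 1 + 4 * e 4 - 2 * e 2) = (4 * e 2 + 8 * e 5, 4 * e 3)"
    using e_numeric t by (subst fold_map_le) (auto simp: algebra_simps t_e t_e' simp del: One_nat_def)
  consider "j = 1" | "j = 2" | "j = 3" | "j = 4" using assms by fastforce
  then show ?thesis
    by cases (use e_numeric t above_one[OF assms(2)] in \<open>auto simp: iter 1 2 3 4 simp del: One_nat_def\<close>)
qed

lemma orbit_3:
  assumes "j \<in> {1..3}"
  shows "fst ((fold_map t ^^ j) (1, 1 - 4 * e 2)) \<noteq> 1"
proof -
  have 1: "fold_map t (1, 1 - 4 * e 2) = (2 * t - 4 * e 3, 4 * e 3)"
    by (subst fold_map_le) (auto simp: algebra_simps t_e t_e' simp del: One_nat_def)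
  have 2: "fold_map t (2 * t - 4 * e 3, 4 * e 3) = (2 * e 1 + 8 * e 4, 2 * e 1)"
    using e_numeric t by (subst fold_map_ge) (auto simp: algebra_simps t_e t_e' simp del: One_nat_def)
  have 3: "fold_map t (2 * e 1 + 8 * e 4, 2 * e 1) = (4 * e 2 + 8 * e 5, 8 * e 5)"
    using e_numeric t by (subst fold_map_le) (auto simp: algebra_simps t_e t_e' simp del: One_nat_def)
  consider "j = 1" | "j = 2" | "j = 3" using assms by fastforce
  then show ?thesis
    by cases (use e_numeric t in \<open>auto simp: iter 1 2 3 simp del: One_nat_def\<close>)
qed

lemma orbit_4:
  assumes "j \<in> {1..2}" "t < 1"
  shows "fst ((fold_map t ^^ j) (1, 4 * e 3)) \<noteq> 1"
proof -
  have 1: "fold_map t (1, 4 * e 3) = (t + 4 * e 4, t - 4 * e 4)"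
    by (subst fold_map_le) (auto simp: algebra_simps t_e t_e' simp del: One_nat_def)
  have 2: "fold_map t (t + 4 * e 4, t - 4 * e 4) = (2 * t - 8 * e 5, 2 * e 1)"
    using above_one[OF assms(2)] by (subst fold_map_ge) (auto simp: algebra_simps t_e t_e' simp del: One_nat_def)
  consider "j = 1" | "j = 2" using assms by fastforce
  then show ?thesis
    by cases (use e_numeric t above_one[OF assms(2)] in \<open>auto simp: iter 1 2 simp del: One_nat_def\<close>)
qed

text \<open>The possible heights of an orbit from the crease that is on the crease again after \<open>i\<close> steps: as
  images of the crease are line segments, they depend on \<open>t\<close> only.\<close>

definition landing :: "nat \<Rightarrow> real set" where
  "landing i = (if i = 1 then {2 * t - 1} else if i = 2 then {2 * e 1} else if i = 3 then {1 - 4 * e 2}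
     else if i = 4 then {4 * e 3} else {1 - 8 * e 4, 8 * e 3 + 8 * e 4 - 1, 4 * e 1 + 8 * e 4 - 1})"

text \<open>The sum of the new coordinates depends only on the old first coordinate, the difference
  only on the old second one. So knowing one coordinate of a point still gives a linear relation at
  its image.\<close>

lemma fold_map_sum: "fst (fold_map t z) + snd (fold_map t z) = 2 * t * (1 - \<bar>fst z - 1\<bar>)"
  and fold_map_diff: "fst (fold_map t z) - snd (fold_map t z) = 2 * t * snd z"
  by (auto simp: fold_map_def algebra_simps)

text \<open>Although \<open>y\<close> is unknown, one linear form of the orbit is known at each
  time: the sum of coordinates at time 1, then a single coordinate at even times and a sum or
  difference at odd times. Together with \<open>a i = 1\<close> this fixes the height; different
  values only reflect the sides taken at times 1 and 3.\<close>

lemma landing: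
  assumes y: "0 \<le> y" "y \<le> 1" and i: "i \<in> {1..5}" and hit: "fst ((fold_map t ^^ i) (1, y)) = 1"
  shows "snd ((fold_map t ^^ i) (1, y)) \<in> landing i"
proof -
  define z where "z k = (fold_map t ^^ k) (1, y)" for k
  define a where "a k = fst (z k)" for k
  define b where "b k = snd (z k)" for k
  have z: "z (Suc k) = fold_map t (a k, b k)" for k by (simp add: z_def a_def b_def)
  have T: "0 \<le> b k" "b k \<le> 1 - \<bar>a k - 1\<bar>" for k
    using fold_map_pow_tent_T[of "(1, y)" t k] y t by (auto simp: a_def b_def z_def tent_T_iff)
  have L: "a (Suc k) = t * (a k + b k)" "b (Suc k) = t * (a k - b k)" if "a k \<le> 1" for k
    using z[of k] fold_map_le[OF that, of t "b k"] by (auto simp: a_def b_def)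
  have R: "a (Suc k) = t * (2 - (a k - b k))" "b (Suc k) = t * (2 - (a k + b k))" if "a k \<ge> 1" for k
    using z[of k] fold_map_ge[OF that, of t "b k"] by (auto simp: a_def b_def algebra_simps)
  have S: "a (Suc k) + b (Suc k) = 2 * t * (1 - \<bar>a k - 1\<bar>)" "a (Suc k) - b (Suc k) = 2 * t * b k" for k
    using fold_map_sum[of "z k"] fold_map_diff[of "z k"] by (simp_all add: a_def b_def z_def)
  have num: "Suc 0 = 1" "Suc 1 = 2" "Suc 2 = 3" "Suc 3 = 4" "Suc 4 = 5" by auto
  \<comment> \<open>Steps from odd to even times need to know the side of the crease, through
    \<open>L\<close> or \<open>R\<close>; steps from even to odd times use the side-free relations
    \<open>S\<close>.\<close>
  note L = L[of 1, unfolded num] L[of 3, unfolded num] and R = R[of 1, unfolded num] R[of 3, unfolded num]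
    and S = S[of 2, unfolded num] S[of 4, unfolded num] and S0 = S(1)[of 0, unfolded num]
  have "a 0 = 1" by (simp add: a_def z_def)
  then have s1: "a 1 + b 1 = 2 * t" using S0 by simp
  have i: "i = 1 \<or> i = 2 \<or> i = 3 \<or> i = 4 \<or> i = 5" using i by auto
  have "b i \<in> landing i" if hit: "a i = 1"
  proof (cases "a 1 < 1")
    case True
    have a2: "a 2 = 2 * t - 2 * e 1"
      using L(1) True s1 by (simp add: algebra_simps t_e t_e' del: One_nat_def)
    then have a2': "a 2 > 1" using e_numeric t by linarith
    have s3: "a 3 + b 3 = 4 * e 1 + 4 * e 2"
      using S(1) a2 a2' by (simp add: algebra_simps t_e t_e' del: One_nat_def)
    then have a3: "a 3 < 1" using e_numeric T(1)[of 3] by linarith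
    have a4: "a 4 = 4 * e 2 + 4 * e 3"
      using L(3) a3 s3 by (simp add: algebra_simps t_e t_e' del: One_nat_def)
    then have a4': "a 4 < 1" using e_numeric by linarith
    have "a 5 + b 5 = 8 * e 3 + 8 * e 4"
      using S(3) a4 a4' by (simp add: algebra_simps t_e t_e' del: One_nat_def)
    then show ?thesis
      using i hit True a2' a3 a4' by (auto simp: landing_def)
  next
    case False
    have b2: "b 2 = 2 * e 1"
      using R(2) False s1 by (simp add: algebra_simps t_e t_e' del: One_nat_def)
    have d3: "a 3 - b 3 = 4 * e 2"
      using S(2) b2 by (simp add: algebra_simps t_e t_e' del: One_nat_def)
    have 45: "(a 4 = 1 \<longrightarrow> b 4 = 4 * e 3) \<and> (a 5 = 1 \<longrightarrow> b 5 \<in> landing 5)"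
    proof (cases "a 3 \<le> 1")
      case True
      have b4: "b 4 = 4 * e 3"
        using L(4) True d3 by (simp add: algebra_simps t_e t_e' del: One_nat_def)
      have "a 5 - b 5 = 8 * e 4"
        using S(4) b4 by (simp add: algebra_simps t_e t_e' del: One_nat_def)
      then show ?thesis using b4 by (auto simp: landing_def)
    next
      case False
      have a4: "a 4 = 2 * t - 4 * e 3"
        using R(3) False d3 by (simp add: algebra_simps t_e t_e' del: One_nat_def)
      then have a4': "a 4 > 1" using e_numeric t by linarith
      have "a 5 + b 5 = 4 * e 1 + 8 * e 4"
        using S(3) a4 a4' by (simp add: algebra_simps t_e t_e' del: One_nat_def)
      then show ?thesis using a4' by (auto simp: landing_def)
    qed
    show ?thesis
      using i hit s1 b2 d3 45 by (auto simp: landing_def)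
  qed
  then show ?thesis using hit by (simp add: a_def b_def z_def)
qed

text \<open>One step is enough, because five of the at most six steps are already spent.\<close>

lemma orbit_5:
  assumes y: "y \<in> landing 5" and "t ^ 6 \<le> 1 / 2"
  shows "fst (fold_map t (1, y)) \<noteq> 1"
proof -
  have "fst (fold_map t (1, y)) = t * (1 + y)" by (simp add: fold_map_def)
  moreover have "t * (1 + (1 - 8 * e 4)) = 2 * t - 8 * e 5" "t * (1 + (8 * e 3 + 8 * e 4 - 1)) = 8 * e 4 + 8 * e 5"
    "t * (1 + (4 * e 1 + 8 * e 4 - 1)) = 4 * e 2 + 8 * e 5"
    by (simp_all add: algebra_simps t_e t_e' del: One_nat_def)
  ultimately show ?thesis
    using y e_numeric t eight[OF assms(2)] by (auto simp: landing_def)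
qed

text \<open>At time \<open>i\<close> the orbit is at one of the explicit points given by
  \<open>landing\<close>, and from there the orbit lemmas follow it for the remaining
  \<open>j - i\<close> steps.\<close>

lemma two_hits:
  assumes z: "z \<in> tent_T" "fst z = 1" and "t < 1"
    and i: "0 < i" "fst ((fold_map t ^^ i) z) = 1"
    and j: "i < j" "j \<le> 5 \<or> j \<le> 6 \<and> t ^ 6 \<le> 1 / 2"
  shows "fst ((fold_map t ^^ j) z) \<noteq> 1"
proof -
  define w where "w = (fold_map t ^^ i) z"
  have i5: "i \<in> {1..5}" using i j by auto
  have lw: "snd w \<in> landing i"
    using landing[of "snd z" i] z i i5 by (cases z) (auto simp: tent_T_iff w_def)
  have eq: "(fold_map t ^^ j) z = (fold_map t ^^ (j - i)) (1, snd w)"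
  proof -
    have "(fold_map t ^^ j) z = (fold_map t ^^ (j - i + i)) z" using j by simp
    also have "\<dots> = (fold_map t ^^ (j - i)) w" unfolding w_def funpow_add by simp
    also have "w = (1, snd w)" using i by (simp add: w_def prod_eq_iff)
    finally show ?thesis .
  qed
  consider "i = 1" | "i = 2" | "i = 3" | "i = 4" | "i = 5" using i5 by fastforce
  then show ?thesis
  proof cases
    case 1
    then have "j - i \<in> {1..4} \<or> j - i = 5 \<and> t ^ 6 \<le> 1 / 2" using j by auto
    then show ?thesis using orbit_1[of "j - i"] 1 lw eq by (simp add: landing_def del: One_nat_def)
  next
    case 2
    then have "j - i \<in> {1..4}" using j by auto
    then show ?thesis using orbit_2[of "j - i"] 2 \<open>t < 1\<close> lw eq by (simp add: landing_def del: One_nat_def)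
  next
    case 3
    then have "j - i \<in> {1..3}" using j by auto
    then show ?thesis using orbit_3[of "j - i"] 3 lw eq by (simp add: landing_def del: One_nat_def)
  next
    case 4
    then have "j - i \<in> {1..2}" using j by auto
    then show ?thesis using orbit_4[of "j - i"] 4 \<open>t < 1\<close> lw eq by (simp add: landing_def del: One_nat_def)
  next
    case 5
    then have "j - i = 1" "t ^ 6 \<le> 1 / 2" using j by auto
    then show ?thesis using orbit_5[of "snd w"] 5 lw eq by simp
  qed
qed

end


section \<open>The exceptional parameter \<open>t = 1\<close>\<close>

lemma fold_map_1_corner:
  assumes "j > 0"
  shows "fst ((fold_map 1 ^^ j) (1, 1)) \<noteq> 1"
proof -
  have "(fold_map 1 ^^ Suc k) (1, 1) \<in> {(2, 0), (0, 0)}" for k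
    by (induction k) (auto simp: fold_map_def)
  from this[of "j - 1"] show ?thesis using assms by auto
qed

text \<open>All \<open>e k\<close> vanish, so a return to the crease has height \<open>0\<close> or
  \<open>1\<close>. The corner \<open>(1, 1)\<close> goes to \<open>(2, 0)\<close> and then stays at
  the origin, while \<open>(1, 0)\<close> goes to \<open>(1, 1)\<close>. Hence the longest pattern
  is a first visit, then \<open>(1, 0)\<close>, then \<open>(1, 1)\<close>.\<close>

lemma three_hits_1:
  assumes z: "z \<in> tent_T" "fst z = 1"
    and i: "0 < i" "fst ((fold_map 1 ^^ i) z) = 1"
    and j: "i < j" "fst ((fold_map 1 ^^ j) z) = 1"
    and k: "j < k" "k \<le> 6"
  shows "fst ((fold_map 1 ^^ k) z) \<noteq> 1"
proof -
  interpret crease 1 by unfold_locales auto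
  define w where "w = (fold_map 1 ^^ i) z"
  have "snd w \<in> landing i"
    using landing[of "snd z" i] z i j k by (cases z) (auto simp: tent_T_iff w_def)
  moreover have "snd w \<ge> 0"
    using fold_map_pow_tent_T[OF z(1), of 1 i] by (simp add: tent_T_iff w_def)
  ultimately have sw: "snd w = 0 \<or> snd w = 1"
    by (auto simp: landing_def e_def split: if_splits)
  have eq: "(fold_map 1 ^^ n) z = (fold_map 1 ^^ (n - i)) (1, snd w)" if "i < n" for n
  proof -
    have "(fold_map 1 ^^ n) z = (fold_map 1 ^^ (n - i + i)) z" using that by simp
    also have "\<dots> = (fold_map 1 ^^ (n - i)) w" unfolding w_def funpow_add by simp
    also have "w = (1, snd w)" using i by (simp add: w_def prod_eq_iff)
    finally show ?thesis .
  qed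
  have "snd w \<noteq> 1"
    using fold_map_1_corner[of "j - i"] eq[of j] j by auto
  then have w0: "snd w = 0" using sw by simp
  have "(fold_map 1 ^^ Suc n) (1, 0) = (fold_map 1 ^^ n) (1, 1)" for n
    by (simp only: funpow_Suc_right comp_def) (simp add: fold_map_def)
  from this[of "k - i - 1"] have "(fold_map 1 ^^ k) z = (fold_map 1 ^^ (k - i - 1)) (1, 1)"
    using eq[of k] w0 j k by (simp add: Suc_diff_Suc del: funpow.simps)
  then show ?thesis using fold_map_1_corner[of "k - i - 1"] j k by simp
qed

section \<open>Balancing visits against expansion\<close>

lemma sqrt2_mult_ge:
  assumes "22 / 25 \<le> t"
  shows "1.414 * (22 / 25) \<le> sqrt 2 * t" "1 \<le> sqrt 2 * t"
proof -
  have "(1.414::real) \<le> sqrt 2" by (rule real_le_rsqrt) (simp add: power2_eq_square)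
  then show "1.414 * (22 / 25) \<le> sqrt 2 * t" using assms by (intro mult_mono) auto
  then show "1 \<le> sqrt 2 * t" by simp
qed

text \<open>Two visits in six steps are affordable when \<open>4 < (sqrt 2 * t) ^ 6\<close>, that is \<open>t ^ 6 > 1 / 2\<close>; for smaller
  \<open>t\<close> there are at most two visits in seven steps. The case \<open>t = 1\<close>, where the corner
  \<open>(1, 1)\<close> lies on the orbit of the crease, is special.\<close>

lemma few_hits:
  assumes "22 / 25 \<le> t" "t \<le> 1"
  obtains N h where "2 ^ h * (1 / (sqrt 2 * t)) ^ N < 1"
    "\<And>z. z \<in> tent_T \<Longrightarrow> card {j. j < N \<and> fst ((fold_map t ^^ j) z) = 1} \<le> h"
proof -
  interpret crease t by unfold_locales (use assms in auto)
  have tp: "t > 0" using assms by simp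
  have shift: "(fold_map t ^^ (n - m)) ((fold_map t ^^ m) z) = (fold_map t ^^ n) z" if "m < n" for m n z
    using that by (simp add: funpow_add[symmetric, THEN fun_cong, unfolded comp_def])
  have card2: "card {j. j < N \<and> fst ((fold_map t ^^ j) z) = 1} \<le> 2"
    if "t < 1" "N \<le> 6 \<or> N \<le> 7 \<and> t ^ 6 \<le> 1 / 2" "z \<in> tent_T" for N z
  proof (rule ccontr)
    define A where "A = {j. j < N \<and> fst ((fold_map t ^^ j) z) = 1}"
    assume "\<not> ?thesis"
    then have A: "finite A" "2 < card A" by (auto simp: A_def)
    \<comment> \<open>The first visits in increasing order; the orbit is restarted at the time
      \<open>a 0\<close> of the first one.\<close>
    define a where "a = enumerate A"
    have a: "a 0 \<in> A" "a 1 \<in> A" "a 2 \<in> A" "a 0 < a 1" "a 1 < a 2"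
      using A by (auto simp: a_def intro!: finite_enumerate_in_set finite_enumerate_mono)
    have "fst ((fold_map t ^^ (a 2 - a 0)) ((fold_map t ^^ a 0) z)) \<noteq> 1"
    proof (rule two_hits)
      show "(fold_map t ^^ a 0) z \<in> tent_T" using fold_map_pow_tent_T that(3) assms by auto
      show "fst ((fold_map t ^^ (a 1 - a 0)) ((fold_map t ^^ a 0) z)) = 1" using a by (simp add: shift A_def)
    qed (use a that in \<open>auto simp: A_def\<close>)
    then show False using a by (simp add: shift A_def)
  qed
  consider "t = 1" | "t < 1" "t ^ 6 \<le> 1 / 2" | "t < 1" "t ^ 6 > 1 / 2" using assms by linarith
  then show ?thesis
  proof cases
    case 1
    show ?thesis
    proof (rule that[of 3 7])
      have "2 ^ 3 * (1 / (sqrt 2 * t)) ^ 7 = 1 / sqrt 2"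
        using 1 real_sqrt_pow2[of 2] by (simp add: power_divide eval_nat_numeral)
      then show "2 ^ 3 * (1 / (sqrt 2 * t)) ^ 7 < 1" by simp
      fix z assume z: "z \<in> tent_T"
      show "card {j. j < 7 \<and> fst ((fold_map t ^^ j) z) = 1} \<le> 3"
      proof (rule ccontr)
        define A where "A = {j. j < 7 \<and> fst ((fold_map t ^^ j) z) = 1}"
        assume "\<not> ?thesis"
        then have A: "finite A" "3 < card A" by (auto simp: A_def)
        define a where "a = enumerate A"
        have a: "a 0 \<in> A" "a 1 \<in> A" "a 2 \<in> A" "a 3 \<in> A" "a 0 < a 1" "a 1 < a 2" "a 2 < a 3"
          using A by (auto simp: a_def intro!: finite_enumerate_in_set finite_enumerate_mono)
        have "fst ((fold_map t ^^ (a 3 - a 0)) ((fold_map t ^^ a 0) z)) \<noteq> 1"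
          unfolding 1
        proof (rule three_hits_1)
          show "(fold_map 1 ^^ a 0) z \<in> tent_T" using fold_map_pow_tent_T z by auto
          show "fst ((fold_map 1 ^^ (a 1 - a 0)) ((fold_map 1 ^^ a 0) z)) = 1" using a by (simp add: shift[unfolded 1] A_def 1)
          show "fst ((fold_map 1 ^^ (a 2 - a 0)) ((fold_map 1 ^^ a 0) z)) = 1" using a by (simp add: shift[unfolded 1] A_def 1)
        qed (use a in \<open>auto simp: A_def 1\<close>)
        then show False using a by (simp add: shift A_def)
      qed
    qed
  next
    case 2
    show ?thesis
    proof (rule that[of 2 7])
      \<comment> \<open>About 4.62; the sixth power is only about 3.71, so six steps would not do at
        the lower end of the range.\<close>
      have "(1.414 * (22 / 25)) ^ 7 \<le> (sqrt 2 * t) ^ 7"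
        by (intro power_mono sqrt2_mult_ge assms) auto
      moreover have "4 < (1.414 * (22 / 25) :: real) ^ 7" by (simp add: power_divide eval_nat_numeral)
      ultimately have "4 < (sqrt 2 * t) ^ 7" by linarith
      moreover have "2 ^ 2 * (1 / (sqrt 2 * t)) ^ 7 = 4 / (sqrt 2 * t) ^ 7" by (simp add: power_divide)
      ultimately show "2 ^ 2 * (1 / (sqrt 2 * t)) ^ 7 < 1" by (simp add: divide_simps)
    qed (use card2 2 in auto)
  next
    case 3
    show ?thesis
    proof (rule that[of 2 6])
      have "(sqrt 2) ^ 6 = 8" using real_sqrt_pow2[of 2] by (simp add: eval_nat_numeral)
      then have "2 ^ 2 * (1 / (sqrt 2 * t)) ^ 6 = 1 / (2 * t ^ 6)" by (simp add: power_divide power_mult_distrib)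
      also have "\<dots> < 1" using 3 by (simp add: divide_simps)
      finally show "2 ^ 2 * (1 / (sqrt 2 * t)) ^ 6 < 1" .
    qed (use card2 3 in auto)
  qed
qed

text \<open>The number 1.245 separates \<open>22 / 25 * sqrt 2\<close>, about 1.2445, from
  \<open>(sqrt 2 + 1) powr (1 / 4)\<close>, about 1.2465.\<close>

lemma tent_tau_ge: "22 / 25 \<le> tent_tau"
proof -
  have "(1.414::real) \<le> sqrt 2" by (rule real_le_rsqrt) (simp add: power2_eq_square)
  then have "(12450 / 10000) ^ 4 \<le> sqrt 2 + (1::real)" by (simp add: power_divide)
  then have "((12450 / 10000) ^ 4) powr (1 / 4) \<le> (sqrt 2 + 1 :: real) powr (1 / 4)"
    by (intro powr_mono2) auto
  moreover have "((12450 / 10000 :: real) ^ 4) powr (1 / 4) = 12450 / 10000"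
    using powr_powr[of "12450 / 10000" 4 "1 / 4"] by simp
  ultimately have "12450 / 10000 \<le> (sqrt 2 + 1 :: real) powr (1 / 4)" by simp
  moreover have "sqrt 2 \<le> 1.4143" by (rule real_le_lsqrt) (auto simp: power2_eq_square)
  then have "22 / 25 * sqrt 2 \<le> 12450 / 10000" by simp
  ultimately show ?thesis by (simp add: tent_tau_def field_simps)
qed

section \<open>A uniform Lasota-Yorke inequality\<close>

lemma tendsto_fold_map_pow:
  assumes "(x \<longlongrightarrow> z) F" "(u \<longlongrightarrow> t) F"
  shows "((\<lambda>n. (fold_map (u n) ^^ k) (x n)) \<longlongrightarrow> (fold_map t ^^ k) z) F"
proof (induction k)
  case (Suc k)
  then show ?case using assms(2) unfolding funpow.simps comp_def fold_map_def by (intro tendsto_intros)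
qed (use assms in simp)

lemma hit_weight_le_card:
  assumes "\<rho> \<ge> 0" "8 ^ N * \<rho> \<le> \<epsilon>"
  shows "hit_weight t \<rho> N z \<le> 2 ^ card {j. j < N \<and> \<bar>fst ((fold_map t ^^ j) z) - 1\<bar> \<le> \<epsilon>}"
proof -
  have "8 ^ j * \<rho> \<le> \<epsilon>" if "j < N" for j
  proof -
    have "8 ^ j * \<rho> \<le> 8 ^ N * \<rho>" using that assms by (intro mult_right_mono power_increasing) auto
    then show ?thesis using assms by simp
  qed
  then have "hit_weight t \<rho> N z \<le> (\<Prod>j<N. if \<bar>fst ((fold_map t ^^ j) z) - 1\<bar> \<le> \<epsilon> then 2 else 1)"
    unfolding hit_weight_def by (intro prod_mono_ennreal) force
  also have "\<dots> = (\<Prod>j\<in>{j. j < N \<and> \<bar>fst ((fold_map t ^^ j) z) - 1\<bar> \<le> \<epsilon>}. 2)"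
    by (rule prod.mono_neutral_cong_right) auto
  finally show ?thesis by simp
qed

lemma compact_tent_T: "compact tent_T"
proof -
  have eq: "tent_T = {z. 0 \<le> snd z} \<inter> {z. snd z \<le> 1 - \<bar>fst z - 1\<bar>}" by (auto simp: tent_T_iff)
  have "closed tent_T" unfolding eq
    by (intro closed_Int closed_Collect_le continuous_intros)
  moreover have "bounded tent_T"
  proof (rule bounded_subset)
    show "bounded (cbox (0, 0) (2, 1 :: real))" by simp
    show "tent_T \<subseteq> cbox (0, 0) (2, 1)" by (auto simp: tent_T_iff cbox_Pair_eq)
  qed
  ultimately show ?thesis by (simp add: compact_eq_bounded_closed)
qed

text \<open>If no tolerance worked, offending points and parameters would converge along a
  subsequence, and in the limit near visits become exact visits of one orbit. The point
  \<open>z\<close> is only required to be close to \<open>tent_T\<close>: an increment of a function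
  supported there may have its base point just outside.\<close>

lemma few_near_hits:
  assumes hits: "\<And>z. z \<in> tent_T \<Longrightarrow> card {j. j < N \<and> fst ((fold_map t0 ^^ j) z) = 1} \<le> h"
  obtains \<epsilon> where "\<epsilon> > 0" "\<And>t z z0. dist t t0 < \<epsilon> \<Longrightarrow> z0 \<in> tent_T \<Longrightarrow> dist z z0 < \<epsilon> \<Longrightarrow>
    card {j. j < N \<and> \<bar>fst ((fold_map t ^^ j) z) - 1\<bar> \<le> \<epsilon>} \<le> h"
proof (rule ccontr)
  define \<epsilon> where "\<epsilon> n = inverse (real (Suc n))" for n
  have \<epsilon>: "\<epsilon> n > 0" "\<epsilon> \<longlonglongrightarrow> 0" for n
    using LIMSEQ_inverse_real_of_nat by (simp_all add: \<epsilon>_def[abs_def])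
  assume "\<not> thesis"
  define Q where "Q n p \<longleftrightarrow> (case p of (t, z, z0) \<Rightarrow> dist t t0 < \<epsilon> n \<and> z0 \<in> tent_T \<and> dist z z0 < \<epsilon> n \<and>
    \<not> card {j. j < N \<and> \<bar>fst ((fold_map t ^^ j) z) - 1\<bar> \<le> \<epsilon> n} \<le> h)" for n p
  have "\<exists>p. Q n p" for n
    using that[OF \<epsilon>(1)[of n]] \<open>\<not> thesis\<close> unfolding Q_def by blast
  then obtain p where p: "Q n (p n)" for n by metis
  define t where "t n = fst (p n)" for n
  define z where "z n = fst (snd (p n))" for n
  define z0 where "z0 n = snd (snd (p n))" for n
  have *: "dist (t n) t0 < \<epsilon> n" "z0 n \<in> tent_T" "dist (z n) (z0 n) < \<epsilon> n"
    "\<not> card {j. j < N \<and> \<bar>fst ((fold_map (t n) ^^ j) (z n)) - 1\<bar> \<le> \<epsilon> n} \<le> h" for n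
    using p[of n] by (auto simp: Q_def t_def z_def z0_def split_beta)
  obtain x r where x: "x \<in> tent_T" "strict_mono (r :: nat \<Rightarrow> nat)" "(z0 \<circ> r) \<longlonglongrightarrow> x"
    using seq_compactE[OF compact_imp_seq_compact[OF compact_tent_T], of z0] *(2) by blast
  have \<epsilon>r: "(\<lambda>n. \<epsilon> (r n)) \<longlonglongrightarrow> 0" using LIMSEQ_subseq_LIMSEQ[OF \<epsilon>(2) x(2)] by (simp add: comp_def)
  have t: "(\<lambda>n. t (r n)) \<longlonglongrightarrow> t0"
    using *(1) by (intro metric_tendsto_imp_tendsto[OF \<epsilon>r]) (auto intro!: always_eventually less_imp_le simp: \<epsilon>(1) less_imp_le)
  have "(\<lambda>n. dist (z (r n)) (z0 (r n))) \<longlonglongrightarrow> 0"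
    by (rule tendsto_sandwich[OF _ _ tendsto_const \<epsilon>r]) (auto intro!: always_eventually less_imp_le *(3))
  moreover have "(\<lambda>n. dist (z0 (r n)) x) \<longlonglongrightarrow> 0" using x(3)[THEN tendsto_dist_iff[THEN iffD1]] by (simp add: comp_def)
  ultimately have "(\<lambda>n. dist (z (r n)) (z0 (r n)) + dist (z0 (r n)) x) \<longlonglongrightarrow> 0 + 0" by (rule tendsto_add)
  then have S: "(\<lambda>n. dist (z (r n)) (z0 (r n)) + dist (z0 (r n)) x) \<longlonglongrightarrow> 0" by simp
  have "(\<lambda>n. dist (z (r n)) x) \<longlonglongrightarrow> 0"
    by (rule tendsto_sandwich[OF _ _ tendsto_const S]) (auto intro!: always_eventually dist_triangle)
  then have z: "(\<lambda>n. z (r n)) \<longlonglongrightarrow> x" by (rule tendsto_dist_iff[THEN iffD2])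
  \<comment> \<open>The exact visits of the limit orbit. At each of the finitely many other times
    the distance to the crease stays positive in the limit and eventually exceeds the shrinking
    tolerance.\<close>
  define J where "J = {j. j < N \<and> fst ((fold_map t0 ^^ j) x) = 1}"
  have "\<forall>\<^sub>F n in sequentially. \<forall>j\<in>{..<N} - J. \<epsilon> (r n) < \<bar>fst ((fold_map (t (r n)) ^^ j) (z (r n))) - 1\<bar>"
  proof (rule eventually_ball_finite)
    show "\<forall>j\<in>{..<N} - J. \<forall>\<^sub>F n in sequentially. \<epsilon> (r n) < \<bar>fst ((fold_map (t (r n)) ^^ j) (z (r n))) - 1\<bar>"
    proof
      fix j assume j: "j \<in> {..<N} - J"
      have "(\<lambda>n. \<bar>fst ((fold_map (t (r n)) ^^ j) (z (r n))) - 1\<bar> - \<epsilon> (r n)) \<longlonglongrightarrow> \<bar>fst ((fold_map t0 ^^ j) x) - 1\<bar> - 0"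
        by (intro tendsto_intros tendsto_fold_map_pow z t \<epsilon>r)
      moreover have "\<bar>fst ((fold_map t0 ^^ j) x) - 1\<bar> - 0 > 0" using j by (auto simp: J_def)
      ultimately have "\<forall>\<^sub>F n in sequentially. \<bar>fst ((fold_map (t (r n)) ^^ j) (z (r n))) - 1\<bar> - \<epsilon> (r n) > 0"
        by (rule order_tendstoD(1))
      then show "\<forall>\<^sub>F n in sequentially. \<epsilon> (r n) < \<bar>fst ((fold_map (t (r n)) ^^ j) (z (r n))) - 1\<bar>"
        by eventually_elim simp
    qed
  qed auto
  from eventually_happens'[OF sequentially_bot this]
  obtain n where n: "\<forall>j\<in>{..<N} - J. \<epsilon> (r n) < \<bar>fst ((fold_map (t (r n)) ^^ j) (z (r n))) - 1\<bar>" ..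
  have "{j. j < N \<and> \<bar>fst ((fold_map (t (r n)) ^^ j) (z (r n))) - 1\<bar> \<le> \<epsilon> (r n)} \<subseteq> J"
    using n by force
  then have "card {j. j < N \<and> \<bar>fst ((fold_map (t (r n)) ^^ j) (z (r n))) - 1\<bar> \<le> \<epsilon> (r n)} \<le> card J"
    by (rule card_mono[rotated]) (auto simp: J_def)
  also have "\<dots> \<le> h" using hits[OF x(1)] by (simp add: J_def)
  finally show False using *(4)[of "r n"] by simp
qed

lemma transfer_tent_T:
  assumes f: "\<And>z. z \<notin> tent_T \<Longrightarrow> f z = 0" and t: "0 < t" "t \<le> 1" and z: "z \<notin> tent_T"
  shows "transfer t f z = 0"
proof -
  define a where "a = (fst z + snd z) / (2 * t)"
  define b where "b = (fst z - snd z) / (2 * t)"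
  have eq: "z = (t * (a + b), t * (a - b))" using t by (cases z) (auto simp: a_def b_def field_simps)
  have "f (a, b) = 0 \<and> f (2 - a, b) = 0" if "a < 1"
  proof -
    have "fold_map t (a, b) = z" "fold_map t (2 - a, b) = z"
      using that eq by (auto simp: fold_map_def)
    then show ?thesis using fold_map_tent_T[of "(a, b)" t] fold_map_tent_T[of "(2 - a, b)" t] z t f by auto
  qed
  then show ?thesis by (simp add: transfer_def Let_def a_def[symmetric] b_def[symmetric])
qed

lemma transfer_pow_tent_T:
  assumes "\<And>z. z \<notin> tent_T \<Longrightarrow> f z = 0" "0 < t" "t \<le> 1" "z \<notin> tent_T"
  shows "(transfer t ^^ k) f z = 0"
  using assms(4) by (induction k arbitrary: z) (use assms transfer_tent_T in auto)

text \<open>An increment vanishes unless one of its end points lies in \<open>T\<close>, so the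
  weights need to be compared only near \<open>T\<close>.\<close>

lemma incr_mono_near:
  assumes "\<And>z z0. z0 \<in> T \<Longrightarrow> dist z z0 \<le> norm u \<Longrightarrow> w z \<le> w' z" and f: "\<And>z. z \<notin> T \<Longrightarrow> f z = 0"
  shows "incr w f u \<le> incr w' f u"
  unfolding incr_def
proof (intro nn_integral_mono)
  fix z
  consider "z \<in> T" | "z + u \<in> T" | "z \<notin> T" "z + u \<notin> T" by blast
  then show "w z * ennreal \<bar>f (z + u) - f z\<bar> \<le> w' z * ennreal \<bar>f (z + u) - f z\<bar>"
  proof cases
    case 1
    then have "w z \<le> w' z" using assms(1)[of z z] by simp
    then show ?thesis by (intro mult_right_mono) auto
  next
    case 2
    then have "w z \<le> w' z" using assms(1)[of "z + u" z] by (simp add: dist_norm)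
    then show ?thesis by (intro mult_right_mono) auto
  qed (simp add: f)
qed

lemma norm_directions:
  assumes "s \<ge> 0"
  shows "norm (s, 0::real) = s" "norm (0::real, s) = s" "norm (s / sqrt 2, s / sqrt 2) = s" "norm (s / sqrt 2, - s / sqrt 2) = s"
proof -
  have "(s / sqrt 2)\<^sup>2 + (s / sqrt 2)\<^sup>2 = s\<^sup>2" by (simp add: power_divide)
  then show "norm (s / sqrt 2, s / sqrt 2) = s" "norm (s / sqrt 2, - s / sqrt 2) = s"
    using assms by (simp_all add: norm_Pair)
qed (use assms in \<open>auto simp: norm_Pair\<close>)

lemma variation_mono_near:
  assumes "\<And>z z0. z0 \<in> T \<Longrightarrow> dist z z0 \<le> s \<Longrightarrow> w z \<le> w' z" and "\<And>z. z \<notin> T \<Longrightarrow> f z = 0" and "s \<ge> 0"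
  shows "variation w f s \<le> variation w' f s"
  unfolding variation_def by (intro add_mono incr_mono_near[of T]) (use assms norm_directions in auto)

lemma variation_const:
  assumes [measurable]: "f \<in> borel_measurable borel"
  shows "variation (\<lambda>_. c) f s = c * modulus f s"
  unfolding variation_def incr_def by (simp add: nn_integral_cmult distrib_left)

text \<open>A Lasota-Yorke inequality in which the slope \<open>B\<close> of a linear bound on the
  modulus plays the role of the variation norm. Hypothesis and conclusion have the same shape on the
  same range of \<open>s\<close>, so it can be iterated.\<close>

definition contracts :: "real \<Rightarrow> nat \<Rightarrow> real \<Rightarrow> real \<Rightarrow> real \<Rightarrow> bool" where
  "contracts t N \<kappa> C s0 \<longleftrightarrow> (\<forall>f B. f \<in> borel_measurable borel \<longrightarrow> (\<forall>z. z \<notin> tent_T \<longrightarrow> f z = 0) \<longrightarrow>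
     (\<forall>s. 0 < s \<longrightarrow> s \<le> s0 \<longrightarrow> modulus f s \<le> B * ennreal s) \<longrightarrow>
     (\<forall>s. 0 < s \<longrightarrow> s \<le> s0 \<longrightarrow> modulus ((transfer t ^^ N) f) s \<le> (ennreal \<kappa> * B + ennreal C * L1norm f) * ennreal s))"

lemma contractsD:
  assumes "contracts t N \<kappa> C s0" "f \<in> borel_measurable borel" "\<And>z. z \<notin> tent_T \<Longrightarrow> f z = 0"
    "\<And>s. 0 < s \<Longrightarrow> s \<le> s0 \<Longrightarrow> modulus f s \<le> B * ennreal s" "0 < s" "s \<le> s0"
  shows "modulus ((transfer t ^^ N) f) s \<le> (ennreal \<kappa> * B + ennreal C * L1norm f) * ennreal s"
  using assms unfolding contracts_def by blast

lemma lasota_yorke: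
  assumes t0: "22 / 25 \<le> t0" "t0 \<le> 1"
  obtains N \<kappa> C s0 \<delta> where "0 < N" "0 \<le> \<kappa>" "\<kappa> < 1" "0 \<le> C" "0 < s0" "0 < \<delta>"
    "\<And>t. 22 / 25 \<le> t \<Longrightarrow> t \<le> 1 \<Longrightarrow> dist t t0 < \<delta> \<Longrightarrow> contracts t N \<kappa> C s0"
proof -
  obtain N h where Nh: "2 ^ h * (1 / (sqrt 2 * t0)) ^ N < 1"
    "\<And>z. z \<in> tent_T \<Longrightarrow> card {j. j < N \<and> fst ((fold_map t0 ^^ j) z) = 1} \<le> h"
    by (rule few_hits[OF t0]) blast
  obtain \<epsilon> where \<epsilon>: "\<epsilon> > 0" "\<And>t z z0. dist t t0 < \<epsilon> \<Longrightarrow> z0 \<in> tent_T \<Longrightarrow> dist z z0 < \<epsilon> \<Longrightarrow>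
    card {j. j < N \<and> \<bar>fst ((fold_map t ^^ j) z) - 1\<bar> \<le> \<epsilon>} \<le> h"
    proof (rule few_near_hits[OF Nh(2)])
    fix \<epsilon> :: real
    assume "\<epsilon> > 0" "\<And>t z z0. dist t t0 < \<epsilon> \<Longrightarrow> z0 \<in> tent_T \<Longrightarrow> dist z z0 < \<epsilon> \<Longrightarrow>
      card {j. j < N \<and> \<bar>fst ((fold_map t ^^ j) z) - 1\<bar> \<le> \<epsilon>} \<le> h"
    then show thesis by (rule that)
  qed
  \<comment> \<open>The strict gap on both sides leaves room for the factor to vary with
    \<open>t\<close> near \<open>t0\<close>.\<close>
  obtain \<kappa> where \<kappa>: "2 ^ h * (1 / (sqrt 2 * t0)) ^ N < \<kappa>" "\<kappa> < 1" using dense[OF Nh(1)] by auto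
  have \<kappa>0: "0 \<le> \<kappa>" using \<kappa>(1) t0 by (intro order_trans[OF _ less_imp_le[OF \<kappa>(1)]]) auto
  have "isCont (\<lambda>t. 2 ^ h * (1 / (sqrt 2 * t)) ^ N) t0" using t0 by (intro continuous_intros) auto
  then have "\<forall>\<^sub>F t in at t0. 2 ^ h * (1 / (sqrt 2 * t)) ^ N < \<kappa>"
    unfolding isCont_def by (rule order_tendstoD(2)) (rule \<kappa>(1))
  then obtain d where d: "d > 0" "\<And>t. t \<noteq> t0 \<Longrightarrow> dist t t0 < d \<Longrightarrow> 2 ^ h * (1 / (sqrt 2 * t)) ^ N < \<kappa>"
    by (auto simp: eventually_at)
  \<comment> \<open>Chosen so that even the widest tolerance in \<open>hit_weight\<close> stays
    within \<open>\<epsilon>\<close>.\<close>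
  define \<rho> where "\<rho> = \<epsilon> / 8 ^ N"
  have \<rho>: "\<rho> > 0" "8 ^ N * \<rho> \<le> \<epsilon>" using \<epsilon>(1) by (auto simp: \<rho>_def)
  \<comment> \<open>The first bound is what \<open>transfer_pow_variation\<close> asks for; the
    second keeps base points of nonzero increments closer than \<open>\<epsilon>\<close> to
    \<open>tent_T\<close>.\<close>
  define s0 where "s0 = min (\<rho> / 3) (\<epsilon> / 2)"
  define C where "C = 24 * 2 ^ N / \<rho>"
  have N: "0 < N" 
  proof (rule ccontr)
    assume "\<not> 0 < N"
    then have "(2::real) ^ h < 1" using Nh(1) by simp
    moreover have "(1::real) \<le> 2 ^ h" by simp
    ultimately show False by linarith
  qed
  show ?thesis
  proof (rule that[of N \<kappa> C s0 "min d \<epsilon>"])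
    fix t assume t: "22 / 25 \<le> t" "t \<le> 1" "dist t t0 < min d \<epsilon>"
    show "contracts t N \<kappa> C s0"
      unfolding contracts_def
    proof (intro allI impI)
      fix f B s
      assume f: "f \<in> borel_measurable borel" "\<forall>z. z \<notin> tent_T \<longrightarrow> f z = 0"
        and B: "\<forall>s. 0 < s \<longrightarrow> s \<le> s0 \<longrightarrow> modulus f s \<le> B * ennreal s"
        and s: "0 < s" "s \<le> s0"
      define \<sigma> where "\<sigma> = 1 / (sqrt 2 * t)"
      have st: "1 \<le> sqrt 2 * t" by (rule sqrt2_mult_ge(2)[OF t(1)])
      then have \<sigma>: "0 < \<sigma>" "\<sigma> \<le> 1" using t by (auto simp: \<sigma>_def)
      have \<sigma>N: "0 < \<sigma> ^ N" "\<sigma> ^ N \<le> 1" using \<sigma> by (auto intro: power_le_one)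
      have sN: "0 < \<sigma> ^ N * s" "\<sigma> ^ N * s \<le> s" using \<sigma>N s mult_right_mono[of "\<sigma> ^ N" 1 s] by auto
      have "modulus ((transfer t ^^ N) f) s \<le>
        variation (hit_weight t \<rho> N) f (\<sigma> ^ N * s) + ennreal (24 * 2 ^ N * s / \<rho>) * L1norm f"
        unfolding \<sigma>_def by (rule transfer_pow_variation) (use f t s \<sigma> in \<open>auto simp: \<sigma>_def s0_def\<close>)
      also have "variation (hit_weight t \<rho> N) f (\<sigma> ^ N * s) \<le> variation (\<lambda>_. 2 ^ h) f (\<sigma> ^ N * s)"
      proof (rule variation_mono_near[of tent_T])
        fix z z0 assume z: "z0 \<in> tent_T" "dist z z0 \<le> \<sigma> ^ N * s"
        have "s \<le> \<epsilon> / 2" using s(2) by (simp add: s0_def)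
        then have "dist z z0 < \<epsilon>" using z(2) sN(2) \<epsilon>(1) by linarith
        have "hit_weight t \<rho> N z \<le> 2 ^ card {j. j < N \<and> \<bar>fst ((fold_map t ^^ j) z) - 1\<bar> \<le> \<epsilon>}"
          by (rule hit_weight_le_card) (use \<rho> in auto)
        also have "\<dots> \<le> 2 ^ h"
          using \<epsilon>(2)[of t z0 z] z \<open>dist z z0 < \<epsilon>\<close> t by (intro power_increasing) auto
        finally show "hit_weight t \<rho> N z \<le> 2 ^ h" .
      qed (use f sN in auto)
      also have "\<dots> = 2 ^ h * modulus f (\<sigma> ^ N * s)" by (rule variation_const) (rule f)
      also have "\<dots> \<le> 2 ^ h * (B * ennreal (\<sigma> ^ N * s))"
        by (intro mult_left_mono B[rule_format] sN(1) order_trans[OF sN(2) s(2)]) auto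
      also have "\<dots> = ennreal (2 ^ h * \<sigma> ^ N) * B * ennreal s"
        using \<sigma> s by (simp add: ennreal_mult ennreal_power[symmetric] mult_ac)
      also have "\<dots> \<le> ennreal \<kappa> * B * ennreal s"
        using d(2)[of t] \<kappa>(1) t by (intro mult_right_mono ennreal_leI) (cases "t = t0"; auto simp: \<sigma>_def)+
      also have "ennreal (24 * 2 ^ N * s / \<rho>) * L1norm f = ennreal C * L1norm f * ennreal s"
      proof -
        have "ennreal (24 * 2 ^ N * s / \<rho>) = ennreal (C * s)" by (simp add: C_def)
        also have "\<dots> = ennreal C * ennreal s" using \<rho> s by (intro ennreal_mult) (auto simp: C_def)
        finally show ?thesis by (simp add: mult_ac)
      qed
      finally show "modulus ((transfer t ^^ N) f) s \<le> (ennreal \<kappa> * B + ennreal C * L1norm f) * ennreal s"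
        by (simp add: distrib_right add_mono)
    qed
  qed (use N \<kappa> \<kappa>0 d \<epsilon> \<rho> in \<open>auto simp: s0_def C_def\<close>)
qed

section \<open>Density of Lipschitz functions\<close>

lemma L1norm_triangle:
  assumes [measurable]: "f \<in> borel_measurable borel" "g \<in> borel_measurable borel"
  shows "L1norm (\<lambda>z. f z + g z) \<le> L1norm f + L1norm g"
  unfolding L1norm_def
  by (subst nn_integral_add[symmetric], measurable)
    (auto intro!: nn_integral_mono ennreal_leI simp: ennreal_plus[symmetric] simp del: ennreal_plus)

lemma L1norm_diff_triangle:
  assumes [measurable]: "f \<in> borel_measurable borel" "g \<in> borel_measurable borel" "h \<in> borel_measurable borel"
  shows "L1norm (\<lambda>z. f z - h z) \<le> L1norm (\<lambda>z. f z - g z) + L1norm (\<lambda>z. g z - h z)"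
  using L1norm_triangle[of "\<lambda>z. f z - g z" "\<lambda>z. g z - h z"] by simp

lemma L1norm_minus_commute: "L1norm (\<lambda>z. f z - g z) = L1norm (\<lambda>z. g z - f z)"
  unfolding L1norm_def by (simp add: abs_minus_commute)

lemma L1norm_cmult:
  assumes [measurable]: "f \<in> borel_measurable borel"
  shows "L1norm (\<lambda>z. c * f z) = ennreal \<bar>c\<bar> * L1norm f"
  unfolding L1norm_def by (subst nn_integral_cmult[symmetric]) (auto simp: abs_mult ennreal_mult)

lemma emeasure_tent_T_finite: "emeasure lborel tent_T < \<infinity>"
  using emeasure_bounded_finite[OF compact_imp_bounded[OF compact_tent_T]] by simp

lemma measurable_tent_T [measurable]: "tent_T \<in> sets borel"
  using compact_tent_T by (simp add: borel_compact)

text \<open>The Lipschitz bound is global, so \<open>g\<close> tends to zero at the boundary of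
  \<open>tent_T\<close> and extension by zero creates no jump that the modulus would see.\<close>

definition tent_lipschitz :: "real \<Rightarrow> (real \<times> real \<Rightarrow> real) \<Rightarrow> bool" where
  "tent_lipschitz L g \<longleftrightarrow> 0 \<le> L \<and> (\<forall>x y. \<bar>g x - g y\<bar> \<le> L * dist x y) \<and> (\<forall>z. z \<notin> tent_T \<longrightarrow> g z = 0)"

definition lip_approximable :: "(real \<times> real \<Rightarrow> real) \<Rightarrow> bool" where
  "lip_approximable h \<longleftrightarrow> (\<forall>\<epsilon>>0. \<exists>g L. tent_lipschitz L g \<and> L1norm (\<lambda>z. h z - g z) \<le> ennreal \<epsilon>)"

lemma tent_lipschitzD:
  assumes "tent_lipschitz L g"
  shows "0 \<le> L" "\<bar>g x - g y\<bar> \<le> L * dist x y" "z \<notin> tent_T \<Longrightarrow> g z = 0"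
  using assms unfolding tent_lipschitz_def by blast+

lemma tent_lipschitz_continuous:
  assumes "tent_lipschitz L g"
  shows "continuous_on UNIV g"
proof -
  have "L-lipschitz_on UNIV g"
    by (rule lipschitz_onI) (use tent_lipschitzD[OF assms] in \<open>auto simp: dist_real_def\<close>)
  then show ?thesis by (rule lipschitz_on_continuous_on)
qed

lemma tent_lipschitz_measurable: "tent_lipschitz L g \<Longrightarrow> g \<in> borel_measurable borel"
  by (intro borel_measurable_continuous_onI tent_lipschitz_continuous)

lemma tent_lipschitz_add:
  assumes "tent_lipschitz L g" "tent_lipschitz L' g'"
  shows "tent_lipschitz (L + L') (\<lambda>z. g z + g' z)"
proof -
  have "\<bar>(g x + g' x) - (g y + g' y)\<bar> \<le> (L + L') * dist x y" for x y
    using tent_lipschitzD(2)[OF assms(1), of x y] tent_lipschitzD(2)[OF assms(2), of x y]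
    unfolding distrib_right by linarith
  then show ?thesis using assms by (simp add: tent_lipschitz_def)
qed

lemma tent_lipschitz_cmult:
  assumes "tent_lipschitz L g"
  shows "tent_lipschitz (\<bar>c\<bar> * L) (\<lambda>z. c * g z)"
proof -
  have "\<bar>c * g x - c * g y\<bar> \<le> (\<bar>c\<bar> * L) * dist x y" for x y
    using mult_left_mono[OF tent_lipschitzD(2)[OF assms, of x y], of "\<bar>c\<bar>"]
    by (simp add: abs_mult[symmetric] algebra_simps)
  then show ?thesis using assms by (simp add: tent_lipschitz_def)
qed

lemma lip_approximable_limit:
  assumes [measurable]: "h \<in> borel_measurable borel"
    and "\<And>\<epsilon>. \<epsilon> > 0 \<Longrightarrow> \<exists>h'. h' \<in> borel_measurable borel \<and> lip_approximable h' \<and> L1norm (\<lambda>z. h z - h' z) \<le> ennreal \<epsilon>"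
  shows "lip_approximable h"
  unfolding lip_approximable_def
proof (intro allI impI)
  fix \<epsilon> :: real assume "\<epsilon> > 0"
  then have e: "\<epsilon> / 2 > 0" by simp
  obtain h' where [measurable]: "h' \<in> borel_measurable borel" and h': "lip_approximable h'" "L1norm (\<lambda>z. h z - h' z) \<le> ennreal (\<epsilon> / 2)"
    using assms(2)[OF e] by blast
  obtain g L where g: "tent_lipschitz L g" "L1norm (\<lambda>z. h' z - g z) \<le> ennreal (\<epsilon> / 2)"
    using h'(1) e unfolding lip_approximable_def by blast
  note [measurable] = tent_lipschitz_measurable[OF g(1)]
  have "L1norm (\<lambda>z. h z - g z) \<le> L1norm (\<lambda>z. h z - h' z) + L1norm (\<lambda>z. h' z - g z)"
    by (rule L1norm_diff_triangle) measurable
  also have "\<dots> \<le> ennreal (\<epsilon> / 2) + ennreal (\<epsilon> / 2)" by (intro add_mono h' g)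
  also have "\<dots> = ennreal \<epsilon>" using e by (subst ennreal_plus[symmetric]) auto
  finally show "\<exists>g L. tent_lipschitz L g \<and> L1norm (\<lambda>z. h z - g z) \<le> ennreal \<epsilon>" using g by blast
qed

lemma lip_approximable_lim:
  assumes [measurable]: "\<And>n::nat. s n \<in> borel_measurable borel" "h \<in> borel_measurable borel" "w \<in> borel_measurable borel"
    and s: "\<And>n. lip_approximable (s n)" and lim: "AE z in lborel. (\<lambda>n. s n z) \<longlonglongrightarrow> h z"
    and w: "\<And>n z. \<bar>s n z\<bar> \<le> w z" "L1norm w < \<infinity>"
  shows "lip_approximable h"
proof (rule lip_approximable_limit)
  fix \<epsilon> :: real assume e: "\<epsilon> > 0"
  have "(\<lambda>n. \<integral>\<^sup>+z. norm (h z - s n z) \<partial>lborel) \<longlonglongrightarrow> 0"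
  proof (rule nn_integral_dominated_convergence_norm)
    show "AE z in lborel. norm (s n z) \<le> \<bar>w z\<bar>" for n
      using w(1)[of n] by (auto intro!: AE_I2 order_trans[OF w(1)])
  qed (use w(2) lim in \<open>auto simp: L1norm_def\<close>)
  then have "\<forall>\<^sub>F n in sequentially. (\<integral>\<^sup>+z. norm (h z - s n z) \<partial>lborel) < ennreal \<epsilon>"
    by (rule order_tendstoD(2)) (use e in simp)
  from eventually_happens'[OF sequentially_bot this] obtain n where "(\<integral>\<^sup>+z. norm (h z - s n z) \<partial>lborel) < ennreal \<epsilon>" ..
  then have "L1norm (\<lambda>z. h z - s n z) \<le> ennreal \<epsilon>" by (simp add: L1norm_def)
  then show "\<exists>h'. h' \<in> borel_measurable borel \<and> lip_approximable h' \<and> L1norm (\<lambda>z. h z - h' z) \<le> ennreal \<epsilon>"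
    using s by (intro exI[of _ "s n"]) auto
qed measurable

lemma lip_approximable_add:
  assumes [measurable]: "h \<in> borel_measurable borel" "h' \<in> borel_measurable borel" and "lip_approximable h" "lip_approximable h'"
  shows "lip_approximable (\<lambda>z. h z + h' z)"
  unfolding lip_approximable_def
proof (intro allI impI)
  fix \<epsilon> :: real assume "\<epsilon> > 0"
  then have e: "\<epsilon> / 2 > 0" by simp
  obtain g L where g: "tent_lipschitz L g" "L1norm (\<lambda>z. h z - g z) \<le> ennreal (\<epsilon> / 2)"
    using assms(3) e unfolding lip_approximable_def by blast
  obtain g' L' where g': "tent_lipschitz L' g'" "L1norm (\<lambda>z. h' z - g' z) \<le> ennreal (\<epsilon> / 2)"
    using assms(4) e unfolding lip_approximable_def by blast
  note [measurable] = tent_lipschitz_measurable[OF g(1)] tent_lipschitz_measurable[OF g'(1)]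
  have "L1norm (\<lambda>z. (h z - g z) + (h' z - g' z)) \<le> L1norm (\<lambda>z. h z - g z) + L1norm (\<lambda>z. h' z - g' z)"
    by (rule L1norm_triangle) measurable
  also have "\<dots> \<le> ennreal (\<epsilon> / 2) + ennreal (\<epsilon> / 2)" by (intro add_mono g g')
  also have "\<dots> = ennreal \<epsilon>" using e by (subst ennreal_plus[symmetric]) auto
  finally have "L1norm (\<lambda>z. h z + h' z - (g z + g' z)) \<le> ennreal \<epsilon>" by (simp add: algebra_simps)
  then show "\<exists>g L. tent_lipschitz L g \<and> L1norm (\<lambda>z. h z + h' z - g z) \<le> ennreal \<epsilon>"
    using tent_lipschitz_add[OF g(1) g'(1)] by blast
qed

lemma lip_approximable_cmult:
  assumes [measurable]: "h \<in> borel_measurable borel" and "lip_approximable h"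
  shows "lip_approximable (\<lambda>z. c * h z)"
  unfolding lip_approximable_def
proof (intro allI impI)
  fix \<epsilon> :: real assume e: "\<epsilon> > 0"
  then have e': "\<epsilon> / (\<bar>c\<bar> + 1) > 0" by simp
  obtain g L where g: "tent_lipschitz L g" "L1norm (\<lambda>z. h z - g z) \<le> ennreal (\<epsilon> / (\<bar>c\<bar> + 1))"
    using assms(2) e' unfolding lip_approximable_def by blast
  note [measurable] = tent_lipschitz_measurable[OF g(1)]
  have "L1norm (\<lambda>z. c * (h z - g z)) = ennreal \<bar>c\<bar> * L1norm (\<lambda>z. h z - g z)"
    by (rule L1norm_cmult) measurable
  also have "\<dots> \<le> ennreal \<bar>c\<bar> * ennreal (\<epsilon> / (\<bar>c\<bar> + 1))" by (intro mult_left_mono g) auto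
  also have "\<dots> \<le> ennreal \<epsilon>" using e by (subst ennreal_mult[symmetric]) (auto intro!: ennreal_leI simp: field_simps)
  finally have "L1norm (\<lambda>z. c * h z - c * g z) \<le> ennreal \<epsilon>" by (simp add: algebra_simps)
  then show "\<exists>g L. tent_lipschitz L g \<and> L1norm (\<lambda>z. c * h z - g z) \<le> ennreal \<epsilon>"
    using tent_lipschitz_cmult[OF g(1)] by blast
qed

lemma convex_tent_T: "convex tent_T"
proof -
  have eq: "tent_T = {z. (0, -1) \<bullet> z \<le> 0} \<inter> {z. (-1, 1) \<bullet> z \<le> 0} \<inter> {z. (1, 1) \<bullet> z \<le> 2}"
    by (auto simp: tent_T_iff inner_prod_def)
  show ?thesis unfolding eq by (intro convex_Int convex_halfspace_le)
qed

lemma L1norm_indicator_tent_T: "L1norm (indicator tent_T) < \<infinity>"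
proof -
  have "L1norm (indicator tent_T) = (\<integral>\<^sup>+z. indicator tent_T z \<partial>lborel)"
    unfolding L1norm_def by (intro nn_integral_cong) (auto simp: indicator_def)
  then show ?thesis using emeasure_tent_T_finite by simp
qed

text \<open>With \<open>W\<close> the part of \<open>U\<close> in the interior, the functions
  \<open>min 1 (n * infdist z (- W))\<close> increase to the indicator of \<open>W\<close>. The rest
  of \<open>U \<inter> tent_T\<close> lies in the boundary of a convex set and is null.\<close>

lemma lip_approximable_open:
  assumes "open U"
  shows "lip_approximable (indicator (U \<inter> tent_T))"
proof (rule lip_approximable_lim)
  define W where "W = U \<inter> interior tent_T"
  define g where "g n z = min 1 (real n * infdist z (- W))" for n z
  have W: "open W" "W \<subseteq> tent_T" "- W \<noteq> {}" "closed (- W)"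
  proof -
    show "open W" "closed (- W)" using assms by (auto simp: W_def)
    show "W \<subseteq> tent_T" using interior_subset by (auto simp: W_def)
    then have "bounded W" using compact_tent_T compact_imp_bounded bounded_subset by blast
    then have "W \<noteq> UNIV" using not_bounded_UNIV by auto
    then show "- W \<noteq> {}" by auto
  qed
  have lip: "\<bar>g n x - g n y\<bar> \<le> real n * dist x y" for n x y
  proof -
    have "\<bar>g n x - g n y\<bar> \<le> \<bar>real n * infdist x (- W) - real n * infdist y (- W)\<bar>" by (auto simp: g_def)
    also have "\<dots> = real n * \<bar>infdist x (- W) - infdist y (- W)\<bar>" by (simp add: right_diff_distrib[symmetric] abs_mult)
    also have "\<dots> \<le> real n * dist x y" by (intro mult_left_mono infdist_triangle_abs) auto
    finally show ?thesis .
  qed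
  have g0: "g n z = 0" if "z \<notin> W" for n z using that by (simp add: g_def)
  have tl: "tent_lipschitz (real n) (g n)" for n 
    unfolding tent_lipschitz_def using lip g0 W(2) of_nat_0_le_iff by blast
  show "g n \<in> borel_measurable borel" for n by (rule tent_lipschitz_measurable[OF tl])
  have [measurable]: "U \<in> sets borel" using assms by (rule borel_open)
  show "indicat_real (U \<inter> tent_T) \<in> borel_measurable borel" by measurable
  show "lip_approximable (g n)" for n
    unfolding lip_approximable_def
  proof (intro allI impI exI conjI)
    show "tent_lipschitz (real n) (g n)" by (rule tl)
  qed (simp add: L1norm_def)
  show "\<bar>g n z\<bar> \<le> indicator tent_T z" for n z
  proof (cases "z \<in> tent_T")
    case True
    then show ?thesis using infdist_nonneg[of z "- W"] by (auto simp: g_def)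
  next
    case False
    then have "g n z = 0" using g0 W(2) by blast
    then show ?thesis by simp
  qed
  show "AE z in lborel. (\<lambda>n. g n z) \<longlonglongrightarrow> indicator (U \<inter> tent_T) z"
  proof -
    have "AE z in lborel. z \<notin> frontier tent_T"
    proof -
      have "frontier tent_T \<in> null_sets lborel"
        using negligible_convex_frontier[OF convex_tent_T] by (simp add: negligible_iff_null_sets null_sets_completion_iff frontier_closed)
      then show ?thesis by (rule AE_not_in)
    qed
    then show ?thesis
    proof eventually_elim
      case (elim z)
      show ?case
      proof (cases "z \<in> W")
        case True
        then have d: "infdist z (- W) > 0"
          using in_closed_iff_infdist_zero[OF W(4,3), of z] infdist_nonneg[of z "- W"] by auto
        have "\<forall>\<^sub>F n in sequentially. g n z = 1"
        proof -
          obtain N where N: "real N * infdist z (- W) > 1" using reals_Archimedean3[OF d, rule_format, of 1] by blast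
          have "g n z = 1" if "n \<ge> N" for n
          proof -
            have "real N * infdist z (- W) \<le> real n * infdist z (- W)" using that d by (intro mult_right_mono) auto
            then show ?thesis using N by (simp add: g_def)
          qed
          then show ?thesis by (auto simp: eventually_sequentially)
        qed
        then have "(\<lambda>n. g n z) \<longlonglongrightarrow> 1" by (simp add: tendsto_eventually)
        then show ?thesis using True W by (auto simp: W_def)
      next
        case False
        then have "z \<notin> U \<inter> tent_T"
          using elim compact_imp_closed[OF compact_tent_T] by (auto simp: W_def frontier_def)
        then show ?thesis using g0[OF False] by simp
      qed
    qed
  qed
qed (use L1norm_indicator_tent_T in auto)

text \<open>Dynkin's argument with the open sets as generator: complements are taken relative to
  \<open>tent_T\<close> by subtraction, and countable disjoint unions follow by dominated
  convergence from finite ones.\<close>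

lemma lip_approximable_borel:
  assumes "A \<in> sets borel"
  shows "lip_approximable (indicator (A \<inter> tent_T))"
proof -
  have "Int_stable {S :: (real \<times> real) set. open S}" by (auto simp: Int_stable_def)
  moreover have "{S :: (real \<times> real) set. open S} \<subseteq> Pow UNIV" by simp
  moreover have "A \<in> sigma_sets UNIV {S. open S}" using assms by (simp add: borel_def)
  ultimately show ?thesis
  proof (induction A rule: sigma_sets_induct_disjoint)
    case (basic A)
    then show ?case using lip_approximable_open by simp
  next
    case empty
    show ?case by (rule lip_approximable_open) simp
  next
    case (compl A)
    then have [measurable]: "A \<in> sets borel" by (simp add: borel_def)
    have "lip_approximable (\<lambda>z. indicator (UNIV \<inter> tent_T) z + (-1) * indicator (A \<inter> tent_T) z)"
      by (intro lip_approximable_add lip_approximable_cmult compl lip_approximable_open) auto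
    also have "(\<lambda>z. indicator (UNIV \<inter> tent_T) z + (-1) * indicator (A \<inter> tent_T) z) = (indicator ((UNIV - A) \<inter> tent_T) :: _ \<Rightarrow> real)"
      by (auto simp: indicator_def)
    finally show ?case .
  next
    case (union A)
    then have [measurable]: "A i \<in> sets borel" for i by (auto simp: borel_def)
    have dis: "disjoint_family A" using union by blast
    have fin: "lip_approximable (indicator ((\<Union>i<n. A i) \<inter> tent_T))" for n
    proof (induction n)
      case 0
      show ?case by (simp only: lessThan_0 UN_empty) (rule lip_approximable_open, simp)
    next
      case (Suc n)
      have "lip_approximable (\<lambda>z. indicator ((\<Union>i<n. A i) \<inter> tent_T) z + indicator (A n \<inter> tent_T) z)"
        by (intro lip_approximable_add union Suc) auto
      also have "(\<lambda>z. indicator ((\<Union>i<n. A i) \<inter> tent_T) z + indicator (A n \<inter> tent_T) z) = (indicator ((\<Union>i<Suc n. A i) \<inter> tent_T) :: _ \<Rightarrow> real)"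
      proof
        fix z
        have "(\<Union>i<n. A i) \<inter> A n = {}"
        proof (rule equals0I)
          fix x assume "x \<in> (\<Union>i<n. A i) \<inter> A n"
          then obtain i where "i < n" "x \<in> A i" "x \<in> A n" by auto
          then show False using disjoint_family_onD[OF dis, of i n] by auto
        qed
        then have "(\<Union>i<n. A i) \<inter> tent_T \<inter> (A n \<inter> tent_T) = {}" by blast
        then have "indicator ((\<Union>i<n. A i) \<inter> tent_T) z + indicator (A n \<inter> tent_T) z =
            (indicator ((\<Union>i<n. A i) \<inter> tent_T \<union> A n \<inter> tent_T) z :: real)" by (rule indicator_add)
        also have "(\<Union>i<n. A i) \<inter> tent_T \<union> A n \<inter> tent_T = (\<Union>i<Suc n. A i) \<inter> tent_T"
          by (auto simp: lessThan_Suc)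
        finally show "indicator ((\<Union>i<n. A i) \<inter> tent_T) z + indicator (A n \<inter> tent_T) z =
            (indicator ((\<Union>i<Suc n. A i) \<inter> tent_T) z :: real)" .
      qed
      finally show ?case .
    qed
    show ?case
    proof (rule lip_approximable_lim[OF _ _ _ fin])
      show "AE z in lborel. (\<lambda>n. indicat_real ((\<Union>i<n. A i) \<inter> tent_T) z) \<longlonglongrightarrow> indicator (\<Union> (range A) \<inter> tent_T) z"
      proof (intro AE_I2 tendsto_eventually)
        fix z
        show "\<forall>\<^sub>F n in sequentially. indicat_real ((\<Union>i<n. A i) \<inter> tent_T) z = indicator (\<Union> (range A) \<inter> tent_T) z"
        proof (cases "z \<in> \<Union> (range A)")
          case True
          then obtain i where "z \<in> A i" by auto
          then have "indicat_real ((\<Union>i<n. A i) \<inter> tent_T) z = indicator (\<Union> (range A) \<inter> tent_T) z" if "n \<ge> Suc i" for n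
            using that by (force simp: indicator_def)
          then show ?thesis by (auto simp: eventually_sequentially)
        qed (auto simp: indicator_def)
      qed
      show "\<bar>indicat_real ((\<Union>i<n. A i) \<inter> tent_T) z\<bar> \<le> indicator tent_T z" for n z by (auto simp: indicator_def)
    qed (use L1norm_indicator_tent_T in auto)
  qed
qed

lemma lip_approximable_integrable:
  assumes h: "integrable lborel h" "\<And>z. z \<notin> tent_T \<Longrightarrow> h z = 0"
  shows "lip_approximable h"
proof -
  have "lip_approximable (\<lambda>z. h z * indicator tent_T z)"
    using h(1)
  proof (induction rule: integrable_induct)
    case (base A c)
    then have [measurable]: "A \<in> sets borel" by simp
    have "lip_approximable (\<lambda>z. c * indicator (A \<inter> tent_T) z)"
      by (intro lip_approximable_cmult lip_approximable_borel) auto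
    also have "(\<lambda>z. c * indicator (A \<inter> tent_T) z) = (\<lambda>z. (indicat_real A z *\<^sub>R c) * indicator tent_T z)"
      by (auto simp: indicator_def)
    finally show ?case .
  next
    case (add f g)
    have "lip_approximable (\<lambda>z. f z * indicator tent_T z + g z * indicator tent_T z)"
      using add by (intro lip_approximable_add) auto
    then show ?case by (simp add: distrib_right)
  next
    case (lim f s)
    note [measurable] = borel_measurable_integrable[OF lim.hyps(1), unfolded measurable_lborel1]
      borel_measurable_integrable[OF lim.hyps(4), unfolded measurable_lborel1]
    \<comment> \<open>The approximating sequence supplied by \<open>integrable_induct\<close> is
      bounded by twice the norm of its limit.\<close>
    have "integrable lborel (\<lambda>z. 2 * norm (f z))" using lim.hyps(4) by auto
    then have fin: "L1norm (\<lambda>z. 2 * norm (f z)) < \<infinity>" unfolding integrable_iff_bounded L1norm_def by simp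
    show ?case
    proof (rule lip_approximable_lim[where w="\<lambda>z. 2 * norm (f z)" and s="\<lambda>i z. s i z * indicator tent_T z"])
      show "\<bar>s n z * indicat_real tent_T z\<bar> \<le> 2 * norm (f z)" for n z
        using lim.hyps(3)[of z n] by (auto simp: indicator_def)
    qed (use lim.hyps lim.IH fin in \<open>auto intro!: AE_I2 tendsto_mult\<close>)
  qed
  moreover have "(\<lambda>z. h z * indicator tent_T z) = h" using h(2) by (auto simp: indicator_def fun_eq_iff)
  ultimately show ?thesis by simp
qed

section \<open>Variation of invariant densities\<close>

text \<open>The increment is at most \<open>L * norm u\<close> and lives on \<open>tent_T\<close>
  and one translate of it, whence the factor 2.\<close>

lemma incr_lipschitz_le:
  assumes g: "tent_lipschitz L g"
  shows "incr1 g u \<le> ennreal (2 * L * measure lborel tent_T) * ennreal (norm u)"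
proof -
  note L = tent_lipschitzD(1,2)[OF g] and g0 = tent_lipschitzD(3)[OF g]
  have "incr1 g u \<le> (\<integral>\<^sup>+z. ennreal (L * norm u) * (indicator tent_T z + indicator tent_T (z + u)) \<partial>lborel)"
    unfolding incr_def
  proof (intro nn_integral_mono)
    fix z
    have "\<bar>g (z + u) - g z\<bar> \<le> L * norm u" using L(2)[of "z + u" z] by (simp add: dist_norm)
    then have *: "ennreal \<bar>g (z + u) - g z\<bar> \<le> ennreal (L * norm u) * 1" by (simp add: ennreal_leI)
    show "1 * ennreal \<bar>g (z + u) - g z\<bar> \<le> ennreal (L * norm u) * (indicator tent_T z + indicator tent_T (z + u))"
    proof (cases "z \<in> tent_T \<or> z + u \<in> tent_T")
      case True
      then have "(1::ennreal) \<le> indicator tent_T z + indicator tent_T (z + u)" by (auto simp: indicator_def)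
      from order_trans[OF * mult_left_mono[OF this]] show ?thesis by simp
    next
      case False
      then show ?thesis using g0 by simp
    qed
  qed
  also have "\<dots> = ennreal (L * norm u) * ((\<integral>\<^sup>+z. indicator tent_T z \<partial>lborel) + (\<integral>\<^sup>+z. indicator tent_T (z + u) \<partial>lborel))"
    by (subst nn_integral_cmult, measurable, subst nn_integral_add) auto
  also have "(\<integral>\<^sup>+z. indicator tent_T (z + u) \<partial>lborel) = (\<integral>\<^sup>+z. indicator tent_T z \<partial>lborel)"
    by (rule nn_integral_shift) measurable
  also have "(\<integral>\<^sup>+z. indicator tent_T z \<partial>lborel) = ennreal (measure lborel tent_T)"
    using emeasure_tent_T_finite by (simp add: emeasure_eq_ennreal_measure)
  also have "ennreal (L * norm u) * (ennreal (measure lborel tent_T) + ennreal (measure lborel tent_T)) =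
      ennreal (2 * L * measure lborel tent_T) * ennreal (norm u)"
    using L(1) by (simp add: ennreal_plus[symmetric] ennreal_mult[symmetric] mult_ac del: ennreal_plus)
  finally show ?thesis .
qed

lemma variation_lipschitz_le:
  assumes g: "tent_lipschitz L g" and s: "0 \<le> s"
  shows "modulus g s \<le> ennreal (8 * L * measure lborel tent_T) * ennreal s"
proof -
  define B where "B = 2 * L * measure lborel tent_T"
  have B: "B \<ge> 0" using tent_lipschitzD(1)[OF g] by (simp add: B_def)
  have "incr1 g u \<le> ennreal B * ennreal (norm u)" for u
    unfolding B_def by (rule incr_lipschitz_le[OF g])
  from this[of "(s, 0)"] this[of "(0, s)"] this[of "(s / sqrt 2, s / sqrt 2)"] this[of "(s / sqrt 2, - s / sqrt 2)"]
  have "modulus g s \<le> ennreal B * ennreal s + ennreal B * ennreal s + ennreal B * ennreal s + ennreal B * ennreal s"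
    unfolding variation_def norm_directions[OF s] by (intro add_mono)
  also have "\<dots> = ennreal (8 * L * measure lborel tent_T) * ennreal s"
  proof -
    have "c + c + c + c = 4 * c" for c :: ennreal
      using distrib_right[of 2 2 c] by (simp add: mult_2 add.assoc)
    moreover have "ennreal (8 * L * measure lborel tent_T) = 4 * ennreal B"
      using ennreal_mult'[of 4 B] by (simp add: B_def mult_ac)
    ultimately show ?thesis by (simp add: mult.assoc)
  qed
  finally show ?thesis .
qed

lemma incr_diff_le:
  assumes [measurable]: "f \<in> borel_measurable borel" "g \<in> borel_measurable borel"
  shows "incr1 f u \<le> incr1 g u + 2 * L1norm (\<lambda>z. f z - g z)"
proof -
  have "incr1 f u \<le> (\<integral>\<^sup>+z. ennreal \<bar>g (z + u) - g z\<bar> + (ennreal \<bar>f (z + u) - g (z + u)\<bar> + ennreal \<bar>f z - g z\<bar>) \<partial>lborel)"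
    unfolding incr_def by (intro nn_integral_mono) (auto simp: ennreal_plus[symmetric] simp del: ennreal_plus intro!: ennreal_leI)
  also have "\<dots> = (\<integral>\<^sup>+z. ennreal \<bar>g (z + u) - g z\<bar> \<partial>lborel) + ((\<integral>\<^sup>+z. ennreal \<bar>f (z + u) - g (z + u)\<bar> \<partial>lborel) + (\<integral>\<^sup>+z. ennreal \<bar>f z - g z\<bar> \<partial>lborel))"
    by (subst nn_integral_add, measurable, subst nn_integral_add) auto
  also have "(\<integral>\<^sup>+z. ennreal \<bar>f (z + u) - g (z + u)\<bar> \<partial>lborel) = (\<integral>\<^sup>+z. ennreal \<bar>f z - g z\<bar> \<partial>lborel)"
    by (rule nn_integral_shift[where f="\<lambda>z. ennreal \<bar>f z - g z\<bar>"]) measurable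
  finally show ?thesis by (simp add: incr_def L1norm_def mult_2)
qed

lemma variation_diff_le:
  assumes "f \<in> borel_measurable borel" "g \<in> borel_measurable borel"
  shows "modulus f s \<le> modulus g s + 8 * L1norm (\<lambda>z. f z - g z)"
proof -
  define N where "N = L1norm (\<lambda>z. f z - g z)"
  have "modulus f s \<le> (incr1 g (s, 0) + 2 * N) + (incr1 g (0, s) + 2 * N) +
      (incr1 g (s / sqrt 2, s / sqrt 2) + 2 * N) + (incr1 g (s / sqrt 2, - s / sqrt 2) + 2 * N)"
    unfolding variation_def N_def by (intro add_mono incr_diff_le assms)
  also have "\<dots> = modulus g s + (2 * N + 2 * N + 2 * N + 2 * N)"
    by (simp add: variation_def ac_simps)
  also have "2 * N + 2 * N + 2 * N + 2 * N = 8 * N" by (simp add: distrib_right[symmetric])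
  finally show ?thesis by (simp add: N_def)
qed

lemma L1norm_eq_0_iff:
  assumes [measurable]: "f \<in> borel_measurable borel"
  shows "L1norm f = 0 \<longleftrightarrow> (AE z in lborel. f z = 0)"
  unfolding L1norm_def by (subst nn_integral_0_iff_AE) auto

lemma transfer_pow_diff:
  "(transfer t ^^ k) (\<lambda>z. f z - g z) = (\<lambda>z. (transfer t ^^ k) f z - (transfer t ^^ k) g z)"
proof (induction k)
  case (Suc k)
  have "transfer t (\<lambda>z. u z - v z) = (\<lambda>z. transfer t u z - transfer t v z)" for u v
    by (rule ext) (rule transfer_diff)
  then show ?case using Suc by simp
qed simp

text \<open>Equality almost everywhere is carried through further applications of
  \<open>transfer\<close> by its contraction of the norm.\<close>

lemma transfer_pow_fixed:
  assumes [measurable]: "f \<in> borel_measurable borel" and t: "t > 0"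
    and fix_f: "AE z in lborel. transfer t f z = f z"
  shows "L1norm (\<lambda>z. f z - (transfer t ^^ k) f z) = 0"
proof (induction k)
  case 0
  show ?case by (simp add: L1norm_def)
next
  case (Suc k)
  have "L1norm (\<lambda>z. f z - (transfer t ^^ Suc k) f z) \<le> L1norm (\<lambda>z. f z - transfer t f z) + L1norm (\<lambda>z. transfer t f z - (transfer t ^^ Suc k) f z)"
    by (rule L1norm_diff_triangle) measurable
  also have "L1norm (\<lambda>z. f z - transfer t f z) = 0"
    by (subst L1norm_eq_0_iff) (use fix_f in auto)
  also have "(\<lambda>z. transfer t f z - (transfer t ^^ Suc k) f z) = transfer t (\<lambda>z. f z - (transfer t ^^ k) f z)"
    by (simp add: transfer_diff fun_eq_iff)
  also have "L1norm \<dots> \<le> L1norm (\<lambda>z. f z - (transfer t ^^ k) f z)"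
    by (rule L1norm_transfer_le) (use t in measurable)
  finally show ?case using Suc by simp
qed

lemma iterated_lasota_yorke:
  assumes step: "contracts t N \<kappa> C s0"
    and \<kappa>: "0 \<le> \<kappa>" "\<kappa> < 1" and C: "0 \<le> C" and t: "0 < t" "t \<le> 1"
    and f: "f \<in> borel_measurable borel" "\<And>z. z \<notin> tent_T \<Longrightarrow> f z = 0"
    and B: "0 \<le> B" "\<And>s. 0 < s \<Longrightarrow> s \<le> s0 \<Longrightarrow> modulus f s \<le> ennreal B * ennreal s"
    and s: "0 < s" "s \<le> s0"
  shows "modulus ((transfer t ^^ (N * k)) f) s \<le> (ennreal (\<kappa> ^ k * B) + ennreal (C / (1 - \<kappa>)) * L1norm f) * ennreal s"
  using s
proof (induction k arbitrary: s)
  case 0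
  then have "modulus f s \<le> ennreal B * ennreal s" by (rule B(2))
  also have "\<dots> \<le> (ennreal B + ennreal (C / (1 - \<kappa>)) * L1norm f) * ennreal s"
    by (intro mult_right_mono) auto
  finally show ?case by simp
next
  case (Suc k)
  let ?n = "L1norm f"
  \<comment> \<open>The fixed point of \<open>D \<mapsto> \<kappa> * D + C\<close>, so that the
    coefficient of the norm does not grow during the induction.\<close>
  define D where "D = C / (1 - \<kappa>)"
  have D: "0 \<le> D" "\<kappa> * D + C = D" using \<kappa> C by (auto simp: D_def field_simps)
  have eq: "(transfer t ^^ (N * Suc k)) f = (transfer t ^^ N) ((transfer t ^^ (N * k)) f)"
    by (simp add: funpow_add)
  have "modulus ((transfer t ^^ (N * Suc k)) f) s \<le> (ennreal \<kappa> * (ennreal (\<kappa> ^ k * B) + ennreal D * ?n) + ennreal C * L1norm ((transfer t ^^ (N * k)) f)) * ennreal s"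
    unfolding eq by (rule contractsD[OF step]) (use Suc f t transfer_pow_tent_T in \<open>auto simp: D_def\<close>)
  also have "\<dots> \<le> (ennreal \<kappa> * (ennreal (\<kappa> ^ k * B) + ennreal D * ?n) + ennreal C * ?n) * ennreal s"
    by (intro mult_right_mono add_left_mono mult_left_mono L1norm_transfer_pow_le) (use f t in auto)
  also have "ennreal \<kappa> * (ennreal (\<kappa> ^ k * B) + ennreal D * ?n) + ennreal C * ?n =
      ennreal (\<kappa> ^ Suc k * B) + ennreal (\<kappa> * D + C) * ?n"
    using \<kappa> B(1) D(1) C by (simp add: distrib_left distrib_right ennreal_mult mult_ac add_ac)
  finally show ?case unfolding D(2) unfolding D_def .
qed

text \<open>The iterated inequality is applied to a Lipschitz approximation \<open>g\<close> of
  \<open>h\<close>. Its slope \<open>B\<close> may be huge, but the factor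
  \<open>\<kappa> ^ k\<close> removes it, while invariance of \<open>h\<close> and contraction of
  the norm keep the iterate of \<open>g\<close> as close to \<open>h\<close> as \<open>g\<close>
  was. The bound that remains no longer depends on \<open>h\<close>.\<close>

lemma invariant_variation:
  assumes step: "contracts t N \<kappa> C s0"
    and \<kappa>: "0 \<le> \<kappa>" "\<kappa> < 1" and C: "0 \<le> C" and t: "0 < t" "t \<le> 1"
    and h: "h \<in> borel_measurable borel" "\<And>z. z \<notin> tent_T \<Longrightarrow> h z = 0" "L1norm h \<le> 1" "AE z in lborel. transfer t h z = h z"
    and s: "0 < s" "s \<le> s0"
  shows "modulus h s \<le> ennreal (C / (1 - \<kappa>) * s)"
proof (rule ennreal_le_epsilon)
  note [measurable] = h(1)
  define D where "D = C / (1 - \<kappa>)"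
  have D: "0 \<le> D" using \<kappa> C by (auto simp: D_def)
  fix e :: real assume "0 < e"
  \<comment> \<open>Half of \<open>e\<close> is for the approximation, which enters through the norm
    of \<open>g\<close> (factor \<open>D * s\<close>) and through \<open>variation_diff_le\<close>
    (factor 8).\<close>
  define \<epsilon> where "\<epsilon> = e / (2 * (D * s + 8))"
  have Ds: "0 \<le> D * s" using D s by simp
  have \<epsilon>: "\<epsilon> > 0" "(D * s + 8) * \<epsilon> = e / 2" using \<open>0 < e\<close> Ds by (auto simp: \<epsilon>_def field_simps add_pos_nonneg add_nonneg_pos)
  have "integrable lborel h"
    unfolding integrable_iff_bounded using h(3) by (auto simp: L1norm_def intro: le_less_trans)
  then have "lip_approximable h" using h(2) by (rule lip_approximable_integrable)
  then obtain g L where g: "tent_lipschitz L g" "L1norm (\<lambda>z. h z - g z) \<le> ennreal \<epsilon>"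
    unfolding lip_approximable_def using \<epsilon>(1) by blast
  note gm [measurable] = tent_lipschitz_measurable[OF g(1)]
  define B where "B = 8 * L * measure lborel tent_T"
  have B: "0 \<le> B" "\<And>s. 0 < s \<Longrightarrow> modulus g s \<le> ennreal B * ennreal s"
    unfolding B_def using tent_lipschitzD(1)[OF g(1)] by (auto intro!: variation_lipschitz_le g)
  \<comment> \<open>The other half of \<open>e\<close>; the number of iterations is chosen after
    \<open>g\<close>, because \<open>B\<close> depends on \<open>g\<close>.\<close>
  have "(\<lambda>k. \<kappa> ^ k * (B * s)) \<longlonglongrightarrow> 0 * (B * s)"
    using \<kappa> by (intro tendsto_mult LIMSEQ_power_zero tendsto_const) auto
  then have "\<forall>\<^sub>F k in sequentially. \<kappa> ^ k * (B * s) < e / 2"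
    by (rule order_tendstoD(2)) (use \<open>0 < e\<close> in simp)
  from eventually_happens'[OF sequentially_bot this] obtain k where k: "\<kappa> ^ k * (B * s) < e / 2" ..
  let ?P = "transfer t ^^ (N * k)"
  have ng: "L1norm g \<le> ennreal (1 + \<epsilon>)"
  proof -
    have "L1norm (\<lambda>z. g z - 0) \<le> L1norm (\<lambda>z. g z - h z) + L1norm (\<lambda>z. h z - 0)"
      by (rule L1norm_diff_triangle) measurable
    also have "\<dots> \<le> ennreal \<epsilon> + 1"
      using g(2) h(3) by (subst L1norm_minus_commute) (auto intro: add_mono)
    finally show ?thesis using \<epsilon> by (simp add: ennreal_plus[symmetric] add.commute del: ennreal_plus flip: ennreal_1)
  qed
  have "L1norm (\<lambda>z. h z - ?P g z) \<le> L1norm (\<lambda>z. h z - ?P h z) + L1norm (\<lambda>z. ?P h z - ?P g z)"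
    by (rule L1norm_diff_triangle) measurable
  also have "L1norm (\<lambda>z. h z - ?P h z) = 0" by (rule transfer_pow_fixed) (use h t in auto)
  also have "(\<lambda>z. ?P h z - ?P g z) = ?P (\<lambda>z. h z - g z)" by (simp add: transfer_pow_diff)
  also have "L1norm \<dots> \<le> L1norm (\<lambda>z. h z - g z)" by (rule L1norm_transfer_pow_le) (use t in measurable)
  also have "\<dots> \<le> ennreal \<epsilon>" by (rule g)
  finally have hP: "L1norm (\<lambda>z. h z - ?P g z) \<le> ennreal \<epsilon>" by simp
  have "modulus h s \<le> modulus (?P g) s + 8 * L1norm (\<lambda>z. h z - ?P g z)"
    by (rule variation_diff_le) measurable
  also have "\<dots> \<le> (ennreal (\<kappa> ^ k * B) + ennreal D * L1norm g) * ennreal s + 8 * ennreal \<epsilon>"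
  proof (intro add_mono mult_left_mono hP)
    show "modulus (?P g) s \<le> (ennreal (\<kappa> ^ k * B) + ennreal D * L1norm g) * ennreal s"
      unfolding D_def by (rule iterated_lasota_yorke[OF step \<kappa> C t gm tent_lipschitzD(3)[OF g(1)] B(1) _ s]) (auto intro: B(2))
  qed auto
  also have "\<dots> \<le> (ennreal (\<kappa> ^ k * B) + ennreal D * ennreal (1 + \<epsilon>)) * ennreal s + 8 * ennreal \<epsilon>"
    by (intro add_mono mult_right_mono mult_left_mono ng order_refl) auto
  also have "\<dots> = ennreal ((\<kappa> ^ k * B + D * (1 + \<epsilon>)) * s + 8 * \<epsilon>)"
    using \<kappa> B(1) D \<epsilon>(1) s by (simp add: ennreal_mult ennreal_plus)
  also have "\<dots> \<le> ennreal (D * s + e)"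
  proof (rule ennreal_leI)
    have "(\<kappa> ^ k * B + D * (1 + \<epsilon>)) * s + 8 * \<epsilon> = \<kappa> ^ k * (B * s) + D * s + (D * s + 8) * \<epsilon>" by (simp add: algebra_simps)
    then show "(\<kappa> ^ k * B + D * (1 + \<epsilon>)) * s + 8 * \<epsilon> \<le> D * s + e" using k \<epsilon>(2) by linarith
  qed
  also have "\<dots> = ennreal (C / (1 - \<kappa>) * s) + ennreal e"
    using Ds \<open>0 < e\<close> by (simp add: D_def)
  finally show "modulus h s \<le> ennreal (C / (1 - \<kappa>) * s) + ennreal e" .
qed

section \<open>Compactness in mean\<close>

lemma bounded_family_convergent_subsequence:
  fixes X :: "nat \<Rightarrow> nat \<Rightarrow> real"
  assumes "\<And>n i. \<bar>X n i\<bar> \<le> M"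
  obtains r where "strict_mono (r :: nat \<Rightarrow> nat)" "\<And>i. convergent (\<lambda>n. X (r n) i)"
proof -
  interpret subseqs "\<lambda>i s. convergent (\<lambda>n. X (s n) i)"
  proof
    fix i and s :: "nat \<Rightarrow> nat" assume "strict_mono s"
    have "seq_compact {- M..M}" by (intro compact_imp_seq_compact compact_Icc)
    moreover have "\<forall>n. X (s n) i \<in> {- M..M}" using assms[of _ i] by (auto simp: abs_le_iff minus_le_iff)
    ultimately obtain l r where "strict_mono (r :: nat \<Rightarrow> nat)" "((\<lambda>n. X (s n) i) \<circ> r) \<longlonglongrightarrow> l"
      by (rule seq_compactE)
    then show "\<exists>r. strict_mono r \<and> convergent (\<lambda>n. X ((s \<circ> r) n) i)"
      by (auto simp: comp_def convergent_def)
  qed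
  have "convergent (\<lambda>n. X (diagseq n) i)" for i
  proof -
    \<comment> \<open>Only from index \<open>Suc i\<close> on is the diagonal sequence a subsequence
      of the one chosen for coordinate \<open>i\<close>.\<close>
    have "convergent (\<lambda>n. X ((diagseq \<circ> ((+) (Suc i))) n) i)"
    proof (rule diagseq_holds)
      fix r s :: "nat \<Rightarrow> nat" and n assume "strict_mono r" "convergent (\<lambda>k. X (s k) n)"
      then show "convergent (\<lambda>k. X ((s \<circ> r) k) n)"
        using convergent_subseq_convergent[of "\<lambda>k. X (s k) n" r] by (simp add: comp_def)
    qed
    then obtain l where "(\<lambda>n. X (diagseq (n + Suc i)) i) \<longlonglongrightarrow> l"
      by (auto simp: convergent_def comp_def add.commute)
    then have "(\<lambda>n. X (diagseq n) i) \<longlonglongrightarrow> l" by (rule LIMSEQ_offset)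
    then show ?thesis by (auto simp: convergent_def)
  qed
  with subseq_diagseq show ?thesis by (rule that)
qed

lemma integrable_iff_L1norm: "f \<in> borel_measurable borel \<Longrightarrow> integrable lborel f \<longleftrightarrow> L1norm f < \<infinity>"
  by (simp add: integrable_iff_bounded L1norm_def)

text \<open>A subsequence converges almost everywhere, and Fatou's lemma turns the Cauchy bound into
  convergence in the mean. Defining the limit by \<open>lim\<close> at every point makes it vanish
  everywhere off \<open>S\<close>, not just almost everywhere.\<close>

lemma L1_complete:
  fixes F :: "nat \<Rightarrow> 'a::euclidean_space \<Rightarrow> real"
  assumes int: "\<And>n. integrable lborel (F n)"
    and cauchy: "\<And>e. e > 0 \<Longrightarrow> \<exists>N. \<forall>m\<ge>N. \<forall>n\<ge>N. L1norm (\<lambda>z. F m z - F n z) \<le> ennreal e"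
    and F0: "\<And>n z. z \<notin> S \<Longrightarrow> F n z = 0"
  obtains r f where "strict_mono (r :: nat \<Rightarrow> nat)" "f \<in> borel_measurable borel" "\<And>z. z \<notin> S \<Longrightarrow> f z = 0"
    "(\<lambda>n. L1norm (\<lambda>z. F (r n) z - f z)) \<longlonglongrightarrow> 0"
proof -
  have [measurable]: "F n \<in> borel_measurable borel" for n using int[of n] by auto
  have L: "(LINT z|lborel. norm (F m z - F n z)) = enn2real (L1norm (\<lambda>z. F m z - F n z))" for m n
    unfolding L1norm_def by (subst integral_eq_nn_integral) auto
  have "\<exists>N. \<forall>i\<ge>N. \<forall>j\<ge>N. (LINT z|lborel. norm (F i z - F j z)) < e" if e: "e > 0" for e
  proof -
    obtain N where N: "\<forall>m\<ge>N. \<forall>n\<ge>N. L1norm (\<lambda>z. F m z - F n z) \<le> ennreal (e / 2)"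
      using cauchy[of "e / 2"] e by auto
    have "enn2real (L1norm (\<lambda>z. F i z - F j z)) < e" if ij: "i \<ge> N" "j \<ge> N" for i j
    proof -
      have "enn2real (L1norm (\<lambda>z. F i z - F j z)) \<le> e / 2"
        using N ij \<open>e > 0\<close> by (intro enn2real_leI) auto
      then show ?thesis using \<open>e > 0\<close> by simp
    qed
    then show ?thesis unfolding L by blast
  qed
  from cauchy_L1_AE_cauchy_subseq[OF int this] obtain r where r: "strict_mono (r :: nat \<Rightarrow> nat)" "AE z in lborel. Cauchy (\<lambda>i. F (r i) z)"
    by metis
  define f where "f z = lim (\<lambda>n. F (r n) z)" for z
  have [measurable]: "f \<in> borel_measurable borel"
    unfolding f_def[abs_def] by (rule borel_measurable_lim_metric) measurable
  have f0: "f z = 0" if "z \<notin> S" for z using that by (simp add: f_def F0)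
  have lim: "AE z in lborel. (\<lambda>n. F (r n) z) \<longlonglongrightarrow> f z"
    using r(2) by eventually_elim (simp add: f_def convergent_LIMSEQ_iff[symmetric] Cauchy_convergent_iff)
  have "(\<lambda>n. L1norm (\<lambda>z. F (r n) z - f z)) \<longlonglongrightarrow> 0"
  proof (rule order_tendstoI)
    fix a :: ennreal assume "a < 0"
    then show "\<forall>\<^sub>F n in sequentially. a < L1norm (\<lambda>z. F (r n) z - f z)" by simp
  next
    fix a :: ennreal assume "0 < a"
    then obtain b where b: "0 < b" "b < a" using dense by blast
    then have "b < top" using less_top order_less_le_trans by (metis top_greatest)
    define e where "e = enn2real b"
    have e: "0 < e" "ennreal e < a"
      using b \<open>b < top\<close> by (auto simp: e_def enn2real_positive_iff)
    obtain N where N: "\<forall>m\<ge>N. \<forall>n\<ge>N. L1norm (\<lambda>z. F m z - F n z) \<le> ennreal e" using cauchy[OF e(1)] by auto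
    have "L1norm (\<lambda>z. F (r n) z - f z) < a" if n: "n \<ge> N" for n
    proof -
      have "AE z in lborel. (\<lambda>m. ennreal \<bar>F (r n) z - F (r m) z\<bar>) \<longlonglongrightarrow> ennreal \<bar>F (r n) z - f z\<bar>"
        using lim by eventually_elim (intro tendsto_intros)
      then have "L1norm (\<lambda>z. F (r n) z - f z) = (\<integral>\<^sup>+z. liminf (\<lambda>m. ennreal \<bar>F (r n) z - F (r m) z\<bar>) \<partial>lborel)"
        unfolding L1norm_def by (intro nn_integral_cong_AE, eventually_elim) (rule lim_imp_Liminf[OF sequentially_bot, symmetric])
      also have "\<dots> \<le> liminf (\<lambda>m. L1norm (\<lambda>z. F (r n) z - F (r m) z))"
        unfolding L1norm_def by (rule nn_integral_liminf) measurable
      also have "\<dots> \<le> ennreal e"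
      proof (rule Liminf_le)
        show "\<forall>\<^sub>F m in sequentially. L1norm (\<lambda>z. F (r n) z - F (r m) z) \<le> ennreal e"
          unfolding eventually_sequentially
          using N n seq_suble[OF r(1)] by (intro exI[of _ N]) (meson order_trans)
      qed simp
      finally show ?thesis using e by simp
    qed
    then show "\<forall>\<^sub>F n in sequentially. L1norm (\<lambda>z. F (r n) z - f z) < a"
      by (auto simp: eventually_sequentially)
  qed
  with r(1) \<open>f \<in> _\<close> f0 show ?thesis by (rule that)
qed

section \<open>Control of the norm by finitely many cell integrals\<close>

definition cell :: "real \<Rightarrow> nat \<times> nat \<Rightarrow> (real \<times> real) set" where
  "cell \<delta> c = cbox (real (fst c) * \<delta>, real (snd c) * \<delta>) ((real (fst c) + 1) * \<delta>, (real (snd c) + 1) * \<delta>)"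

lemma mem_cell: "z \<in> cell \<delta> c \<longleftrightarrow> real (fst c) * \<delta> \<le> fst z \<and> fst z \<le> (real (fst c) + 1) * \<delta> \<and>
    real (snd c) * \<delta> \<le> snd z \<and> snd z \<le> (real (snd c) + 1) * \<delta>"
  by (cases z) (auto simp: cell_def cbox_Pair_eq)

lemma measurable_cell [measurable]: "cell \<delta> c \<in> sets borel"
  by (simp add: cell_def)

lemma measure_cell: "\<delta> \<ge> 0 \<Longrightarrow> measure lborel (cell \<delta> c) = \<delta>\<^sup>2"
  by (simp add: cell_def content_Pair algebra_simps power2_eq_square)

lemma tent_T_covered:
  assumes "\<delta> > 0" "2 < real M * \<delta>" "z \<in> tent_T"
  obtains c where "c \<in> {..<M} \<times> {..<M}" "z \<in> cell \<delta> c"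
proof -
  have z: "0 \<le> fst z" "fst z \<le> 2" "0 \<le> snd z" "snd z \<le> 2" using assms(3) by (auto simp: tent_T_iff)
  have *: "nat \<lfloor>x / \<delta>\<rfloor> < M \<and> real (nat \<lfloor>x / \<delta>\<rfloor>) * \<delta> \<le> x \<and> x \<le> (real (nat \<lfloor>x / \<delta>\<rfloor>) + 1) * \<delta>" if "0 \<le> x" "x \<le> 2" for x
  proof -
    have 0: "0 \<le> x / \<delta>" using that assms by simp
    then have eq: "real (nat \<lfloor>x / \<delta>\<rfloor>) = of_int \<lfloor>x / \<delta>\<rfloor>" by simp
    have "real (nat \<lfloor>x / \<delta>\<rfloor>) \<le> x / \<delta>" "x / \<delta> \<le> real (nat \<lfloor>x / \<delta>\<rfloor>) + 1" unfolding eq by linarith+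
    then have "real (nat \<lfloor>x / \<delta>\<rfloor>) * \<delta> \<le> x \<and> x \<le> (real (nat \<lfloor>x / \<delta>\<rfloor>) + 1) * \<delta>"
      using assms(1) by (simp add: pos_le_divide_eq pos_divide_le_eq)
    moreover have "x / \<delta> < real M" using that assms by (simp add: pos_divide_less_eq)
    then have "real (nat \<lfloor>x / \<delta>\<rfloor>) < real M" using \<open>real (nat \<lfloor>x / \<delta>\<rfloor>) \<le> x / \<delta>\<close> by linarith
    ultimately show ?thesis by simp
  qed
  show ?thesis
    by (rule that[of "(nat \<lfloor>fst z / \<delta>\<rfloor>, nat \<lfloor>snd z / \<delta>\<rfloor>)"]) (use *[OF z(1,2)] *[OF z(3,4)] in \<open>auto simp: mem_cell\<close>)
qed

definition cell_integral :: "real \<Rightarrow> (real \<times> real \<Rightarrow> real) \<Rightarrow> nat \<times> nat \<Rightarrow> real" where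
  "cell_integral \<delta> g c = (\<integral>y. indicator (cell \<delta> c) y * g y \<partial>lborel)"

text \<open>For \<open>z\<close> in a cell, \<open>\<delta>\<^sup>2 * g z\<close> is the integral of
  \<open>g\<close> over the cell plus that of \<open>g z - g y\<close>. In the second term
  \<open>y - z\<close> ranges within a square of area \<open>4 * \<delta>\<^sup>2\<close>, and
  Fubini turns it into an integral of \<open>incr1 g\<close>. The first is bounded by the whole sum
  over cells, so a covering is enough and overlapping edges do no harm.\<close>

lemma L1norm_le_cells:
  assumes int: "integrable lborel g" and g0: "\<And>z. z \<notin> tent_T \<Longrightarrow> g z = 0" and \<delta>: "0 < \<delta>" "2 < real M * \<delta>"
    and V: "\<And>v. v \<in> cbox (-\<delta>, -\<delta>) (\<delta>, \<delta>) \<Longrightarrow> incr1 g v \<le> ennreal E"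
  shows "ennreal (\<delta>\<^sup>2) * L1norm g \<le> emeasure lborel tent_T * ennreal (\<Sum>c\<in>{..<M} \<times> {..<M}. \<bar>cell_integral \<delta> g c\<bar>)
    + ennreal (4 * \<delta>\<^sup>2) * ennreal E"
proof -
  have [measurable]: "g \<in> borel_measurable borel" using int by auto
  define I where "I = (\<Sum>c\<in>{..<M} \<times> {..<M}. \<bar>cell_integral \<delta> g c\<bar>)"
  let ?B = "cbox (-\<delta>, -\<delta>) (\<delta>, \<delta>)"
  have pt: "ennreal (\<delta>\<^sup>2) * ennreal \<bar>g z\<bar> \<le> indicator tent_T z * ennreal I + (\<integral>\<^sup>+v. indicator ?B v * ennreal \<bar>g (z + v) - g z\<bar> \<partial>lborel)" for z
  proof (cases "z \<in> tent_T")
    case False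
    then show ?thesis using g0 by simp
  next
    case True
    then obtain c where c: "c \<in> {..<M} \<times> {..<M}" "z \<in> cell \<delta> c" using tent_T_covered[OF \<delta>] by blast
    have [simp]: "integrable lborel (indicat_real (cell \<delta> c))"
      using emeasure_bounded_finite[OF bounded_cbox] by (intro integrable_real_indicator) (auto simp: cell_def)
    have i1: "integrable lborel (\<lambda>y. indicator (cell \<delta> c) y * g y)"
      using integrable_mult_indicator[OF _ int, of "cell \<delta> c"] by simp
    have i2: "integrable lborel (\<lambda>y. indicator (cell \<delta> c) y * (g z - g y))"
    proof -
      have "integrable lborel (\<lambda>y. indicat_real (cell \<delta> c) y * g z - indicator (cell \<delta> c) y * g y)"
        using i1 by (intro Bochner_Integration.integrable_diff integrable_mult_left) auto
      then show ?thesis by (simp add: algebra_simps)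
    qed
    have "\<delta>\<^sup>2 * g z = (\<integral>y. indicator (cell \<delta> c) y * g z \<partial>lborel)"
      using \<delta> by (simp add: measure_cell)
    also have "\<dots> = (\<integral>y. indicator (cell \<delta> c) y * g y + indicator (cell \<delta> c) y * (g z - g y) \<partial>lborel)"
      by (rule Bochner_Integration.integral_cong) (auto simp: algebra_simps)
    also have "\<dots> = cell_integral \<delta> g c + (\<integral>y. indicator (cell \<delta> c) y * (g z - g y) \<partial>lborel)"
      unfolding cell_integral_def by (rule Bochner_Integration.integral_add[OF i1 i2])
    finally have "\<bar>\<delta>\<^sup>2 * g z\<bar> \<le> \<bar>cell_integral \<delta> g c\<bar> + \<bar>\<integral>y. indicator (cell \<delta> c) y * (g z - g y) \<partial>lborel\<bar>" by linarith
    then have "ennreal (\<delta>\<^sup>2 * \<bar>g z\<bar>) \<le> ennreal (\<bar>cell_integral \<delta> g c\<bar> + \<bar>\<integral>y. indicator (cell \<delta> c) y * (g z - g y) \<partial>lborel\<bar>)"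
      by (intro ennreal_leI) (simp add: abs_mult)
    also have "\<dots> = ennreal \<bar>cell_integral \<delta> g c\<bar> + ennreal \<bar>\<integral>y. indicator (cell \<delta> c) y * (g z - g y) \<partial>lborel\<bar>" by simp
    also have "ennreal \<bar>cell_integral \<delta> g c\<bar> \<le> ennreal I"
      unfolding I_def using c by (intro ennreal_leI member_le_sum) auto
    also have "ennreal \<bar>\<integral>y. indicator (cell \<delta> c) y * (g z - g y) \<partial>lborel\<bar> \<le> (\<integral>\<^sup>+y. ennreal (norm (indicator (cell \<delta> c) y * (g z - g y))) \<partial>lborel)"
      using integral_norm_bound_ennreal[OF i2] by simp
    also have "\<dots> \<le> (\<integral>\<^sup>+y. indicator ?B (y - z) * ennreal \<bar>g y - g z\<bar> \<partial>lborel)"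
    proof (rule nn_integral_mono)
      fix y
      have "y - z \<in> ?B" if "y \<in> cell \<delta> c"
        using that c(2) by (cases y; cases z) (auto simp: mem_cell cbox_Pair_eq algebra_simps)
      then show "ennreal (norm (indicator (cell \<delta> c) y * (g z - g y))) \<le> indicator ?B (y - z) * ennreal \<bar>g y - g z\<bar>"
        by (auto simp: indicator_def abs_minus_commute)
    qed
    also have "\<dots> = (\<integral>\<^sup>+v. indicator ?B (v + z - z) * ennreal \<bar>g (v + z) - g z\<bar> \<partial>lborel)"
      by (rule nn_integral_shift[where f="\<lambda>y. indicator ?B (y - z) * ennreal \<bar>g y - g z\<bar>", symmetric]) measurable
    finally show ?thesis using True \<delta> by (simp add: ennreal_mult add.commute add_mono)
  qed
  have "ennreal (\<delta>\<^sup>2) * L1norm g = (\<integral>\<^sup>+z. ennreal (\<delta>\<^sup>2) * ennreal \<bar>g z\<bar> \<partial>lborel)"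
    unfolding L1norm_def by (rule nn_integral_cmult[symmetric]) measurable
  also have "\<dots> \<le> (\<integral>\<^sup>+z. indicator tent_T z * ennreal I + (\<integral>\<^sup>+v. indicator ?B v * ennreal \<bar>g (z + v) - g z\<bar> \<partial>lborel) \<partial>lborel)"
    by (intro nn_integral_mono pt)
  also have "\<dots> = (\<integral>\<^sup>+z. indicator tent_T z * ennreal I \<partial>lborel) + (\<integral>\<^sup>+z. \<integral>\<^sup>+v. indicator ?B v * ennreal \<bar>g (z + v) - g z\<bar> \<partial>lborel \<partial>lborel)"
    by (rule nn_integral_add) measurable
  also have "(\<integral>\<^sup>+z. indicator tent_T z * ennreal I \<partial>lborel) = emeasure lborel tent_T * ennreal I"
    by (subst nn_integral_multc) auto
  also have "(\<integral>\<^sup>+z. \<integral>\<^sup>+v. indicator ?B v * ennreal \<bar>g (z + v) - g z\<bar> \<partial>lborel \<partial>lborel) =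
      (\<integral>\<^sup>+v. \<integral>\<^sup>+z. indicator ?B v * ennreal \<bar>g (z + v) - g z\<bar> \<partial>lborel \<partial>lborel)"
    by (rule lborel_pair.Fubini'[symmetric]) measurable
  also have "\<dots> = (\<integral>\<^sup>+v. indicator ?B v * incr1 g v \<partial>lborel)"
    unfolding incr_def by (intro nn_integral_cong, subst nn_integral_cmult) auto
  also have "\<dots> \<le> (\<integral>\<^sup>+v. ennreal E * indicator ?B v \<partial>lborel)"
    by (intro nn_integral_mono) (auto simp: indicator_def intro!: V)
  also have "\<dots> = ennreal E * emeasure lborel ?B"
    by (rule nn_integral_cmult_indicator) simp
  also have "emeasure lborel ?B = ennreal (4 * \<delta>\<^sup>2)"
    using \<delta> by (subst emeasure_eq_ennreal_measure) (auto simp: emeasure_lborel_cbox_eq content_Pair power2_eq_square)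
  finally show ?thesis by (simp add: I_def mult.commute add_mono)
qed


lemma incr_add_le:
  assumes [measurable]: "f \<in> borel_measurable borel"
  shows "incr1 f (u + v) \<le> incr1 f u + incr1 f v"
proof -
  have "incr1 f (u + v) \<le> (\<integral>\<^sup>+z. ennreal \<bar>f (z + u) - f z\<bar> + ennreal \<bar>f (z + u + v) - f (z + u)\<bar> \<partial>lborel)"
    unfolding incr_def
    by (intro nn_integral_mono) (auto simp: ennreal_plus[symmetric] add.assoc simp del: ennreal_plus intro!: ennreal_leI)
  also have "\<dots> = (\<integral>\<^sup>+z. ennreal \<bar>f (z + u) - f z\<bar> \<partial>lborel) + (\<integral>\<^sup>+z. ennreal \<bar>f (z + u + v) - f (z + u)\<bar> \<partial>lborel)"
    by (rule nn_integral_add) measurable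
  also have "(\<integral>\<^sup>+z. ennreal \<bar>f (z + u + v) - f (z + u)\<bar> \<partial>lborel) = (\<integral>\<^sup>+z. ennreal \<bar>f (z + v) - f z\<bar> \<partial>lborel)"
    by (rule nn_integral_shift[where f="\<lambda>z. ennreal \<bar>f (z + v) - f z\<bar>"]) measurable
  finally show ?thesis by (simp add: incr_def)
qed

lemma incr_minus:
  assumes [measurable]: "f \<in> borel_measurable borel"
  shows "incr1 f (- u) = incr1 f u"
  unfolding incr_def
  by (subst nn_integral_shift[where c=u, symmetric]) (auto simp: abs_minus_commute)

lemma incr_diff:
  assumes [measurable]: "f \<in> borel_measurable borel" "g \<in> borel_measurable borel"
  shows "incr1 (\<lambda>z. f z - g z) u \<le> incr1 f u + incr1 g u"
  unfolding incr_def
  by (subst nn_integral_add[symmetric], measurable)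
    (auto intro!: nn_integral_mono ennreal_leI simp: ennreal_plus[symmetric] simp del: ennreal_plus)

text \<open>An arbitrary small vector is split into its horizontal and vertical parts, and these two
  directions are among those measured by \<open>modulus\<close>.\<close>

lemma incr_le_of_variation:
  assumes [measurable]: "f \<in> borel_measurable borel" and C: "0 \<le> C"
    and V: "\<And>s. 0 < s \<Longrightarrow> s \<le> s0 \<Longrightarrow> modulus f s \<le> ennreal (C * s)"
    and \<delta>: "\<delta> \<le> s0" and v: "v \<in> cbox (-\<delta>, -\<delta>) (\<delta>, \<delta>)"
  shows "incr1 f v \<le> ennreal (2 * C * \<delta>)"
proof -
  have pos: "incr1 f (s, 0) \<le> ennreal (C * \<delta>) \<and> incr1 f (0, s) \<le> ennreal (C * \<delta>)" if s: "0 \<le> s" "s \<le> \<delta>" for s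
  proof (cases "s = 0")
    case True
    then show ?thesis by (simp add: incr_def zero_prod_def[symmetric])
  next
    case False
    then have "modulus f s \<le> ennreal (C * s)" using s \<delta> by (intro V) auto
    also have "\<dots> \<le> ennreal (C * \<delta>)" using s C by (intro ennreal_leI mult_left_mono) auto
    finally have V: "modulus f s \<le> ennreal (C * \<delta>)" .
    have "incr1 f (s, 0) \<le> modulus f s" "incr1 f (0, s) \<le> modulus f s"
      unfolding variation_def by (auto intro: add_increasing add_increasing2)
    then show ?thesis using V by auto
  qed
  have sgn: "incr1 f (s, 0) = incr1 f (\<bar>s\<bar>, 0)" "incr1 f (0, s) = incr1 f (0, \<bar>s\<bar>)" for s
    using incr_minus[of f "(s, 0)"] incr_minus[of f "(0, s)"] by (auto simp: abs_if)
  obtain a b where ab: "v = (a, b)" "\<bar>a\<bar> \<le> \<delta>" "\<bar>b\<bar> \<le> \<delta>" using v by (cases v) (auto simp: cbox_Pair_eq)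
  have "incr1 f v \<le> incr1 f (a, 0) + incr1 f (0, b)"
    using incr_add_le[of f "(a, 0)" "(0, b)"] by (simp add: ab)
  also have "\<dots> \<le> ennreal (C * \<delta>) + ennreal (C * \<delta>)"
    using pos[of "\<bar>a\<bar>"] pos[of "\<bar>b\<bar>"] ab sgn by (intro add_mono) auto
  also have "\<dots> = ennreal (2 * C * \<delta>)"
    using C ab by (subst ennreal_plus[symmetric]) auto
  finally show ?thesis .
qed

text \<open>The Riesz-Kolmogorov criterion. Integrals over all dyadic cells form countably many
  bounded sequences, so a diagonal subsequence makes all of them converge; the modulus bound then
  makes the functions themselves a Cauchy sequence.\<close>

lemma L1_compact:
  fixes F :: "nat \<Rightarrow> real \<times> real \<Rightarrow> real"
  assumes F: "\<And>n. F n \<in> borel_measurable borel" "\<And>n z. z \<notin> tent_T \<Longrightarrow> F n z = 0" "\<And>n. L1norm (F n) \<le> 1"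
    and C: "0 \<le> C" and s0: "0 < s0"
    and V: "\<And>n s. 0 < s \<Longrightarrow> s \<le> s0 \<Longrightarrow> modulus (F n) s \<le> ennreal (C * s)"
  obtains r f where "strict_mono (r :: nat \<Rightarrow> nat)" "f \<in> borel_measurable borel" "\<And>z. z \<notin> tent_T \<Longrightarrow> f z = 0"
    "(\<lambda>n. L1norm (\<lambda>z. F (r n) z - f z)) \<longlonglongrightarrow> 0"
proof -
  note [measurable] = F(1)
  have int: "integrable lborel (F n)" for n
    using F(3)[of n] by (subst integrable_iff_L1norm) (auto intro: le_less_trans)
  \<comment> \<open>Two uses of \<open>prod_decode\<close> enumerate the triples of mesh level and
    the two cell indices by one natural number.\<close>
  define X where "X n i = (case prod_decode i of (j, k) \<Rightarrow> cell_integral (1 / 2 ^ j) (F n) (prod_decode k))" for n i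
  have cint: "integrable lborel (\<lambda>y. indicator (cell \<delta> c) y * F n y)" for \<delta> c n
    using integrable_mult_indicator[OF _ int[of n], of "cell \<delta> c"] by simp
  have "\<bar>cell_integral \<delta> (F n) c\<bar> \<le> 1" for \<delta> n c
  proof -
    have "ennreal \<bar>cell_integral \<delta> (F n) c\<bar> \<le> (\<integral>\<^sup>+y. ennreal (norm (indicator (cell \<delta> c) y * F n y)) \<partial>lborel)"
      unfolding cell_integral_def using integral_norm_bound_ennreal[OF cint] by simp
    also have "\<dots> \<le> L1norm (F n)"
      unfolding L1norm_def by (intro nn_integral_mono) (auto simp: indicator_def)
    also have "\<dots> \<le> ennreal 1" using F(3) by simp
    finally show ?thesis by (subst (asm) ennreal_le_iff) auto
  qed
  then have "\<bar>X n i\<bar> \<le> 1" for n i by (auto simp: X_def split: prod.split)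
  then obtain r where r: "strict_mono (r :: nat \<Rightarrow> nat)" "\<And>i. convergent (\<lambda>n. X (r n) i)"
    using bounded_family_convergent_subsequence by blast
  have conv: "convergent (\<lambda>n. cell_integral (1 / 2 ^ j) (F (r n)) c)" for j c
    using r(2)[of "prod_encode (j, prod_encode c)"] by (simp add: X_def)
  have cauchy: "\<exists>N. \<forall>m\<ge>N. \<forall>n\<ge>N. L1norm (\<lambda>z. F (r m) z - F (r n) z) \<le> ennreal e" if e: "e > 0" for e
  proof -
    define A where "A = measure lborel tent_T"
    have A: "0 \<le> A" "emeasure lborel tent_T = ennreal A"
      using emeasure_tent_T_finite by (simp_all add: A_def emeasure_eq_ennreal_measure)
    have "(\<lambda>j. 1 / (2::real) ^ j) \<longlonglongrightarrow> 0"
      using LIMSEQ_power_zero[of "1 / 2 :: real"] by (simp add: power_divide)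
    \<comment> \<open>A difference of two members has increments at most
      \<open>4 * C * \<delta>\<close>; the factor \<open>4 * \<delta>\<^sup>2\<close> of
      \<open>L1norm_le_cells\<close> leaves \<open>16 * C * \<delta>\<close> after division by
      \<open>\<delta>\<^sup>2\<close>.\<close>
    then have "(\<lambda>j. 16 * C * (1 / 2 ^ j)) \<longlonglongrightarrow> 16 * C * 0" by (intro tendsto_intros)
    then have "\<forall>\<^sub>F j in sequentially. 16 * C * (1 / 2 ^ j) < e / 2" by (rule order_tendstoD(2)) (use e in simp)
    moreover have "\<forall>\<^sub>F j in sequentially. 1 / 2 ^ j < s0" by (rule order_tendstoD(2)) (fact, fact)
    ultimately have "\<forall>\<^sub>F j in sequentially. 16 * C * (1 / 2 ^ j) < e / 2 \<and> 1 / 2 ^ j < s0" by (rule eventually_conj)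
    from eventually_happens'[OF sequentially_bot this] obtain j :: nat where j: "16 * C * (1 / 2 ^ j) < e / 2" "1 / 2 ^ j < s0" by auto
    define \<delta> where "\<delta> = 1 / (2::real) ^ j"
    \<comment> \<open>One cell more than needed to reach 2, since \<open>tent_T_covered\<close> asks
      for strict inequality.\<close>
    define M :: nat where "M = 2 ^ (j + 1) + 1"
    have \<delta>: "0 < \<delta>" "\<delta> \<le> s0" "16 * C * \<delta> < e / 2" using j by (auto simp: \<delta>_def)
    have "real M * \<delta> = 2 + \<delta>" by (simp add: M_def \<delta>_def field_simps)
    then have M: "2 < real M * \<delta>" using \<delta> by simp
    define K where "K = {..<M} \<times> {..<M}"
    define l where "l c = lim (\<lambda>n. cell_integral \<delta> (F (r n)) c)" for c
    define S where "S n = (\<Sum>c\<in>K. \<bar>cell_integral \<delta> (F (r n)) c - l c\<bar>)" for n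
    have "(\<lambda>n. S n) \<longlonglongrightarrow> (\<Sum>c\<in>K. \<bar>l c - l c\<bar>)"
      unfolding S_def l_def using conv[of j] by (intro tendsto_intros) (auto simp: convergent_LIMSEQ_iff \<delta>_def)
    then have S: "S \<longlonglongrightarrow> 0" by simp
    \<comment> \<open>Makes the cell sums of two members contribute at most half of
      \<open>e\<close>; \<open>A + 1\<close> avoids division by zero.\<close>
    define \<eta> where "\<eta> = e * \<delta>\<^sup>2 / (4 * (A + 1))"
    have \<eta>: "0 < \<eta>" "A * (2 * \<eta>) \<le> e / 2 * \<delta>\<^sup>2"
    proof -
      show "0 < \<eta>" using e \<delta> A by (simp add: \<eta>_def)
      then have "A * (2 * \<eta>) \<le> (A + 1) * (2 * \<eta>)" by (intro mult_right_mono) auto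
      also have "\<dots> = e / 2 * \<delta>\<^sup>2" using A by (simp add: \<eta>_def field_simps)
      finally show "A * (2 * \<eta>) \<le> e / 2 * \<delta>\<^sup>2" .
    qed
    from order_tendstoD(2)[OF S \<eta>(1)] obtain N where N: "\<And>n. n \<ge> N \<Longrightarrow> S n < \<eta>" by (auto simp: eventually_sequentially)
    have "L1norm (\<lambda>z. F (r m) z - F (r n) z) \<le> ennreal e" if mn: "m \<ge> N" "n \<ge> N" for m n
    proof -
      let ?g = "\<lambda>z. F (r m) z - F (r n) z"
      have cd: "cell_integral \<delta> ?g c = cell_integral \<delta> (F (r m)) c - cell_integral \<delta> (F (r n)) c" for c
        unfolding cell_integral_def right_diff_distrib by (rule Bochner_Integration.integral_diff[OF cint cint])
      have "(\<Sum>c\<in>K. \<bar>cell_integral \<delta> ?g c\<bar>) \<le> (\<Sum>c\<in>K. \<bar>cell_integral \<delta> (F (r m)) c - l c\<bar> + \<bar>cell_integral \<delta> (F (r n)) c - l c\<bar>)"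
        unfolding cd by (intro sum_mono) linarith
      also have "\<dots> = S m + S n" by (simp add: S_def sum.distrib)
      also have "\<dots> \<le> 2 * \<eta>" using N[OF mn(1)] N[OF mn(2)] by simp
      finally have I: "(\<Sum>c\<in>K. \<bar>cell_integral \<delta> ?g c\<bar>) \<le> 2 * \<eta>" .
      have "ennreal (\<delta>\<^sup>2) * L1norm ?g \<le> emeasure lborel tent_T * ennreal (\<Sum>c\<in>K. \<bar>cell_integral \<delta> ?g c\<bar>)
          + ennreal (4 * \<delta>\<^sup>2) * ennreal (4 * C * \<delta>)"
        unfolding K_def
      proof (rule L1norm_le_cells)
        fix v assume v: "v \<in> cbox (-\<delta>, -\<delta>) (\<delta>, \<delta>)"
        have "incr1 ?g v \<le> incr1 (F (r m)) v + incr1 (F (r n)) v"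
          by (rule incr_diff) measurable
        also have "\<dots> \<le> ennreal (2 * C * \<delta>) + ennreal (2 * C * \<delta>)"
          by (intro add_mono incr_le_of_variation[OF F(1) C V \<delta>(2) v]) auto
        also have "\<dots> = ennreal (4 * C * \<delta>)" using C \<delta> by (subst ennreal_plus[symmetric]) auto
        finally show "incr1 ?g v \<le> ennreal (4 * C * \<delta>)" .
      qed (use int F(2) \<delta> M in auto)
      also have "\<dots> \<le> ennreal A * ennreal (2 * \<eta>) + ennreal (4 * \<delta>\<^sup>2) * ennreal (4 * C * \<delta>)"
        unfolding A(2) by (intro add_right_mono mult_left_mono ennreal_leI I) auto
      also have "\<dots> = ennreal (A * (2 * \<eta>) + 4 * \<delta>\<^sup>2 * (4 * C * \<delta>))"
        using A \<eta> C \<delta> by (simp add: ennreal_mult[symmetric] ennreal_plus[symmetric] del: ennreal_plus)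
      also have "\<dots> \<le> ennreal (\<delta>\<^sup>2 * e)"
      proof (rule ennreal_leI)
        have "4 * \<delta>\<^sup>2 * (4 * C * \<delta>) = 16 * C * \<delta> * \<delta>\<^sup>2" by simp
        also have "\<dots> \<le> e / 2 * \<delta>\<^sup>2" using \<delta> by (intro mult_right_mono) auto
        finally show "A * (2 * \<eta>) + 4 * \<delta>\<^sup>2 * (4 * C * \<delta>) \<le> \<delta>\<^sup>2 * e" using \<eta>(2) by (simp add: algebra_simps)
      qed
      also have "\<dots> = ennreal (\<delta>\<^sup>2) * ennreal e" using e by (simp add: ennreal_mult)
      finally show ?thesis using \<delta> by (subst (asm) ennreal_mult_le_mult_iff) auto
    qed
    then show ?thesis by blast
  qed
  show ?thesis
  proof (rule L1_complete[of "\<lambda>n. F (r n)" tent_T])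
    fix r' :: "nat \<Rightarrow> nat" and f
    assume r': "strict_mono r'" "f \<in> borel_measurable borel" "\<And>z. z \<notin> tent_T \<Longrightarrow> f z = 0"
      "(\<lambda>n. L1norm (\<lambda>z. F (r (r' n)) z - f z)) \<longlonglongrightarrow> 0"
    show ?thesis
    proof (rule that)
      show "strict_mono (r \<circ> r')" using r(1) r'(1) by (rule strict_mono_o)
      show "(\<lambda>n. L1norm (\<lambda>z. F ((r \<circ> r') n) z - f z)) \<longlonglongrightarrow> 0" using r'(4) by simp
    qed (fact r')+
  qed (fact int cauchy F(2))+
qed

section \<open>Invariant densities and invariant measures\<close>

lemma space_lborel_tent_T [simp]: "space (lborel_on tent_T) = tent_T"
  by (simp add: space_restrict_space)

lemma nn_integral_lborel_tent_T: "(\<integral>\<^sup>+z. f z \<partial>lborel_on tent_T) = (\<integral>\<^sup>+z. f z * indicator tent_T z \<partial>lborel)"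
  by (rule nn_integral_restrict_space) simp

lemma finite_measure_lborel_tent_T: "finite_measure (lborel_on tent_T)"
  using emeasure_tent_T_finite by (intro finite_measureI) (simp add: emeasure_restrict_space)

lemma AE_lborel_tent_T: "(AE z in lborel_on tent_T. P z) \<longleftrightarrow> (AE z in lborel. z \<in> tent_T \<longrightarrow> P z)"
  by (rule AE_restrict_space_iff) simp

text \<open>A representative on the whole plane: sign and support conditions hold at every point,
  and only the fixed point equation holds up to a null set.\<close>

definition acip_density :: "real \<Rightarrow> (real \<times> real \<Rightarrow> real) \<Rightarrow> bool" where
  "acip_density t h \<longleftrightarrow> h \<in> borel_measurable borel \<and> (\<forall>z. 0 \<le> h z) \<and> (\<forall>z. z \<notin> tent_T \<longrightarrow> h z = 0) \<and>
     L1norm h = 1 \<and> (AE z in lborel. transfer t h z = h z)"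

lemma tent_map_vimage: "tent_map t -` A \<inter> tent_T = fold_map t -` A \<inter> tent_T"
  using tent_map_eq_fold_map by auto

text \<open>By duality \<open>transfer t h\<close> is the density of the image measure, which is the
  measure itself; uniqueness of densities gives the fixed point equation almost everywhere.\<close>

lemma leb_density_acip:
  assumes t: "0 < t" "t \<le> 1" and \<mu>: "acip tent_T (tent_map t) \<mu>"
  defines "h \<equiv> \<lambda>z. leb_density tent_T \<mu> z * indicator tent_T z"
  shows "acip_density t h"
proof -
  let ?M = "lborel_on tent_T"
  interpret finite_measure ?M by (rule finite_measure_lborel_tent_T)
  interpret \<mu>: prob_space \<mu> using \<mu> by (simp add: acip_def)
  have sets: "sets \<mu> = sets ?M" and ac: "absolutely_continuous ?M \<mu>"
    using \<mu> by (auto simp: acip_def)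
  have space: "space \<mu> = tent_T" using sets_eq_imp_space_eq[OF sets] by simp
  have dens: "density ?M (RN_deriv ?M \<mu>) = \<mu>" by (rule density_RN_deriv[OF ac sets])
  have fin: "AE z in ?M. RN_deriv ?M \<mu> z \<noteq> \<infinity>"
    by (rule RN_deriv_finite[OF _ ac sets]) unfold_locales
  have leb [measurable]: "leb_density tent_T \<mu> \<in> borel_measurable ?M"
    unfolding leb_density_def by measurable
  have hm [measurable]: "h \<in> borel_measurable borel"
    using leb unfolding h_def by (subst (asm) borel_measurable_restrict_space_iff) (auto simp: mult.commute)
  have h0: "0 \<le> h z" for z by (simp add: h_def leb_density_def)
  have emeas: "emeasure \<mu> (A \<inter> tent_T) = (\<integral>\<^sup>+z. ennreal (h z) * indicator A z \<partial>lborel)" if [measurable]: "A \<in> sets borel" for A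
  proof -
    have A: "A \<inter> tent_T \<in> sets ?M" by (auto simp: sets_restrict_space)
    have "emeasure \<mu> (A \<inter> tent_T) = (\<integral>\<^sup>+z. RN_deriv ?M \<mu> z * indicator (A \<inter> tent_T) z \<partial>?M)"
      by (subst dens[symmetric], subst emeasure_density) (use A in auto)
    also have "\<dots> = (\<integral>\<^sup>+z. ennreal (leb_density tent_T \<mu> z) * indicator (A \<inter> tent_T) z \<partial>?M)"
      using fin by (intro nn_integral_cong_AE) (auto simp: leb_density_def less_top)
    also have "\<dots> = (\<integral>\<^sup>+z. ennreal (h z) * indicator A z \<partial>lborel)"
      unfolding nn_integral_lborel_tent_T by (intro nn_integral_cong) (auto simp: h_def indicator_def)
    finally show ?thesis .
  qed
  have inv: "emeasure \<mu> (fold_map t -` A \<inter> tent_T) = emeasure \<mu> (A \<inter> tent_T)" if [measurable]: "A \<in> sets borel" for A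
  proof -
    have A: "A \<inter> tent_T \<in> sets \<mu>" unfolding sets by (auto simp: sets_restrict_space)
    have "emeasure \<mu> (tent_map t -` (A \<inter> tent_T) \<inter> space \<mu>) = emeasure \<mu> (A \<inter> tent_T)"
      using \<mu> A unfolding acip_def invariant_measure_def by blast
    also have "tent_map t -` (A \<inter> tent_T) \<inter> space \<mu> = fold_map t -` A \<inter> tent_T"
    proof -
      have "fold_map t z \<in> tent_T" if "z \<in> tent_T" for z using fold_map_tent_T[OF that] t by simp
      then show ?thesis unfolding space tent_map_vimage by blast
    qed
    finally show ?thesis .
  qed
  have "density lborel (\<lambda>z. ennreal (transfer t h z)) = density lborel (\<lambda>z. ennreal (h z))"
  proof (rule measure_eqI)
    fix A assume "A \<in> sets (density lborel (\<lambda>z. ennreal (transfer t h z)))"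
    then have [measurable]: "A \<in> sets borel" by simp
    have [measurable]: "fold_map t -` A \<in> sets borel" using measurable_sets[OF measurable_fold_map, of A t] by simp
    have "(\<integral>\<^sup>+z. ennreal (transfer t h z) * indicator A z \<partial>lborel) = (\<integral>\<^sup>+z. ennreal (h z) * indicator A (fold_map t z) \<partial>lborel)"
      by (rule nn_integral_transfer) (use h0 t in auto)
    also have "\<dots> = (\<integral>\<^sup>+z. ennreal (h z) * indicator (fold_map t -` A) z \<partial>lborel)"
      by (simp add: indicator_vimage)
    also have "\<dots> = (\<integral>\<^sup>+z. ennreal (h z) * indicator A z \<partial>lborel)"
      by (simp add: emeas[symmetric] inv)
    finally show "emeasure (density lborel (\<lambda>z. ennreal (transfer t h z))) A = emeasure (density lborel (\<lambda>z. ennreal (h z))) A"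
      by (simp add: emeasure_density)
  qed simp
  then have "AE z in lborel. ennreal (transfer t h z) = ennreal (h z)"
    by (intro sigma_finite_measure.density_unique[OF sigma_finite_lborel]) auto
  moreover have "0 \<le> transfer t h z" for z
    using h0 t by (auto simp: transfer_def Let_def)
  ultimately have "AE z in lborel. transfer t h z = h z" using h0 by (auto simp: ennreal_inj)
  moreover have "L1norm h = 1"
    using emeas[of UNIV] \<mu>.emeasure_space_1 h0 by (simp add: space L1norm_def)
  moreover have "\<forall>z. z \<notin> tent_T \<longrightarrow> h z = 0" by (simp add: h_def)
  ultimately show ?thesis using h0 hm unfolding acip_density_def by blast
qed

text \<open>Duality read in the other direction. The second conclusion ties the chosen
  representative to the Radon-Nikodym derivative in terms of which stability is formulated.\<close>

lemma acip_density_acip: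
  assumes t: "0 < t" "t \<le> 1" and h: "acip_density t h"
  defines "\<nu> \<equiv> density (lborel_on tent_T) (\<lambda>z. ennreal (h z))"
  shows "acip tent_T (tent_map t) \<nu>" "AE z in lborel_on tent_T. h z = leb_density tent_T \<nu> z"
proof -
  let ?M = "lborel_on tent_T"
  interpret finite_measure ?M by (rule finite_measure_lborel_tent_T)
  have [measurable]: "h \<in> borel_measurable borel" and h0: "\<And>z. 0 \<le> h z" "\<And>z. z \<notin> tent_T \<Longrightarrow> h z = 0"
    and h1: "L1norm h = 1" and inv: "AE z in lborel. transfer t h z = h z"
    using h by (auto simp: acip_density_def)
  have [measurable]: "h \<in> borel_measurable ?M" by (intro measurable_restrict_space1) simp
  have sets: "sets \<nu> = sets ?M" and space: "space \<nu> = tent_T" by (simp_all add: \<nu>_def)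
  have setsD: "A \<in> sets borel" if "A \<in> sets \<nu>" for A
    using that unfolding sets by (auto simp: sets_restrict_space)
  have emeas: "emeasure \<nu> A = (\<integral>\<^sup>+z. ennreal (h z) * indicator A z \<partial>lborel)" if "A \<in> sets \<nu>" for A
  proof -
    have "emeasure \<nu> A = (\<integral>\<^sup>+z. ennreal (h z) * indicator A z \<partial>?M)"
      unfolding \<nu>_def using that by (subst emeasure_density) (auto simp: sets)
    also have "\<dots> = (\<integral>\<^sup>+z. ennreal (h z) * indicator A z \<partial>lborel)"
      unfolding nn_integral_lborel_tent_T by (intro nn_integral_cong) (use h0 in \<open>auto simp: indicator_def\<close>)
    finally show ?thesis .
  qed
  have "emeasure \<nu> (space \<nu>) = 1"
  proof -
    have "emeasure \<nu> (space \<nu>) = (\<integral>\<^sup>+z. ennreal (h z) * indicator tent_T z \<partial>lborel)"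
      by (subst emeas) (auto simp: space sets sets_restrict_space)
    also have "\<dots> = L1norm h" unfolding L1norm_def
      by (intro nn_integral_cong) (use h0 in \<open>auto simp: indicator_def\<close>)
    finally show ?thesis using h1 by simp
  qed
  then have prob: "prob_space \<nu>" by (rule prob_spaceI)
  have fold: "fold_map t \<in> measurable \<nu> \<nu>"
  proof -
    have "fold_map t \<in> measurable (restrict_space borel tent_T) (restrict_space borel tent_T)"
      by (intro measurable_restrict_space3 measurable_fold_map) (use fold_map_tent_T t in auto)
    moreover have "sets \<nu> = sets (restrict_space borel tent_T)" unfolding sets by (intro sets_restrict_space_cong) simp
    ultimately show ?thesis by (simp cong: measurable_cong_sets)
  qed
  have "tent_map t \<in> measurable \<nu> \<nu>"
    by (subst measurable_cong[where g="fold_map t"]) (auto simp: space tent_map_eq_fold_map fold)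
  moreover have "emeasure \<nu> (tent_map t -` A \<inter> space \<nu>) = emeasure \<nu> A" if A: "A \<in> sets \<nu>" for A
  proof -
    note [measurable] = setsD[OF A]
    have "emeasure \<nu> (tent_map t -` A \<inter> space \<nu>) = emeasure \<nu> (fold_map t -` A \<inter> space \<nu>)"
      by (simp add: space tent_map_vimage)
    also have "\<dots> = (\<integral>\<^sup>+z. ennreal (h z) * indicator (fold_map t -` A \<inter> space \<nu>) z \<partial>lborel)"
      by (rule emeas) (rule measurable_sets[OF fold A])
    also have "\<dots> = (\<integral>\<^sup>+z. ennreal (h z) * indicator A (fold_map t z) \<partial>lborel)"
      by (intro nn_integral_cong) (use h0 in \<open>auto simp: indicator_def space\<close>)
    also have "\<dots> = (\<integral>\<^sup>+z. ennreal (transfer t h z) * indicator A z \<partial>lborel)"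
      by (rule nn_integral_transfer[symmetric]) (use h0 t in auto)
    also have "\<dots> = (\<integral>\<^sup>+z. ennreal (h z) * indicator A z \<partial>lborel)"
      using inv by (intro nn_integral_cong_AE) auto
    finally show ?thesis by (simp add: emeas[OF A])
  qed
  ultimately have "invariant_measure (tent_map t) \<nu>" by (auto simp: invariant_measure_def)
  moreover have "absolutely_continuous ?M \<nu>"
    unfolding \<nu>_def by (rule absolutely_continuousI_density) measurable
  ultimately show "acip tent_T (tent_map t) \<nu>" using prob sets by (auto simp: acip_def)
  have "AE z in ?M. ennreal (h z) = RN_deriv ?M \<nu> z"
    by (rule RN_deriv_unique) (auto simp: \<nu>_def)
  then show "AE z in ?M. h z = leb_density tent_T \<nu> z"
    by eventually_elim (simp add: leb_density_def h0 flip: \<open>\<And>z. 0 \<le> h z\<close>, metis enn2real_ennreal h0(1))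
qed

lemma AE_plane_line:
  assumes "a \<noteq> 0"
  shows "AE z in (lborel :: (real \<times> real) measure). a \<bullet> z \<noteq> b"
proof -
  have "{z. a \<bullet> z = b} \<in> null_sets lborel"
    using negligible_hyperplane[of a b] assms closed_hyperplane[of a b]
    by (simp add: negligible_iff_null_sets null_sets_completion_iff)
  from AE_not_in[OF this] show ?thesis by simp
qed

text \<open>Dominated convergence: \<open>g\<close> is bounded and the divisor
  \<open>2 * (t n)\<^sup>2\<close> is at least 1, so all images are dominated by a multiple of the
  indicator of \<open>tent_T\<close>. Pointwise convergence can fail only where the case distinction
  in \<open>transfer\<close> jumps.\<close>

lemma transfer_tendsto:
  assumes t: "22 / 25 \<le> t0" "\<And>n. 22 / 25 \<le> t n" "\<And>n. t n \<le> 1" "t \<longlonglongrightarrow> t0" "t0 \<le> 1"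
    and g: "tent_lipschitz L g"
  shows "(\<lambda>n. L1norm (\<lambda>z. transfer t0 g z - transfer (t n) g z)) \<longlonglongrightarrow> 0"
proof -
  note [measurable] = tent_lipschitz_measurable[OF g] and cont = tent_lipschitz_continuous[OF g] and g0 = tent_lipschitzD(3)[OF g]
  have "bounded (g ` tent_T)"
    using compact_continuous_image[OF continuous_on_subset[OF cont subset_UNIV] compact_tent_T] by (rule compact_imp_bounded)
  then obtain B where B0: "\<forall>x\<in>g ` tent_T. norm x \<le> B" unfolding bounded_iff by blast
  have B: "\<bar>g z\<bar> \<le> \<bar>B\<bar>" for z
  proof (cases "z \<in> tent_T")
    case True
    then have "\<bar>g z\<bar> \<le> B" using B0 by auto
    then show ?thesis by linarith
  qed (simp add: g0)
  have "(\<lambda>n. \<integral>\<^sup>+z. norm (transfer t0 g z - transfer (t n) g z) \<partial>lborel) \<longlonglongrightarrow> 0"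
  proof (rule nn_integral_dominated_convergence_norm)
    fix n
    have tn: "0 < t n" using t(2)[of n] by simp
    have "\<bar>transfer (t n) g z\<bar> \<le> 2 * \<bar>B\<bar> * indicator tent_T z" for z
    proof (cases "z \<in> tent_T")
      case False
      then show ?thesis using transfer_tent_T[OF g0 tn t(3)] by simp
    next
      case True
      have "(22 / 25)\<^sup>2 \<le> (t n)\<^sup>2" using t(2) by (intro power_mono) auto
      then have t2: "1 \<le> 2 * (t n)\<^sup>2" by (simp add: power2_eq_square)
      have "\<bar>g x + g y\<bar> / (2 * (t n)\<^sup>2) \<le> (2 * \<bar>B\<bar>) / 1" for x y
        using B[of x] B[of y] t2 by (intro frac_le) auto
      then show ?thesis using True by (auto simp: transfer_def Let_def)
    qed
    then show "AE z in lborel. norm (transfer (t n) g z) \<le> 2 * \<bar>B\<bar> * indicator tent_T z" by simp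
  next
    have "(\<integral>\<^sup>+z. ennreal (2 * \<bar>B\<bar> * indicator tent_T z) \<partial>lborel) = ennreal (2 * \<bar>B\<bar>) * emeasure lborel tent_T"
      by (subst nn_integral_cmult_indicator[symmetric]) (auto intro!: nn_integral_cong simp: indicator_def)
    also have "\<dots> < \<infinity>" using emeasure_tent_T_finite by (simp add: ennreal_mult_less_top)
    finally show "(\<integral>\<^sup>+z. ennreal (2 * \<bar>B\<bar> * indicator tent_T z) \<partial>lborel) < \<infinity>" .
    \<comment> \<open>This line is the image of the crease under the map for
      \<open>t0\<close>.\<close>
    have "AE z in (lborel :: (real \<times> real) measure). (1, 1) \<bullet> z \<noteq> 2 * t0" by (rule AE_plane_line) (simp add: zero_prod_def)
    then show "AE z in lborel. (\<lambda>n. transfer (t n) g z) \<longlonglongrightarrow> transfer t0 g z"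
    proof eventually_elim
      case (elim z)
      define a where "a t = (fst z + snd z) / (2 * t)" for t
      define b where "b t = (fst z - snd z) / (2 * t)" for t
      have t0: "t0 \<noteq> 0" using t(1) by auto
      have ab: "(\<lambda>n. a (t n)) \<longlonglongrightarrow> a t0" "(\<lambda>n. b (t n)) \<longlonglongrightarrow> b t0"
        unfolding a_def b_def using t0 by (auto intro!: tendsto_intros t(4))
      have gt: "(\<lambda>n. g (x n)) \<longlonglongrightarrow> g y" if "x \<longlonglongrightarrow> y" for x y
        using continuous_on_tendsto_compose[OF cont that] by simp
      have "a t0 \<noteq> 1" using elim t0 by (cases z) (auto simp: a_def field_simps)
      then consider "a t0 < 1" | "a t0 > 1" by linarith
      then show ?case
      proof cases
        case 1
        have lim: "(\<lambda>n. (g (a (t n), b (t n)) + g (2 - a (t n), b (t n))) / (2 * (t n)\<^sup>2)) \<longlonglongrightarrow>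
            (g (a t0, b t0) + g (2 - a t0, b t0)) / (2 * t0\<^sup>2)"
          using t0 by (auto intro!: tendsto_intros gt ab t(4))
        have "\<forall>\<^sub>F n in sequentially. (g (a (t n), b (t n)) + g (2 - a (t n), b (t n))) / (2 * (t n)\<^sup>2) = transfer (t n) g z"
          using order_tendstoD(2)[OF ab(1) 1] by eventually_elim (simp add: transfer_def Let_def a_def b_def)
        from Lim_transform_eventually[OF lim this] show ?thesis
          using 1 by (simp add: transfer_def Let_def a_def b_def)
      next
        case 2
        have "\<forall>\<^sub>F n in sequentially. transfer (t n) g z = 0"
          using order_tendstoD(1)[OF ab(1) 2] by eventually_elim (simp add: transfer_def Let_def a_def)
        moreover have "transfer t0 g z = 0" using 2 by (simp add: transfer_def Let_def a_def)
        ultimately show ?thesis by (simp add: tendsto_eventually)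
      qed
    qed
  qed measurable
  then show ?thesis by (simp add: L1norm_def)
qed

section \<open>Existence and statistical stability\<close>

lemma L1norm_transfer_diff_le:
  assumes [measurable]: "f \<in> borel_measurable borel" "g \<in> borel_measurable borel" and "t > 0"
  shows "L1norm (\<lambda>z. transfer t f z - transfer t g z) \<le> L1norm (\<lambda>z. f z - g z)"
  using L1norm_transfer_le[of "\<lambda>z. f z - g z" t] assms(3) by (simp add: transfer_diff[abs_def])

text \<open>Only asymptotic invariance is asked of \<open>h n\<close>, with a parameter that may
  vary, so that one statement serves both for invariant densities along \<open>t n\<close> and for
  Cesaro averages at a fixed parameter.\<close>

lemma approx_invariant_limit:
  assumes t: "22 / 25 \<le> t0" "t0 \<le> 1" "\<And>n. 22 / 25 \<le> t n" "\<And>n. t n \<le> 1" "t \<longlonglongrightarrow> t0"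
    and h: "\<And>n. h n \<in> borel_measurable borel" "\<And>n z. 0 \<le> h n z" "\<And>n. L1norm (h n) = 1"
      "(\<lambda>n. L1norm (\<lambda>z. transfer (t n) (h n) z - h n z)) \<longlonglongrightarrow> 0"
    and f: "f \<in> borel_measurable borel" "\<And>z. z \<notin> tent_T \<Longrightarrow> f z = 0" "(\<lambda>n. L1norm (\<lambda>z. h n z - f z)) \<longlonglongrightarrow> 0"
  shows "acip_density t0 (\<lambda>z. max 0 (f z))" "AE z in lborel. f z = max 0 (f z)"
proof -
  note [measurable] = h(1) f(1)
  \<comment> \<open>\<open>acip_density\<close> demands nonnegativity everywhere. Since the
    \<open>h n\<close> are nonnegative, taking the positive part of the limit does not increase its
    distance from them.\<close>
  define f' where "f' z = max 0 (f z)" for z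
  have [measurable]: "f' \<in> borel_measurable borel" unfolding f'_def by measurable
  have t_pos: "t n > 0" "t0 > 0" for n using t(1) t(3)[of n] by linarith+
  define D where "D n = L1norm (\<lambda>z. h n z - f' z)" for n
  have D: "D \<longlonglongrightarrow> 0"
  proof (rule tendsto_sandwich[OF _ _ tendsto_const f(3)])
    show "\<forall>\<^sub>F n in sequentially. D n \<le> L1norm (\<lambda>z. h n z - f z)"
      unfolding D_def L1norm_def f'_def
    proof (intro always_eventually allI nn_integral_mono ennreal_leI)
      fix n z
      show "\<bar>h n z - max 0 (f z)\<bar> \<le> \<bar>h n z - f z\<bar>" using h(2)[of n z] by (simp add: max_def)
    qed
  qed simp
  have zero: "x = 0" if "\<And>n. x \<le> X n" "X \<longlonglongrightarrow> 0" for x :: ennreal and X :: "nat \<Rightarrow> ennreal"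
    using LIMSEQ_le_const[OF that(2), of x] that(1) by auto
  have "L1norm (\<lambda>z. f z - f' z) = 0"
  proof (rule zero)
    fix n
    show "L1norm (\<lambda>z. f z - f' z) \<le> L1norm (\<lambda>z. h n z - f z) + D n"
      unfolding D_def by (subst L1norm_minus_commute, rule L1norm_diff_triangle) measurable
  next
    show "(\<lambda>n. L1norm (\<lambda>z. h n z - f z) + D n) \<longlonglongrightarrow> 0" using tendsto_add[OF f(3) D] by simp
  qed
  then show "AE z in lborel. f z = max 0 (f z)"
    by (subst (asm) L1norm_eq_0_iff) (auto simp: f'_def)
  have one: "L1norm f' = 1"
  proof (rule antisym)
    have "L1norm f' \<le> D n + 1" for n
    proof -
      have "L1norm (\<lambda>z. f' z - 0) \<le> L1norm (\<lambda>z. f' z - h n z) + L1norm (\<lambda>z. h n z - 0)"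
        by (rule L1norm_diff_triangle) measurable
      then show ?thesis by (simp add: h(3) D_def L1norm_minus_commute[of f'])
    qed
    moreover have "(\<lambda>n. D n + 1) \<longlonglongrightarrow> 0 + 1" by (intro tendsto_intros D)
    ultimately show "L1norm f' \<le> 1" using LIMSEQ_le_const[of "\<lambda>n. D n + 1" 1 "L1norm f'"] by auto
    have "1 \<le> D n + L1norm f'" for n
    proof -
      have "L1norm (\<lambda>z. h n z - 0) \<le> L1norm (\<lambda>z. h n z - f' z) + L1norm (\<lambda>z. f' z - 0)"
        by (rule L1norm_diff_triangle) measurable
      then show ?thesis by (simp add: h(3) D_def)
    qed
    moreover have "(\<lambda>n. D n + L1norm f') \<longlonglongrightarrow> 0 + L1norm f'" by (intro tendsto_intros D)
    ultimately show "1 \<le> L1norm f'" using LIMSEQ_le_const[of "\<lambda>n. D n + L1norm f'" "L1norm f'" 1] by auto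
  qed
  have f'0: "f' z = 0" if "z \<notin> tent_T" for z using f(2)[OF that] by (simp add: f'_def)
  have "lip_approximable f'"
    by (rule lip_approximable_integrable) (use one f'0 in \<open>auto simp: integrable_iff_L1norm\<close>)
  have "L1norm (\<lambda>z. transfer t0 f' z - f' z) \<le> 0"
  proof (rule ennreal_le_epsilon)
    fix e :: real assume "0 < e"
    then have e: "e / 2 > 0" by simp
    obtain g L where g: "tent_lipschitz L g" "L1norm (\<lambda>z. f' z - g z) \<le> ennreal (e / 2)"
      using \<open>lip_approximable f'\<close> e unfolding lip_approximable_def by blast
    note [measurable] = tent_lipschitz_measurable[OF g(1)]
    define E where "E n = L1norm (\<lambda>z. transfer t0 g z - transfer (t n) g z)" for n
    define I where "I n = L1norm (\<lambda>z. transfer (t n) (h n) z - h n z)" for n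
    have E: "E \<longlonglongrightarrow> 0" unfolding E_def
      by (rule transfer_tendsto[where L=L]) (use t g in auto)
    \<comment> \<open>The chain of comparisons passes from \<open>transfer t0 f'\<close> through
      \<open>transfer t0 g\<close>, \<open>transfer (t n) g\<close>,
      \<open>transfer (t n) f'\<close> and \<open>transfer (t n) (h n)\<close> to \<open>h n\<close>
      and \<open>f'\<close>. The parameter is changed only at the Lipschitz function
      \<open>g\<close>, where \<open>transfer_tendsto\<close> applies.\<close>
    have le: "L1norm (\<lambda>z. transfer t0 f' z - f' z) \<le> ennreal (e / 2) + (E n + (ennreal (e / 2) + (D n + (I n + D n))))" for n
    proof -
      let ?P = "transfer (t n)"
      have "L1norm (\<lambda>z. transfer t0 f' z - f' z) \<le> L1norm (\<lambda>z. transfer t0 f' z - transfer t0 g z) + L1norm (\<lambda>z. transfer t0 g z - f' z)"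
        by (rule L1norm_diff_triangle) measurable
      also have "L1norm (\<lambda>z. transfer t0 f' z - transfer t0 g z) \<le> ennreal (e / 2)"
        by (rule order_trans[OF L1norm_transfer_diff_le g(2)]) (use t_pos in measurable)
      also have "L1norm (\<lambda>z. transfer t0 g z - f' z) \<le> E n + L1norm (\<lambda>z. ?P g z - f' z)"
        unfolding E_def by (rule L1norm_diff_triangle) measurable
      also have "L1norm (\<lambda>z. ?P g z - f' z) \<le> L1norm (\<lambda>z. ?P g z - ?P f' z) + L1norm (\<lambda>z. ?P f' z - f' z)"
        by (rule L1norm_diff_triangle) measurable
      also have "L1norm (\<lambda>z. ?P g z - ?P f' z) \<le> ennreal (e / 2)"
        by (rule order_trans[OF L1norm_transfer_diff_le]) (use t_pos g(2) in \<open>auto simp: L1norm_minus_commute[of g]\<close>)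
      also have "L1norm (\<lambda>z. ?P f' z - f' z) \<le> L1norm (\<lambda>z. ?P f' z - ?P (h n) z) + L1norm (\<lambda>z. ?P (h n) z - f' z)"
        by (rule L1norm_diff_triangle) measurable
      also have "L1norm (\<lambda>z. ?P f' z - ?P (h n) z) \<le> D n"
        by (rule order_trans[OF L1norm_transfer_diff_le]) (use t_pos in \<open>auto simp: L1norm_minus_commute[of f'] D_def\<close>)
      also have "L1norm (\<lambda>z. ?P (h n) z - f' z) \<le> I n + D n"
        unfolding I_def D_def by (rule L1norm_diff_triangle) measurable
      finally show ?thesis by (auto simp: add_mono)
    qed
    have "(\<lambda>n. ennreal (e / 2) + (E n + (ennreal (e / 2) + (D n + (I n + D n))))) \<longlonglongrightarrow>
        ennreal (e / 2) + (0 + (ennreal (e / 2) + (0 + (0 + 0))))"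
      using h(4) unfolding I_def[symmetric] by (intro tendsto_intros E D)
    then have "L1norm (\<lambda>z. transfer t0 f' z - f' z) \<le> ennreal (e / 2) + (0 + (ennreal (e / 2) + (0 + (0 + 0))))"
      by (rule LIMSEQ_le_const) (use le in auto)
    also have "\<dots> = 0 + ennreal e" using e by (simp add: ennreal_plus[symmetric] del: ennreal_plus)
    finally show "L1norm (\<lambda>z. transfer t0 f' z - f' z) \<le> 0 + ennreal e" .
  qed
  then have "L1norm (\<lambda>z. transfer t0 f' z - f' z) = 0" by simp
  then have "AE z in lborel. transfer t0 f' z = f' z"
    by (subst (asm) L1norm_eq_0_iff) auto
  then have "acip_density t0 f'" using one f'0 by (auto simp: acip_density_def) (simp add: f'_def)
  then show "acip_density t0 (\<lambda>z. max 0 (f z))" by (simp add: f'_def[abs_def])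
qed

section \<open>Invariant densities as limits of averages\<close>

lemma transfer_nonneg: "(\<And>z. 0 \<le> f z) \<Longrightarrow> 0 \<le> transfer t f z"
  by (auto simp: transfer_def Let_def)

lemma L1norm_transfer:
  assumes [measurable]: "f \<in> borel_measurable borel" and f: "\<And>z. 0 \<le> f z" and t: "t > 0"
  shows "L1norm (transfer t f) = L1norm f"
  using nn_integral_transfer[of f "\<lambda>_. 1" t] f t transfer_nonneg[of f t] by (simp add: L1norm_def)

lemma transfer_average:
  "transfer t (\<lambda>z. c * (\<Sum>k\<in>K. f k z)) z = c * (\<Sum>k\<in>K. transfer t (f k) z)"
proof -
  have "transfer t (\<lambda>z. \<Sum>k\<in>K. f k z) z = (\<Sum>k\<in>K. transfer t (f k) z)" for z
    by (auto simp: transfer_def Let_def sum.distrib sum_divide_distrib[symmetric])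
  moreover have "transfer t (\<lambda>z. c * g z) z = c * transfer t g z" for g
    by (auto simp: transfer_def Let_def algebra_simps)
  ultimately show ?thesis by simp
qed

lemma incr_average_le:
  assumes [measurable]: "\<And>k. k \<in> K \<Longrightarrow> f k \<in> borel_measurable borel" and c: "0 \<le> c" and K: "finite K"
  shows "incr1 (\<lambda>z. c * (\<Sum>k\<in>K. f k z)) u \<le> ennreal c * (\<Sum>k\<in>K. incr1 (f k) u)"
proof -
  have "incr1 (\<lambda>z. c * (\<Sum>k\<in>K. f k z)) u \<le> (\<integral>\<^sup>+z. ennreal c * (\<Sum>k\<in>K. ennreal \<bar>f k (z + u) - f k z\<bar>) \<partial>lborel)"
    unfolding incr_def
  proof (intro nn_integral_mono)
    fix z
    have "\<bar>c * (\<Sum>k\<in>K. f k (z + u)) - c * (\<Sum>k\<in>K. f k z)\<bar> = c * \<bar>\<Sum>k\<in>K. f k (z + u) - f k z\<bar>"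
      using c by (simp add: sum_subtractf right_diff_distrib[symmetric] abs_mult)
    also have "\<dots> \<le> c * (\<Sum>k\<in>K. \<bar>f k (z + u) - f k z\<bar>)" using c by (intro mult_left_mono sum_abs)
    finally show "1 * ennreal \<bar>c * (\<Sum>k\<in>K. f k (z + u)) - c * (\<Sum>k\<in>K. f k z)\<bar> \<le> ennreal c * (\<Sum>k\<in>K. ennreal \<bar>f k (z + u) - f k z\<bar>)"
      using c by (simp add: sum_ennreal ennreal_mult[symmetric] sum_nonneg ennreal_leI)
  qed
  also have "\<dots> = ennreal c * (\<Sum>k\<in>K. \<integral>\<^sup>+z. ennreal \<bar>f k (z + u) - f k z\<bar> \<partial>lborel)"
    by (subst nn_integral_cmult, measurable, subst nn_integral_sum) auto
  finally show ?thesis by (simp add: incr_def)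
qed

lemma variation_average_le:
  assumes "\<And>k. k \<in> K \<Longrightarrow> f k \<in> borel_measurable borel" and "0 \<le> c" and "finite K"
  shows "modulus (\<lambda>z. c * (\<Sum>k\<in>K. f k z)) s \<le> ennreal c * (\<Sum>k\<in>K. modulus (f k) s)"
  unfolding variation_def sum.distrib distrib_left by (intro add_mono incr_average_le assms)

lemma interior_tent_T_nonempty: "interior tent_T \<noteq> {}"
proof -
  have "ball (1, 1 / 4) (1 / 4) \<subseteq> tent_T"
  proof
    fix z :: "real \<times> real" assume "z \<in> ball (1, 1 / 4) (1 / 4)"
    then have "\<bar>1 - fst z\<bar> < 1 / 4" "\<bar>1 / 4 - snd z\<bar> < 1 / 4"
      using dist_fst_le[of "(1, 1 / 4)" z] dist_snd_le[of "(1, 1 / 4)" z] by (auto simp: dist_real_def)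
    then show "z \<in> tent_T" unfolding tent_T_iff by linarith
  qed
  then have "(1, 1 / 4) \<in> interior tent_T" by (intro interiorI[OF open_ball]) auto
  then show ?thesis by auto
qed

text \<open>The distance to the complement of the interior, capped at 1 and normalised; it is
  positive on a nonempty open set, so its norm is not zero.\<close>

lemma lipschitz_density_exists:
  obtains g L where "tent_lipschitz L g" "\<And>z. 0 \<le> g z" "L1norm g = 1"
proof -
  define W where "W = interior tent_T"
  define p where "p z = min 1 (infdist z (- W))" for z
  have W: "open W" "W \<subseteq> tent_T" "W \<noteq> {}" using interior_subset interior_tent_T_nonempty by (auto simp: W_def)
  have lip: "\<bar>p x - p y\<bar> \<le> 1 * dist x y" for x y
  proof -
    have "\<bar>p x - p y\<bar> \<le> \<bar>infdist x (- W) - infdist y (- W)\<bar>" by (auto simp: p_def)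
    then show ?thesis using infdist_triangle_abs[of x "- W" y] by simp
  qed
  have p0: "0 \<le> p z" for z using infdist_nonneg by (simp add: p_def)
  have pT: "p z = 0" if "z \<notin> tent_T" for z
  proof -
    have "z \<in> - W" using that W(2) by blast
    then show ?thesis by (simp add: p_def)
  qed
  have tl: "tent_lipschitz 1 p" using lip pT by (simp add: tent_lipschitz_def del: split_paired_All)
  note [measurable] = tent_lipschitz_measurable[OF tl]
  have "p z \<le> indicator tent_T z" for z using pT[of z] by (cases "z \<in> tent_T") (auto simp: p_def)
  then have "L1norm p \<le> L1norm (indicator tent_T)"
    unfolding L1norm_def using p0 by (intro nn_integral_mono ennreal_leI) (auto simp: abs_of_nonneg)
  then have fin: "L1norm p < \<infinity>" using L1norm_indicator_tent_T by (rule le_less_trans)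
  have "L1norm p \<noteq> 0"
  proof
    assume "L1norm p = 0"
    then have AE: "AE z in lborel. p z = 0" by (subst (asm) L1norm_eq_0_iff) auto
    have "bounded W" using compact_imp_bounded[OF compact_tent_T] W(2) by (rule bounded_subset)
    then have "W \<noteq> UNIV" using not_bounded_UNIV by auto
    then have ne: "- W \<noteq> {}" by auto
    have "p z \<noteq> 0" if "z \<in> W" for z
      using in_closed_iff_infdist_zero[OF W(1)[unfolded open_closed] ne, of z] that by (auto simp: p_def min_def)
    then have "AE z in lborel. z \<notin> W" using AE by (auto elim!: eventually_mono)
    then have "W \<in> null_sets lborel" using W(1) by (subst (asm) AE_iff_null_sets[symmetric]) auto
    then have "negligible W" by (simp add: negligible_iff_null_sets null_sets_completionI)
    then show False using open_not_negligible W by blast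
  qed
  define A where "A = enn2real (L1norm p)"
  have A: "0 < A" "L1norm p = ennreal A"
    using fin \<open>L1norm p \<noteq> 0\<close> by (auto simp: A_def enn2real_positive_iff less_top zero_less_iff_neq_zero)
  show ?thesis
  proof (rule that)
    show "tent_lipschitz (\<bar>1 / A\<bar> * 1) (\<lambda>z. (1 / A) * p z)" by (rule tent_lipschitz_cmult[OF tl])
    show "L1norm (\<lambda>z. (1 / A) * p z) = 1"
      using A by (subst L1norm_cmult) (auto simp: ennreal_mult[symmetric])
  qed (use A p0 in auto)
qed


text \<open>Blocks of \<open>N\<close> iterations are controlled by the contraction. The incomplete
  block is handled with the trivial bound \<open>hit_weight_le\<close> and tolerance
  \<open>\<rho> = 1\<close>, which is why \<open>s\<close> is kept below 1/3.\<close>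

lemma iterates_variation:
  assumes t: "22 / 25 \<le> t" "t \<le> 1"
    and g: "tent_lipschitz L g" "L1norm g \<le> 1"
  obtains C s0 where "0 \<le> C" "0 < s0"
    "\<And>m s. 0 < s \<Longrightarrow> s \<le> s0 \<Longrightarrow> modulus ((transfer t ^^ m) g) s \<le> ennreal (C * s)"
proof (rule lasota_yorke[OF t])
  fix N :: nat and \<kappa> C s0 \<delta> :: real
  assume N: "0 < N" and \<kappa>: "0 \<le> \<kappa>" "\<kappa> < 1" and C: "0 \<le> C" and s0: "0 < s0" and "0 < \<delta>"
    and LY: "\<And>t'. 22 / 25 \<le> t' \<Longrightarrow> t' \<le> 1 \<Longrightarrow> dist t' t < \<delta> \<Longrightarrow> contracts t' N \<kappa> C s0"
  have step: "contracts t N \<kappa> C s0" by (rule LY) (use t \<open>0 < \<delta>\<close> in auto)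
  have t_pos: "0 < t" using t by simp
  note [measurable] = tent_lipschitz_measurable[OF g(1)]
  define B where "B = 8 * L * measure lborel tent_T"
  have B: "0 \<le> B" "\<And>s. 0 < s \<Longrightarrow> modulus g s \<le> ennreal B * ennreal s"
    unfolding B_def using tent_lipschitzD(1)[OF g(1)] by (auto intro!: variation_lipschitz_le g)
  define D where "D = C / (1 - \<kappa>)"
  have D: "0 \<le> D" using \<kappa> C by (simp add: D_def)
  define s\<^sub>1 where "s\<^sub>1 = min s0 (1 / 3)"
  show ?thesis
  proof (rule that[of "2 ^ N * (B + D) + 24 * 2 ^ N" s\<^sub>1])
    fix m :: nat and s :: real assume s: "0 < s" "s \<le> s\<^sub>1"
    define k where "k = m div N"
    define i where "i = m mod N"
    have m: "m = i + N * k" and i: "i \<le> N" using N by (simp_all add: k_def i_def less_imp_le)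
    define p where "p = (transfer t ^^ (N * k)) g"
    have [measurable]: "p \<in> borel_measurable borel" unfolding p_def by measurable
    have p1: "L1norm p \<le> 1"
      unfolding p_def using L1norm_transfer_pow_le[of g t "N * k"] t_pos g(2) by auto
    have pV: "modulus p s' \<le> ennreal (B + D) * ennreal s'" if s': "0 < s'" "s' \<le> s0" for s'
    proof -
      have "modulus p s' \<le> (ennreal (\<kappa> ^ k * B) + ennreal D * L1norm g) * ennreal s'"
        unfolding p_def D_def
        by (rule iterated_lasota_yorke[OF step \<kappa> C t_pos t(2) _ tent_lipschitzD(3)[OF g(1)] B(1) _ s']) (auto intro: B(2))
      also have "\<dots> \<le> (ennreal B + ennreal D * 1) * ennreal s'"
        using \<kappa> B(1) g(2) by (intro mult_right_mono add_mono ennreal_leI mult_left_mono mult_left_le_one_le power_le_one) auto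
      finally show ?thesis using B(1) D by simp
    qed
    define \<sigma> where "\<sigma> = 1 / (sqrt 2 * t)"
    have "1 \<le> sqrt 2 * t" by (rule sqrt2_mult_ge(2)[OF t(1)])
    then have \<sigma>: "0 < \<sigma>" "\<sigma> \<le> 1" by (auto simp: \<sigma>_def)
    have \<sigma>i: "0 < \<sigma> ^ i" "\<sigma> ^ i \<le> 1" using \<sigma> by (auto intro: power_le_one)
    have s'': "0 < \<sigma> ^ i * s" "\<sigma> ^ i * s \<le> s" using \<sigma>i s mult_right_mono[of "\<sigma> ^ i" 1 s] by auto
    have "modulus ((transfer t ^^ i) p) s \<le> variation (hit_weight t 1 i) p (\<sigma> ^ i * s) + ennreal (24 * 2 ^ i * s / 1) * L1norm p"
      unfolding \<sigma>_def by (rule transfer_pow_variation) (use t_pos t s \<sigma> in \<open>auto simp: s\<^sub>1_def \<sigma>_def\<close>)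
    also have "\<dots> \<le> 2 ^ i * (ennreal (B + D) * ennreal s) + ennreal (24 * 2 ^ i * s) * 1"
    proof (intro add_mono)
      have "variation (hit_weight t 1 i) p (\<sigma> ^ i * s) \<le> variation (\<lambda>_. 2 ^ i) p (\<sigma> ^ i * s)"
        unfolding variation_def incr_def by (intro add_mono nn_integral_mono mult_right_mono hit_weight_le) auto
      also have "\<dots> = 2 ^ i * modulus p (\<sigma> ^ i * s)" by (rule variation_const) measurable
      also have "\<dots> \<le> 2 ^ i * (ennreal (B + D) * ennreal (\<sigma> ^ i * s))"
      proof (intro mult_left_mono pV)
        show "0 < \<sigma> ^ i * s" by (rule s'')
        show "\<sigma> ^ i * s \<le> s0" using s''(2) s(2) unfolding s\<^sub>1_def by linarith
      qed auto
      also have "\<dots> \<le> 2 ^ i * (ennreal (B + D) * ennreal s)"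
        using s'' by (intro mult_left_mono ennreal_leI) auto
      finally show "variation (hit_weight t 1 i) p (\<sigma> ^ i * s) \<le> 2 ^ i * (ennreal (B + D) * ennreal s)" .
      show "ennreal (24 * 2 ^ i * s / 1) * L1norm p \<le> ennreal (24 * 2 ^ i * s) * 1"
        using p1 by (intro mult_mono) auto
    qed
    also have "\<dots> = ennreal (2 ^ i * (B + D) * s + 24 * 2 ^ i * s)"
      using B(1) D s by (simp add: ennreal_mult ennreal_plus ennreal_power[symmetric] mult.assoc)
    also have "\<dots> \<le> ennreal ((2 ^ N * (B + D) + 24 * 2 ^ N) * s)"
    proof (rule ennreal_leI)
      have "(2::real) ^ i \<le> 2 ^ N" using i by (intro power_increasing) auto
      then have "2 ^ i * ((B + D) * s + 24 * s) \<le> 2 ^ N * ((B + D) * s + 24 * s)"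
        using B(1) D s by (intro mult_right_mono) auto
      then show "2 ^ i * (B + D) * s + 24 * 2 ^ i * s \<le> (2 ^ N * (B + D) + 24 * 2 ^ N) * s" by (simp add: algebra_simps)
    qed
    finally show "modulus ((transfer t ^^ m) g) s \<le> ennreal ((2 ^ N * (B + D) + 24 * 2 ^ N) * s)"
      unfolding m funpow_add by (simp add: p_def)
  qed (use B(1) D s0 in \<open>auto simp: s\<^sub>1_def\<close>)
qed

text \<open>The Krylov-Bogolyubov construction: \<open>transfer t (u n) - u n\<close> telescopes to
  two terms with weight \<open>c n\<close>, so the averages are asymptotically invariant, and they
  inherit the common modulus bound of the iterates, hence compactness in the mean.\<close>

lemma acip_density_exists:
  assumes t: "22 / 25 \<le> t" "t \<le> 1"
  obtains h where "acip_density t h"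
proof -
  obtain g L where g: "tent_lipschitz L g" "\<And>z. 0 \<le> g z" "L1norm g = 1"
    by (rule lipschitz_density_exists) blast
  have t_pos: "t > 0" using t by simp
  have g1: "L1norm g \<le> 1" using g(3) by simp
  obtain C s0 where C: "0 \<le> C" "0 < s0"
    "\<And>m s. 0 < s \<Longrightarrow> s \<le> s0 \<Longrightarrow> modulus ((transfer t ^^ m) g) s \<le> ennreal (C * s)"
    by (rule iterates_variation[OF t g(1) g1]) blast+
  define p where "p m = (transfer t ^^ m) g" for m
  note [measurable] = tent_lipschitz_measurable[OF g(1)]
  have pm [measurable]: "p m \<in> borel_measurable borel" for m unfolding p_def by measurable
  have p0: "0 \<le> p m z" for m z unfolding p_def by (induction m arbitrary: z) (auto simp: g(2) transfer_nonneg)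
  have pT: "p m z = 0" if "z \<notin> tent_T" for m z
    unfolding p_def by (rule transfer_pow_tent_T[OF tent_lipschitzD(3)[OF g(1)] t_pos t(2) that])
  have p1: "L1norm (p m) = 1" for m
  proof (induction m)
    case (Suc m)
    then show ?case using L1norm_transfer[OF pm[of m] p0 t_pos] by (simp add: p_def)
  qed (simp add: p_def g(3))
  define c where "c n = 1 / real (Suc n)" for n
  define u where "u n z = c n * (\<Sum>k\<le>n. p k z)" for n z
  have c: "0 \<le> c n" "c n * real (Suc n) = 1" for n by (auto simp: c_def)
  have um [measurable]: "u n \<in> borel_measurable borel" for n unfolding u_def by measurable
  have u0: "0 \<le> u n z" for n z using p0 c by (simp add: u_def sum_nonneg)
  have uT: "u n z = 0" if "z \<notin> tent_T" for n z using pT[OF that] by (simp add: u_def)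
  have cn: "ennreal (c n) * of_nat (Suc n) = 1" for n
    using c[of n] by (metis ennreal_1 ennreal_mult ennreal_of_nat_eq_real_of_nat of_nat_0_le_iff)
  have u1: "L1norm (u n) = 1" for n
  proof -
    have "L1norm (u n) = (\<integral>\<^sup>+z. ennreal (c n) * (\<Sum>k\<le>n. ennreal \<bar>p k z\<bar>) \<partial>lborel)"
      unfolding L1norm_def using u0[of n] p0 c(1)[of n]
      by (intro nn_integral_cong) (simp add: u_def sum_nonneg ennreal_mult sum_ennreal)
    also have "\<dots> = ennreal (c n) * (\<Sum>k\<le>n. L1norm (p k))"
      unfolding L1norm_def by (subst nn_integral_cmult, measurable, subst nn_integral_sum) auto
    also have "\<dots> = 1" using cn[of n] by (simp add: p1)
    finally show ?thesis .
  qed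
  have uV: "modulus (u n) s \<le> ennreal (C * s)" if s: "0 < s" "s \<le> s0" for n s
  proof -
    have "modulus (u n) s \<le> ennreal (c n) * (\<Sum>k\<le>n. modulus (p k) s)"
      unfolding u_def[abs_def] by (rule variation_average_le) (use c in auto)
    also have "\<dots> \<le> ennreal (c n) * (\<Sum>k\<le>n. ennreal (C * s))"
      using C(3)[OF s] by (intro mult_left_mono sum_mono) (auto simp: p_def)
    also have "\<dots> = (ennreal (c n) * of_nat (Suc n)) * ennreal (C * s)" by (simp add: mult.assoc)
    finally show ?thesis unfolding cn by simp
  qed
  have inv: "L1norm (\<lambda>z. transfer t (u n) z - u n z) \<le> ennreal (2 * c n)" for n
  proof -
    have "transfer t (u n) z - u n z = c n * (p (Suc n) z - p 0 z)" for z
    proof -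
      have "transfer t (u n) z = c n * (\<Sum>k\<le>n. p (Suc k) z)"
        unfolding u_def[abs_def] transfer_average by (simp add: p_def)
      moreover have "(\<Sum>k\<le>n. p (Suc k) z - p k z) = p (Suc n) z - p 0 z" by (induction n) simp_all
      ultimately show ?thesis
        by (simp add: u_def right_diff_distrib[symmetric] sum_subtractf[symmetric])
    qed
    then have "L1norm (\<lambda>z. transfer t (u n) z - u n z) = ennreal (c n) * L1norm (\<lambda>z. p (Suc n) z - p 0 z)"
      using c(1)[of n] by (simp add: L1norm_cmult)
    also have "L1norm (\<lambda>z. p (Suc n) z - p 0 z) \<le> L1norm (\<lambda>z. p (Suc n) z - 0) + L1norm (\<lambda>z. 0 - p 0 z)"
      by (rule L1norm_diff_triangle) measurable
    also have "L1norm (\<lambda>z. 0 - p 0 z) = L1norm (p 0)" by (simp add: L1norm_def)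
    also have "L1norm (\<lambda>z. p (Suc n) z - 0) + L1norm (p 0) = 2" using p1[of "Suc n"] p1[of 0] by simp
    finally have "L1norm (\<lambda>z. transfer t (u n) z - u n z) \<le> ennreal (c n) * 2" by (simp add: mult_left_mono)
    also have "\<dots> = ennreal (2 * c n)" using c(1)[of n] by (subst mult.commute[of 2]) (simp add: ennreal_mult)
    finally show ?thesis .
  qed
  have c0: "(\<lambda>n. ennreal (2 * c n)) \<longlonglongrightarrow> 0"
  proof -
    have "(\<lambda>n. 2 * c n) \<longlonglongrightarrow> 2 * 0"
      unfolding c_def by (intro tendsto_mult tendsto_const) (use LIMSEQ_inverse_real_of_nat in \<open>simp add: inverse_eq_divide\<close>)
    then have "(\<lambda>n. ennreal (2 * c n)) \<longlonglongrightarrow> ennreal (2 * 0)" by (intro tendsto_ennrealI)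
    then show ?thesis by simp
  qed
  have u1': "L1norm (u n) \<le> 1" for n using u1[of n] by simp
  show ?thesis
  proof (rule L1_compact[OF um uT u1' C(1,2) uV])
    fix r :: "nat \<Rightarrow> nat" and f
    assume r: "strict_mono r" "f \<in> borel_measurable borel" "\<And>z. z \<notin> tent_T \<Longrightarrow> f z = 0"
      "(\<lambda>n. L1norm (\<lambda>z. u (r n) z - f z)) \<longlonglongrightarrow> 0"
    have "acip_density t (\<lambda>z. max 0 (f z))"
    proof (rule approx_invariant_limit(1)[where t="\<lambda>_. t" and h="\<lambda>n. u (r n)"])
      show "(\<lambda>n. L1norm (\<lambda>z. transfer t (u (r n)) z - u (r n) z)) \<longlonglongrightarrow> 0"
      proof (rule tendsto_sandwich[OF _ _ tendsto_const])
        show "(\<lambda>n. ennreal (2 * c (r n))) \<longlonglongrightarrow> 0" using LIMSEQ_subseq_LIMSEQ[OF c0 r(1)] by (simp add: comp_def)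
      qed (auto intro!: always_eventually inv)
    qed (use t u0 u1 r in auto)
    then show ?thesis by (rule that)
  qed auto
qed

lemma uniform_variation:
  assumes t0: "22 / 25 \<le> t0" "t0 \<le> 1"
  obtains C s0 \<delta> where "0 \<le> C" "0 < s0" "0 < \<delta>"
    "\<And>t h s. 22 / 25 \<le> t \<Longrightarrow> t \<le> 1 \<Longrightarrow> dist t t0 < \<delta> \<Longrightarrow> acip_density t h \<Longrightarrow> 0 < s \<Longrightarrow> s \<le> s0 \<Longrightarrow>
      modulus h s \<le> ennreal (C * s)"
proof (rule lasota_yorke[OF t0])
  fix N :: nat and \<kappa> C s0 \<delta> :: real
  assume N: "0 < N" and \<kappa>: "0 \<le> \<kappa>" "\<kappa> < 1" and C: "0 \<le> C" and s0: "0 < s0" and \<delta>: "0 < \<delta>"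
    and LY: "\<And>t. 22 / 25 \<le> t \<Longrightarrow> t \<le> 1 \<Longrightarrow> dist t t0 < \<delta> \<Longrightarrow> contracts t N \<kappa> C s0"
  show ?thesis
  proof (rule that[of "C / (1 - \<kappa>)" s0 \<delta>])
    fix t h s
    assume t: "22 / 25 \<le> t" "t \<le> 1" "dist t t0 < \<delta>" and h: "acip_density t h" and s: "0 < s" "s \<le> s0"
    show "modulus h s \<le> ennreal (C / (1 - \<kappa>) * s)"
      by (rule invariant_variation[OF LY[OF t] \<kappa> C _ t(2) _ _ _ _ s]) (use t h in \<open>auto simp: acip_density_def\<close>)
  qed (use \<kappa> C s0 \<delta> in auto)
qed

lemma L1_tendsto_lborel_tent_T:
  fixes f :: "real \<times> real \<Rightarrow> real"
  defines "res \<equiv> \<lambda>(g :: real \<times> real \<Rightarrow> real) z. g z * indicator tent_T z"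
  shows "L1_tendsto (lborel_on tent_T) F f \<longleftrightarrow>
    (\<forall>n. integrable lborel (res (F n))) \<and> integrable lborel (res f) \<and> (\<lambda>n. L1norm (\<lambda>z. res (F n) z - res f z)) \<longlonglongrightarrow> 0"
proof -
  have "integrable (lborel_on tent_T) g \<longleftrightarrow> integrable lborel (res g)" for g :: "real \<times> real \<Rightarrow> real"
    by (subst integrable_restrict_space) (auto simp: res_def mult.commute)
  moreover have "(\<integral>\<^sup>+z. ennreal (norm (F n z - f z)) \<partial>lborel_on tent_T) = L1norm (\<lambda>z. res (F n) z - res f z)" for n
    unfolding nn_integral_lborel_tent_T L1norm_def by (intro nn_integral_cong) (auto simp: res_def indicator_def)
  ultimately show ?thesis by (simp add: L1_tendsto_def)
qed

theorem theorem2: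
  shows "statistically_stable tent_T {tent_tau..1} tent_map"
proof -
  have rng: "22 / 25 \<le> t" "0 < t" "t \<le> 1" if "t \<in> {tent_tau..1}" for t
    using that tent_tau_ge by auto
  define dens where "dens \<mu> z = leb_density tent_T \<mu> z * indicator tent_T z" for \<mu> z
  have image: "tent_map t ` tent_T \<subseteq> tent_T" if "t \<in> {tent_tau..1}" for t
    using fold_map_tent_T rng[OF that] by (auto simp: tent_map_eq_fold_map)
  have exists: "\<exists>\<mu>. acip tent_T (tent_map t) \<mu>" if "t \<in> {tent_tau..1}" for t
    using acip_density_exists[OF rng(1,3)[OF that]] acip_density_acip(1)[OF rng(2,3)[OF that]] by metis
  \<comment> \<open>An arbitrary subsequence \<open>r\<close> is fixed at once; both clauses of the
    definition are proved for it.\<close>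
  have main: "(\<exists>s. strict_mono s \<and> (\<exists>f. L1_tendsto (lborel_on tent_T) (\<lambda>k. leb_density tent_T (\<mu> (r (s k)))) f)) \<and>
      (\<forall>f. L1_tendsto (lborel_on tent_T) (\<lambda>k. leb_density tent_T (\<mu> (r k))) f \<longrightarrow>
        (\<exists>\<nu>. acip tent_T (tent_map t0) \<nu> \<and> (AE x in lborel_on tent_T. f x = leb_density tent_T \<nu> x)))"
    if t0: "t0 \<in> {tent_tau..1}" and t: "\<And>n. t n \<in> {tent_tau..1}" "t \<longlonglongrightarrow> t0"
      and \<mu>: "\<And>n. acip tent_T (tent_map (t n)) (\<mu> n)" and r: "strict_mono r"
    for t0 t and \<mu> :: "nat \<Rightarrow> (real \<times> real) measure" and r :: "nat \<Rightarrow> nat"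
  proof -
    have h: "acip_density (t n) (dens (\<mu> n))" for n
      unfolding dens_def[abs_def] by (rule leb_density_acip[OF rng(2,3)[OF t(1)] \<mu>])
    have hm [measurable]: "dens (\<mu> n) \<in> borel_measurable borel" for n using h[of n] by (simp add: acip_density_def)
    have h1: "L1norm (dens (\<mu> n)) = 1" for n using h[of n] by (simp add: acip_density_def)
    have hint: "integrable lborel (dens (\<mu> n))" for n by (simp add: integrable_iff_L1norm h1)
    have tr: "(\<lambda>n. t (r n)) \<longlonglongrightarrow> t0" using LIMSEQ_subseq_LIMSEQ[OF t(2) r] by (simp add: comp_def)
    have precompact: "\<exists>s. strict_mono s \<and> (\<exists>f. L1_tendsto (lborel_on tent_T) (\<lambda>k. leb_density tent_T (\<mu> (r (s k)))) f)"
    proof (rule uniform_variation[OF rng(1,3)[OF t0]])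
      fix C s0 \<delta> :: real
      assume C: "0 \<le> C" "0 < s0" "0 < \<delta>" and V: "\<And>t h s. 22 / 25 \<le> t \<Longrightarrow> t \<le> 1 \<Longrightarrow> dist t t0 < \<delta> \<Longrightarrow> acip_density t h \<Longrightarrow> 0 < s \<Longrightarrow> s \<le> s0 \<Longrightarrow>
        modulus h s \<le> ennreal (C * s)"
      \<comment> \<open>The uniform modulus bound holds only for parameters within
        \<open>\<delta>\<close> of \<open>t0\<close>, so the first \<open>K\<close> terms are
        skipped; the final subsequence is shifted accordingly.\<close>
      obtain K where K: "\<And>n. n \<ge> K \<Longrightarrow> dist (t (r n)) t0 < \<delta>"
        using tendstoD[OF tr C(3)] by (auto simp: eventually_sequentially)
      define F where "F n = dens (\<mu> (r (n + K)))" for n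
      have Fm: "F n \<in> borel_measurable borel" and FT: "z \<notin> tent_T \<Longrightarrow> F n z = 0" and F1: "L1norm (F n) \<le> 1" for n z
        by (simp_all add: F_def h1) (simp add: dens_def)
      have FV: "modulus (F n) s \<le> ennreal (C * s)" if "0 < s" "s \<le> s0" for n s
        unfolding F_def by (rule V[OF rng(1,3)[OF t(1)] K h that]) simp
      show ?thesis
      proof (rule L1_compact[OF Fm FT F1 C(1,2) FV])
        fix r' :: "nat \<Rightarrow> nat" and f
        assume r': "strict_mono r'" "f \<in> borel_measurable borel" "\<And>z. z \<notin> tent_T \<Longrightarrow> f z = 0"
          "(\<lambda>n. L1norm (\<lambda>z. F (r' n) z - f z)) \<longlonglongrightarrow> 0"
        define s where "s n = r' n + K" for n
        have "strict_mono s" using r'(1) by (simp add: s_def strict_mono_def)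
        moreover have "L1_tendsto (lborel_on tent_T) (\<lambda>k. leb_density tent_T (\<mu> (r (s k)))) f"
        proof -
          have f: "f z * indicator tent_T z = f z" for z using r'(3)[of z] by (cases "z \<in> tent_T") auto
          \<comment> \<open>\<open>L1_tendsto\<close> includes integrability of the limit, which
            follows from being at finite distance from one member.\<close>
          have "\<forall>\<^sub>F n in sequentially. L1norm (\<lambda>z. F (r' n) z - f z) < 1"
            by (rule order_tendstoD(2)[OF r'(4)]) simp
          from eventually_happens'[OF sequentially_bot this] obtain n where n: "L1norm (\<lambda>z. F (r' n) z - f z) < 1" ..
          have "L1norm (\<lambda>z. f z - 0) \<le> L1norm (\<lambda>z. f z - F (r' n) z) + L1norm (\<lambda>z. F (r' n) z - 0)"
            by (rule L1norm_diff_triangle) (use r'(2) Fm in auto)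
          also have "\<dots> \<le> 1 + 1"
            using n F1[of "r' n"] by (intro add_mono) (auto simp: L1norm_minus_commute[of f])
          also have "\<dots> < \<infinity>" by simp
          finally have "integrable lborel f" using r'(2) by (simp add: integrable_iff_L1norm)
          then show ?thesis
            unfolding L1_tendsto_lborel_tent_T f dens_def[symmetric]
            using hint r'(4) by (auto simp: F_def s_def)
        qed
        ultimately show ?thesis by blast
      qed auto
    qed
    have limit: "\<exists>\<nu>. acip tent_T (tent_map t0) \<nu> \<and> (AE x in lborel_on tent_T. f x = leb_density tent_T \<nu> x)"
      if L: "L1_tendsto (lborel_on tent_T) (\<lambda>k. leb_density tent_T (\<mu> (r k))) f" for f
    proof -
      define f' where "f' z = f z * indicator tent_T z" for z
      have f': "integrable lborel f'" "(\<lambda>n. L1norm (\<lambda>z. dens (\<mu> (r n)) z - f' z)) \<longlonglongrightarrow> 0"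
        using L unfolding L1_tendsto_lborel_tent_T by (simp_all add: f'_def[abs_def] dens_def[abs_def])
      have [measurable]: "f' \<in> borel_measurable borel" using f'(1) by auto
      have zero: "L1norm (\<lambda>z. transfer (t (r n)) (dens (\<mu> (r n))) z - dens (\<mu> (r n)) z) = 0" for n
        by (subst L1norm_eq_0_iff) (use h[of "r n"] in \<open>auto simp: acip_density_def\<close>)
      have A: "acip_density t0 (\<lambda>z. max 0 (f' z))" and B: "AE z in lborel. f' z = max 0 (f' z)"
        using approx_invariant_limit[where t="\<lambda>n. t (r n)" and h="\<lambda>n. dens (\<mu> (r n))" and f=f',
            OF rng(1,3)[OF t0] rng(1,3)[OF t(1)] tr hm _ h1 _ _ _ f'(2)] h zero
        by (auto simp: acip_density_def f'_def)
      define \<nu> where "\<nu> = density (lborel_on tent_T) (\<lambda>z. ennreal (max 0 (f' z)))"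
      note C = acip_density_acip[OF rng(2,3)[OF t0] A, folded \<nu>_def]
      \<comment> \<open>The given limit is nonnegative only almost everywhere; it is identified with
        the positive part from which \<open>\<nu>\<close> is built.\<close>
      have "AE z in lborel_on tent_T. f z = max 0 (f' z)"
        unfolding AE_lborel_tent_T using B by eventually_elim (auto simp: f'_def)
      then have "AE z in lborel_on tent_T. f z = leb_density tent_T \<nu> z"
        using C(2) by eventually_elim simp
      then show ?thesis using C(1) by blast
    qed
    show ?thesis using precompact limit by blast
  qed
  show ?thesis
    unfolding statistically_stable_def
    using compact_tent_T image exists main by blast
qed

end
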